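(* Let $S^{\mathbf u}_{2,GMS}$ be the general metric space sensitivity index with respect to $\mathbf u$, and let $\widehat S^{\mathbf u}_{2,GMS}$ be its U-statistics estimator built from an i.i.d. sample $(\mathbf Z_1,\dots,\mathbf Z_N)$ with distribution $\mathbb P_2^{\mathbf u}$ (all objects as defined in the context). If for every $j=1,\dots,4$ $$\mathbb E\left[\Phi_j^s\left(\mathbf Z_1,\dots,\mathbf Z_{M(j)}\right)^2\right]<\infty ,$$ then $$\sqrt N\left(\widehat S^{\mathbf u}_{2,GMS}-S^{\mathbf u}_{2,GMS}\right)\longrightarrow \mathcal N(0,\sigma^2)\quad\text{in distribution as } N\to\infty,$$ where the asymptotic variance is $\sigma^2=g^{\top}\Gamma g$, with $\Gamma$ the $4\times4$ matrix $$\Gamma(i,j)=M(i)M(j)\,\mathrm{Cov}\left(\mathbb E[\Phi_i^s(\mathbf Z_1,\dots,\mathbf Z_{M(i)})\mid \mathbf Z_1],\ \mathbb E[\Phi_j^s(\mathbf Z_1,\dots,\mathbf Z_{M(j)})\mid \mathbf Z_1]\right),\quad 1\le i,j\le 4,$$ and $g=\nabla\Psi\left(I(\Phi_1^s),I(\Phi_2^s),I(\Phi_3^s),I(\Phi_4^s)\right)$, where $\nabla\Psi(x,y,z,t)=(z-t)^{-2}\,(z-t,\,-z+t,\,-x+y,\,x-y)^{\top}$.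
   Context: **Model.** Let $(E_1,\mathcal A_1),\dots,(E_p,\mathcal A_p)$ be measurable spaces, $E=E_1\times\dots\times E_p$, $(\mathcal X,d)$ a separable metric space (with its Borel $\sigma$-algebra), and $f:E\to\mathcal X$ a measurable function. Let $X_1,\dots,X_p$ be mutually independent random elements, $X_i$ with values in $E_i$, all defined on one probability space, and let $Z=f(X_1,\dots,X_p)$. Denote by $\mathbb P$ also the distribution of $Z$ on $\mathcal X$. Fix $\mathbf u\subset\{1,\dots,p\}$ and write $X_{\mathbf u}=(X_i)_{i\in\mathbf u}$. **Test functions.** Let $m\ge 1$ be an integer and let $(a,x)\mapsto T_a(x)$, $\mathcal X^m\times\mathcal X\to\mathbb R$, be a measurable function belonging to $L^2(\mathbb P^{\otimes m}\otimes\mathbb P)$. By convention $m=0$ means that $T_a=T$ does not depend on $a$ (and then there is no integration over $a$). **Index.** The general metric space sensitivity index with respect to $\mathbf u$ is $$S^{\mathbf u}_{2,GMS}=\frac{\int_{\mathcal X^m}\mathbb E\left[\left(\mathbb E[T_a(Z)]-\mathbb E[T_a(Z)\mid X_{\mathbf u}]\right)^2\right]d\mathbb P^{\otimes m}(a)}{\int_{\mathcal X^m}\mathrm{Var}(T_a(Z))\,d\mathbb P^{\otimes m}(a)},$$ where the denominator is assumed to be nonzero so that the index is well defined. **Pick-Freeze copy.** Let $(X_1',\dots,X_p')$ be an independent copy of $(X_1,\dots,X_p)$. Let $X^{\mathbf u}$ be the vector with $X^{\mathbf u}_i=X_i$ if $i\in\mathbf u$ and $X^{\mathbf u}_i=X_i'$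 if $i\notin\mathbf u$, and set $Z^{\mathbf u}=f(X^{\mathbf u})$. Let $\mathbf Z=(Z,Z^{\mathbf u})^\top$ and let $\mathbb P_2^{\mathbf u}$ be its law on $\mathcal X^2$. Let $\mathbf Z_1,\mathbf Z_2,\dots$ be i.i.d. with law $\mathbb P_2^{\mathbf u}$. **Kernels.** For $\mathbf z_i=(z_i,z_i^{\mathbf u})^\top\in\mathcal X^2$ define - $\Phi_1(\mathbf z_1,\dots,\mathbf z_{m+1})=T_{z_1,\dots,z_m}(z_{m+1})\,T_{z_1,\dots,z_m}(z_{m+1}^{\mathbf u})$, - $\Phi_2(\mathbf z_1,\dots,\mathbf z_{m+2})=T_{z_1,\dots,z_m}(z_{m+1})\,T_{z_1,\dots,z_m}(z_{m+2}^{\mathbf u})$, - $\Phi_3(\mathbf z_1,\dots,\mathbf z_{m+1})=T_{z_1,\dots,z_m}(z_{m+1})^2$, - $\Phi_4(\mathbf z_1,\dots,\mathbf z_{m+2})=T_{z_1,\dots,z_m}(z_{m+1})\,T_{z_1,\dots,z_m}(z_{m+2})$. Set $M(1)=M(3)=m+1$ and $M(2)=M(4)=m+2$. The symmetrized kernels are $$\Phi_j^s(\mathbf z_1,\dots,\mathbf z_{M(j)})=\frac1{M(j)!}\sum_{\tau\in\mathcal S_{M(j)}}\Phi_j(\mathbf z_{\tau(1)},\dots,\mathbf z_{\tau(M(j))}),$$ where $\mathcal S_k$ is the group of all permutations of $\{1,\dots,k\}$. For a kernel $\Phi=\Phi_j$ or $\Phi_j^s$ let $I(\Phi)=\int\Phi(\mathbf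 z_1,\dots,\mathbf z_{M(j)})\,d(\mathbb P_2^{\mathbf u})^{\otimes M(j)}(\mathbf z_1,\dots,\mathbf z_{M(j)})$, the integral being over $(\mathcal X^2)^{M(j)}$. **Estimator.** For $N\ge m+2$ and $j=1,\dots,4$ let $$U_{j,N}=\binom{N}{M(j)}^{-1}\sum_{1\le i_1<\dots<i_{M(j)}\le N}\Phi_j^s(\mathbf Z_{i_1},\dots,\mathbf Z_{i_{M(j)}}).$$ Let $\Psi(x,y,z,t)=\dfrac{x-y}{z-t}$ (for $z\neq t$). The estimator is $$\widehat S^{\mathbf u}_{2,GMS}=\Psi(U_{1,N},U_{2,N},U_{3,N},U_{4,N})=\frac{U_{1,N}-U_{2,N}}{U_{3,N}-U_{4,N}},$$ with an arbitrary fixed value (say $0$) on the event $U_{3,N}=U_{4,N}$. $\mathcal N(0,\sigma^2)$ is the centered Gaussian law with variance $\sigma^2$ (the Dirac mass at $0$ if $\sigma^2=0$). *)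

theory Defs
  imports "HOL-Probability.Probability"
begin

text \<open>Tuples indexed by \<open>J\<close> are the extensional functions of the library's product \<open>PiM J\<close>; the
  factors \<open>E i\<close> may carry different carriers and \<open>\<sigma>\<close>-algebras inside one ambient type.\<close>

definition random_tuple :: "nat set \<Rightarrow> (nat \<Rightarrow> 'w \<Rightarrow> 'e) \<Rightarrow> 'w \<Rightarrow> nat \<Rightarrow> 'e" where
  "random_tuple J X \<omega> = (\<lambda>i\<in>J. X i \<omega>)"

definition model_output ::
    "nat \<Rightarrow> ((nat \<Rightarrow> 'e) \<Rightarrow> 'x) \<Rightarrow> (nat \<Rightarrow> 'w \<Rightarrow> 'e) \<Rightarrow> 'w \<Rightarrow> 'x" where
  "model_output p f X \<omega> = f (random_tuple {1..p} X \<omega>)"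

definition pick_freeze ::
    "nat set \<Rightarrow> (nat \<Rightarrow> 'w \<Rightarrow> 'e) \<Rightarrow> (nat \<Rightarrow> 'w \<Rightarrow> 'e) \<Rightarrow> nat \<Rightarrow> 'w \<Rightarrow> 'e" where
  "pick_freeze u X X' i = (if i \<in> u then X i else X' i)"

definition output_law ::
    "'w measure \<Rightarrow> nat \<Rightarrow> ((nat \<Rightarrow> 'e) \<Rightarrow> 'x::topological_space) \<Rightarrow> (nat \<Rightarrow> 'w \<Rightarrow> 'e) \<Rightarrow> 'x measure" where
  "output_law M p f X = distr M borel (model_output p f X)"

definition pair_law ::
    "'w measure \<Rightarrow> nat \<Rightarrow> ((nat \<Rightarrow> 'e) \<Rightarrow> 'x::topological_space) \<Rightarrow> nat set \<Rightarrow>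
      (nat \<Rightarrow> 'w \<Rightarrow> 'e) \<Rightarrow> (nat \<Rightarrow> 'w \<Rightarrow> 'e) \<Rightarrow> ('x \<times> 'x) measure" where
  "pair_law M p f u X X' =
     distr M (borel \<Otimes>\<^sub>M borel)
       (\<lambda>\<omega>. (model_output p f X \<omega>, model_output p f (pick_freeze u X X') \<omega>))"

definition cond_exp_given ::
    "'w measure \<Rightarrow> 'b measure \<Rightarrow> ('w \<Rightarrow> 'b) \<Rightarrow> ('w \<Rightarrow> real) \<Rightarrow> 'w \<Rightarrow> real" where
  "cond_exp_given M N Y h = real_cond_exp M (vimage_algebra (space M) Y N) h"

definition covariance :: "'w measure \<Rightarrow> ('w \<Rightarrow> real) \<Rightarrow> ('w \<Rightarrow> real) \<Rightarrow> real" where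
  "covariance M V W = (\<integral>\<omega>. (V \<omega> - (\<integral>v. V v \<partial>M)) * (W \<omega> - (\<integral>v. W v \<partial>M)) \<partial>M)"

text \<open>For \<open>m = 0\<close> the product \<open>PiM {1..m} (\<lambda>_. P)\<close> is the unit mass at the empty tuple, so the
  integrals over \<open>a\<close> below disappear and \<open>T\<close> has no parameter.\<close>

definition gms_numerator ::
    "'w measure \<Rightarrow> (nat \<Rightarrow> 'e measure) \<Rightarrow> nat \<Rightarrow> ((nat \<Rightarrow> 'e) \<Rightarrow> 'x::topological_space) \<Rightarrow> nat set \<Rightarrow>
      (nat \<Rightarrow> 'w \<Rightarrow> 'e) \<Rightarrow> nat \<Rightarrow> ((nat \<Rightarrow> 'x) \<Rightarrow> 'x \<Rightarrow> real) \<Rightarrow> real" where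
  "gms_numerator M E p f u X m T =
     (\<integral>a. (\<integral>\<omega>. ((\<integral>v. T a (model_output p f X v) \<partial>M)
                - cond_exp_given M (PiM u E) (random_tuple u X)
                    (\<lambda>v. T a (model_output p f X v)) \<omega>)\<^sup>2 \<partial>M)
      \<partial>(PiM {1..m} (\<lambda>_. output_law M p f X)))"

definition gms_denominator ::
    "'w measure \<Rightarrow> nat \<Rightarrow> ((nat \<Rightarrow> 'e) \<Rightarrow> 'x::topological_space) \<Rightarrow>
      (nat \<Rightarrow> 'w \<Rightarrow> 'e) \<Rightarrow> nat \<Rightarrow> ((nat \<Rightarrow> 'x) \<Rightarrow> 'x \<Rightarrow> real) \<Rightarrow> real" where
  "gms_denominator M p f X m T =
     (\<integral>a. prob_space.variance M (\<lambda>v. T a (model_output p f X v))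
      \<partial>(PiM {1..m} (\<lambda>_. output_law M p f X)))"

definition gms_index ::
    "'w measure \<Rightarrow> (nat \<Rightarrow> 'e measure) \<Rightarrow> nat \<Rightarrow> ((nat \<Rightarrow> 'e) \<Rightarrow> 'x::topological_space) \<Rightarrow> nat set \<Rightarrow>
      (nat \<Rightarrow> 'w \<Rightarrow> 'e) \<Rightarrow> nat \<Rightarrow> ((nat \<Rightarrow> 'x) \<Rightarrow> 'x \<Rightarrow> real) \<Rightarrow> real" where
  "gms_index M E p f u X m T = gms_numerator M E p f u X m T / gms_denominator M p f X m T"

text \<open>The four kernels are indexed by the numeral type \<open>4\<close>, whose elements are \<open>1, 2, 3\<close> and
  \<open>4 = 0\<close>, so that vectors in \<open>real ^ 4\<close> and matrices can be indexed by them.\<close>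

definition arity :: "nat \<Rightarrow> 4 \<Rightarrow> nat" where
  "arity m j = (if j = 1 \<or> j = 3 then m + 1 else m + 2)"

definition kernel ::
    "nat \<Rightarrow> ((nat \<Rightarrow> 'x) \<Rightarrow> 'x \<Rightarrow> real) \<Rightarrow> 4 \<Rightarrow> (nat \<Rightarrow> 'x \<times> 'x) \<Rightarrow> real" where
  "kernel m T j z =
     (let Ta = T (\<lambda>i\<in>{1..m}. fst (z i)) in
      if j = 1 then Ta (fst (z (m + 1))) * Ta (snd (z (m + 1)))
      else if j = 2 then Ta (fst (z (m + 1))) * Ta (snd (z (m + 2)))
      else if j = 3 then (Ta (fst (z (m + 1))))\<^sup>2
      else Ta (fst (z (m + 1))) * Ta (fst (z (m + 2))))"

definition symmetrize :: "nat \<Rightarrow> ((nat \<Rightarrow> 'a) \<Rightarrow> real) \<Rightarrow> (nat \<Rightarrow> 'a) \<Rightarrow> real" where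
  "symmetrize k \<Phi> z = (\<Sum>\<tau> | \<tau> permutes {1..k}. \<Phi> (\<lambda>i. z (\<tau> i))) / fact k"

definition sym_kernel ::
    "nat \<Rightarrow> ((nat \<Rightarrow> 'x) \<Rightarrow> 'x \<Rightarrow> real) \<Rightarrow> 4 \<Rightarrow> (nat \<Rightarrow> 'x \<times> 'x) \<Rightarrow> real" where
  "sym_kernel m T j = symmetrize (arity m j) (kernel m T j)"

definition u_statistic :: "nat \<Rightarrow> ((nat \<Rightarrow> 'a) \<Rightarrow> real) \<Rightarrow> nat \<Rightarrow> (nat \<Rightarrow> 'a) \<Rightarrow> real" where
  "u_statistic k \<Phi> N z =
     (\<Sum>i \<in> {i \<in> {1..k} \<rightarrow>\<^sub>E {1..N}. strict_mono_on {1..k} i}. \<Phi> (\<lambda>l\<in>{1..k}. z (i l)))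
       / real (N choose k)"

text \<open>With \<open>x / 0 = 0\<close> the estimator takes the value \<open>0\<close> where its denominator vanishes.\<close>

definition Psi :: "real ^ 4 \<Rightarrow> real" where
  "Psi v = (v $ 1 - v $ 2) / (v $ 3 - v $ 4)"

definition grad_Psi :: "real ^ 4 \<Rightarrow> real ^ 4" where
  "grad_Psi v = (1 / (v $ 3 - v $ 4)\<^sup>2) *\<^sub>R
     vector [v $ 3 - v $ 4, - (v $ 3) + v $ 4, - (v $ 1) + v $ 2, v $ 1 - v $ 2]"

lemma GDERIV_Psi:
  assumes "v $ 3 \<noteq> v $ 4"
  shows "GDERIV Psi v :> grad_Psi v"
proof -
  have c: "((\<lambda>v::real^4. v $ i) has_derivative (\<lambda>h. h $ i)) (at v)" for i
    by (rule bounded_linear_imp_has_derivative) (rule bounded_linear_vec_nth)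
  have "((\<lambda>v. (v $ 1 - v $ 2) / (v $ 3 - v $ 4)) has_derivative
      (\<lambda>h. - (v $ 1 - v $ 2) * (inverse (v $ 3 - v $ 4) * (h $ 3 - h $ 4) * inverse (v $ 3 - v $ 4))
         + (h $ 1 - h $ 2) / (v $ 3 - v $ 4))) (at v)"
    using assms by (intro has_derivative_divide has_derivative_diff c) auto
  moreover have "- (v $ 1 - v $ 2) * (inverse (v $ 3 - v $ 4) * (h $ 3 - h $ 4) * inverse (v $ 3 - v $ 4))
         + (h $ 1 - h $ 2) / (v $ 3 - v $ 4) = h \<bullet> grad_Psi v" for h
    using assms
    by (simp add: grad_Psi_def inner_vec_def sum_4 vector_def power2_eq_square divide_simps)
       (simp add: algebra_simps)
  ultimately show ?thesis
    unfolding gderiv_def Psi_def[abs_def] by simp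
qed

definition estimator ::
    "nat \<Rightarrow> ((nat \<Rightarrow> 'x) \<Rightarrow> 'x \<Rightarrow> real) \<Rightarrow> nat \<Rightarrow> (nat \<Rightarrow> 'x \<times> 'x) \<Rightarrow> real" where
  "estimator m T N z = Psi (\<chi> j. u_statistic (arity m j) (sym_kernel m T j) N z)"

definition kernel_means ::
    "nat \<Rightarrow> ((nat \<Rightarrow> 'x) \<Rightarrow> 'x \<Rightarrow> real) \<Rightarrow> ('x \<times> 'x) measure \<Rightarrow> real ^ 4" where
  "kernel_means m T Q = (\<chi> j. \<integral>z. sym_kernel m T j z \<partial>(PiM {1..arity m j} (\<lambda>_. Q)))"

definition sample_kernel ::
    "nat \<Rightarrow> ((nat \<Rightarrow> 'x) \<Rightarrow> 'x \<Rightarrow> real) \<Rightarrow> (nat \<Rightarrow> 's \<Rightarrow> 'x \<times> 'x) \<Rightarrow> 4 \<Rightarrow> 's \<Rightarrow> real" where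
  "sample_kernel m T ZZ j \<omega> = sym_kernel m T j (\<lambda>i\<in>{1..arity m j}. ZZ i \<omega>)"

definition Gamma_matrix ::
    "'s measure \<Rightarrow> nat \<Rightarrow> ((nat \<Rightarrow> 'x::topological_space) \<Rightarrow> 'x \<Rightarrow> real) \<Rightarrow>
      (nat \<Rightarrow> 's \<Rightarrow> 'x \<times> 'x) \<Rightarrow> real ^ 4 ^ 4" where
  "Gamma_matrix S m T ZZ = (\<chi> i j.
     real (arity m i) * real (arity m j) *
     covariance S
       (cond_exp_given S (borel \<Otimes>\<^sub>M borel) (ZZ 1) (sample_kernel m T ZZ i))
       (cond_exp_given S (borel \<Otimes>\<^sub>M borel) (ZZ 1) (sample_kernel m T ZZ j)))"

definition centered_gaussian :: "real \<Rightarrow> real measure" where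
  "centered_gaussian v =
     (if v = 0 then return borel 0 else density lborel (normal_density 0 (sqrt v)))"

end

theory Submission
  imports Defs "HOL-Real_Asymp.Real_Asymp"
begin

text \<open>
  Let \<open>U\<close> be the vector of the four U-statistics, \<open>\<theta>\<close> its mean and
  \<open>b = \<theta>\<^sub>3 - \<theta>\<^sub>4\<close>. Conditioning on the parameters \<open>a\<close> of the test function shows that \<open>b\<close>
  is the denominator of the index and that \<open>\<theta>\<^sub>1 - \<theta>\<^sub>2\<close> is its numerator, so the index is \<open>Psi \<theta>\<close>
  (\<open>index_eq_Psi\<close>). The only point in this that is not Fubini's theorem is the identity
  \<open>E[T(Z) T(Z\<^sup>u)] = E[E[T(Z) | X\<^sub>u]\<^sup>2]\<close>. It holds because redrawing the coordinates outside \<open>u\<close>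
  does not change the law of the inputs, and averaging over the redrawn coordinates is the conditional
  expectation given \<open>X\<^sub>u\<close> (locale \<open>resampling\<close>).

  With \<open>r = Psi \<theta>\<close> and \<open>g = grad_Psi \<theta> = (1, -1, -r, r) / b\<close>, the centred estimator is,
  wherever \<open>U\<^sub>3 \<noteq> U\<^sub>4\<close>, exactly a quotient:
  \<open>sqrt N * (Psi U - Psi \<theta>) = sqrt N * (g \<bullet> (U - \<theta>)) / ((U\<^sub>3 - U\<^sub>4) / b)\<close>.
  The numerator is linear in \<open>U\<close> and the denominator tends to \<open>1\<close>, so the delta method reduces to a
  scalar Slutsky lemma for quotients (\<open>slutsky_divide\<close>).

  The numerator is treated with Hoeffding's projection. Subtracting from a symmetric kernel its mean
  and its projections on single observations leaves a residual that integrates to zero over all but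
  one of its arguments. Residuals on index sets with at most one common index are therefore
  orthogonal. The proportion of pairs of \<open>k\<close>-subsets of \<open>{1..N}\<close> with two common indices is of order
  \<open>1 / N\<^sup>2\<close>, so \<open>sqrt N\<close> times the averaged residual tends to \<open>0\<close> in mean square
  (\<open>hoeffding_projection\<close>). What is left is a normalised sum of i.i.d. terms \<open>influence g (Z n)\<close>
  to which the one-dimensional central limit theorem applies. Because the projections are the
  centred conditional expectations given one observation
  (\<open>conditional_expectation_given_first\<close>), its variance is the quadratic form
  \<open>g \<bullet> (\<Gamma> *v g)\<close> (\<open>influence_variance\<close>).
\<close>

section \<open>Counting increasing index maps and overlapping subsets\<close>

text \<open>An increasing map lists its range in order, so it can be recovered from the range as the sorted
  list of that set. Sums over increasing maps thereby become sums over subsets.\<close>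
lemma bij_betw_increasing_maps_subsets:
  "bij_betw (\<lambda>i. i ` {1..k}) {i \<in> {1..k} \<rightarrow>\<^sub>E {1..N}. strict_mono_on {1..k} i}
     {A. A \<subseteq> {1..N::nat} \<and> card A = k}"
proof (intro bij_betwI')
  have list: "sorted_list_of_set (i ` {1..k}) = map i [1..<Suc k]" 
    if i: "strict_mono_on {1..k} i" for i :: "nat \<Rightarrow> nat"
  proof -
    have "inj_on i {1..k}" using i by (rule strict_mono_on_imp_inj_on)
    hence "card (i ` {1..k}) = k" by (simp add: card_image)
    moreover have "sorted_wrt (<) (map i [1..<Suc k])"
      using i by (auto simp: sorted_wrt_map strict_mono_on_def simp del: upt_Suc
          intro!: sorted_wrt_mono_rel[OF _ sorted_wrt_upt])
    moreover have "set (map i [1..<Suc k]) = i ` {1..k}" by auto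
    ultimately show ?thesis
      by (subst sorted_list_of_set_unique[symmetric]) (auto simp del: upt_Suc)
  qed
  fix i i' assume i: "i \<in> {i \<in> {1..k} \<rightarrow>\<^sub>E {1..N}. strict_mono_on {1..k} i}"
    and i': "i' \<in> {i \<in> {1..k} \<rightarrow>\<^sub>E {1..N}. strict_mono_on {1..k} i}"
  show "(i ` {1..k} = i' ` {1..k}) = (i = i')"
  proof
    assume "i ` {1..k} = i' ` {1..k}"
    hence "map i [1..<Suc k] = map i' [1..<Suc k]" using list[of i] list[of i'] i i' by simp
    hence "i l = i' l" if "l \<in> {1..k}" for l using that by (auto simp del: upt_Suc)
    moreover have "i \<in> extensional {1..k}" "i' \<in> extensional {1..k}" using i i' by (auto simp: PiE_def)
    ultimately show "i = i'" by (intro extensionalityI) auto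
  qed simp
next
  fix i assume "i \<in> {i \<in> {1..k} \<rightarrow>\<^sub>E {1..N}. strict_mono_on {1..k} i}"
  thus "i ` {1..k} \<in> {A. A \<subseteq> {1..N} \<and> card A = k}"
    using strict_mono_on_imp_inj_on[of "{1..k}" i] by (auto simp: card_image)
next
  fix A assume A: "A \<in> {A. A \<subseteq> {1..N} \<and> card A = k}"
  define xs where "xs = sorted_list_of_set A"
  have fin: "finite A" using A finite_subset by blast
  have xs: "sorted_wrt (<) xs" "set xs = A" "length xs = k"
    using A fin by (auto simp: xs_def)
  define i where "i = (\<lambda>l\<in>{1..k}. xs ! (l - 1))"
  have "i ` {1..k} = set xs"
  proof -
    have "i ` {1..k} = (\<lambda>l. xs ! l) ` ((\<lambda>l. l - 1) ` {1..k})"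
      unfolding image_image by (intro image_cong) (auto simp: i_def)
    also have "(\<lambda>l. l - 1) ` {1..k} = {0..<length xs}"
      using xs(3) by (auto simp: image_iff intro!: bexI[of _ "Suc _"])
    finally show ?thesis by (simp add: nth_image[of "length xs" xs, simplified])
  qed
  moreover have "strict_mono_on {1..k} i"
    using xs by (auto simp: i_def strict_mono_on_def sorted_wrt_iff_nth_less)
  moreover have "i \<in> {1..k} \<rightarrow>\<^sub>E {1..N}"
    using calculation(1) A xs by (auto simp: i_def PiE_def)
  ultimately show "\<exists>i\<in>{i \<in> {1..k} \<rightarrow>\<^sub>E {1..N}. strict_mono_on {1..k} i}. A = i ` {1..k}"
    using xs by auto
qed

lemma card_supersets_of_size:
  assumes "finite I" "B \<subseteq> I" "card B \<le> k"
  shows "card {A. A \<subseteq> I \<and> card A = k \<and> B \<subseteq> A} = (card I - card B) choose (k - card B)"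
proof -
  have fB: "finite B" using assms finite_subset by blast
  have "bij_betw (\<lambda>A. A - B) {A. A \<subseteq> I \<and> card A = k \<and> B \<subseteq> A} {A. A \<subseteq> I - B \<and> card A = k - card B}"
  proof (rule bij_betw_byWitness[where f' = "\<lambda>A. A \<union> B"])
    show "(\<lambda>A. A \<union> B) ` {A. A \<subseteq> I - B \<and> card A = k - card B} \<subseteq> {A. A \<subseteq> I \<and> card A = k \<and> B \<subseteq> A}"
    proof safe
      fix A assume A: "A \<subseteq> I - B" "card A = k - card B"
      hence "card (A \<union> B) = card A + card B"
        using assms fB by (intro card_Un_disjoint) (auto intro: finite_subset)
      thus "card (A \<union> B) = k" using A assms by simp
    qed (use assms in auto)
  qed (use assms fB in \<open>auto simp: card_Diff_subset\<close>)
  hence "card {A. A \<subseteq> I \<and> card A = k \<and> B \<subseteq> A} = card {A. A \<subseteq> I - B \<and> card A = k - card B}"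
    by (rule bij_betw_same_card)
  also have "\<dots> = (card (I - B)) choose (k - card B)"
    using assms by (intro n_subsets) auto
  finally show ?thesis using assms fB by (simp add: card_Diff_subset)
qed

text \<open>Union bound: a pair sharing at least two elements contains a common two-element set \<open>B\<close>, and
  for each \<open>B\<close> both members of the pair are among the \<open>k\<close>-sets containing \<open>B\<close>.\<close>
lemma card_pairs_sharing_two:
  assumes I: "finite I" and "2 \<le> k"
  shows "card {(A, A'). A \<subseteq> I \<and> card A = k \<and> A' \<subseteq> I \<and> card A' = k \<and> 2 \<le> card (A \<inter> A')}
    \<le> (card I choose 2) * ((card I - 2) choose (k - 2))\<^sup>2"
proof -
  let ?P = "{B. B \<subseteq> I \<and> card B = 2}"
  let ?S = "\<lambda>B. {A. A \<subseteq> I \<and> card A = k \<and> B \<subseteq> A}"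
  have fS: "finite (?S B)" for B using I by auto
  have "{(A, A'). A \<subseteq> I \<and> card A = k \<and> A' \<subseteq> I \<and> card A' = k \<and> 2 \<le> card (A \<inter> A')}
     \<subseteq> (\<Union>B\<in>?P. ?S B \<times> ?S B)"
  proof safe
    fix A A' assume A: "A \<subseteq> I" "A' \<subseteq> I" "2 \<le> card (A \<inter> A')" "k = card A" "card A' = card A"
    obtain B where "B \<subseteq> A \<inter> A'" "card B = 2"
      using A(3) by (meson obtain_subset_with_card_n)
    thus "(A, A') \<in> (\<Union>B\<in>?P. {Aa. Aa \<subseteq> I \<and> card Aa = card A \<and> B \<subseteq> Aa} \<times> {Aa. Aa \<subseteq> I \<and> card Aa = card A \<and> B \<subseteq> Aa})"
      using A by auto
  qed
  hence "card {(A, A'). A \<subseteq> I \<and> card A = k \<and> A' \<subseteq> I \<and> card A' = k \<and> 2 \<le> card (A \<inter> A')}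
     \<le> card (\<Union>B\<in>?P. ?S B \<times> ?S B)"
    using I fS by (intro card_mono) auto
  also have "\<dots> \<le> (\<Sum>B\<in>?P. card (?S B \<times> ?S B))"
    using I by (intro card_UN_le) auto
  also have "\<dots> = (\<Sum>B\<in>?P. ((card I - 2) choose (k - 2))\<^sup>2)"
    using assms card_supersets_of_size[OF I, of _ k]
    by (intro sum.cong) (auto simp: card_cartesian_product power2_eq_square)
  also have "\<dots> = (card I choose 2) * ((card I - 2) choose (k - 2))\<^sup>2"
    using n_subsets[OF I, of 2] by simp
  finally show ?thesis .
qed

text \<open>Dividing by the number of all pairs leaves a quantity of order \<open>1 / N\<^sup>2\<close>; the absorption identity
  for binomial coefficients makes the constant explicit. For \<open>k = 1\<close> both sides vanish.\<close>
lemma fraction_of_pairs_sharing_two: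
  assumes N: "2 \<le> N" "k \<le> N" and k: "1 \<le> k"
  shows "real (card {(A, A'). A \<subseteq> {1..N} \<and> card A = k \<and> A' \<subseteq> {1..N} \<and> card A' = k \<and> 2 \<le> card (A \<inter> A')})
    \<le> (real k * (real k - 1))\<^sup>2 / (2 * real N * (real N - 1)) * (real (N choose k))\<^sup>2"
    (is "real (card ?T) \<le> ?r")
proof (cases "k \<ge> 2")
  case True
  have N0: "real N > 0" "real N - 1 > 0" using N by auto
  have C: "real (N choose k) > 0" using N by simp
  have "card ?T \<le> (N choose 2) * ((N - 2) choose (k - 2))\<^sup>2"
    using card_pairs_sharing_two[of "{1..N}" k] True by simp
  hence le: "real (card ?T) \<le> real (N choose 2) * (real ((N - 2) choose (k - 2)))\<^sup>2"
    unfolding of_nat_power[symmetric] of_nat_mult[symmetric] of_nat_le_iff .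
  have "2 * (N choose 2) = N * (N - 1)"
    using times_binomial_minus1_eq[of 2 N] by (simp add: choose_one[unfolded One_nat_def])
  hence "real (2 * (N choose 2)) = real (N * (N - 1))" by simp
  hence c2: "real (N choose 2) = real N * (real N - 1) / 2"
    using N by (simp add: of_nat_diff)
  have 1: "real k * real (N choose k) = real N * real ((N - 1) choose (k - 1))"
    unfolding of_nat_mult[symmetric] of_nat_eq_iff using True by (intro times_binomial_minus1_eq) simp
  have 2: "(real k - 1) * real ((N - 1) choose (k - 1)) = (real N - 1) * real ((N - 2) choose (k - 2))"
  proof -
    have "(k - 1) * ((N - 1) choose (k - 1)) = (N - 1) * ((N - 1 - 1) choose (k - 1 - 1))"
      using True by (intro times_binomial_minus1_eq) simp
    hence "real (k - 1) * real ((N - 1) choose (k - 1)) = real (N - 1) * real ((N - 2) choose (k - 2))"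
      unfolding of_nat_mult[symmetric] of_nat_eq_iff by (simp add: numeral_2_eq_2 One_nat_def)
    thus ?thesis using True N by (simp add: of_nat_diff)
  qed
  have "real k * (real k - 1) * real (N choose k) = real N * (real N - 1) * real ((N - 2) choose (k - 2))"
    using 1 2 by algebra
  hence "real ((N - 2) choose (k - 2)) = real k * (real k - 1) * real (N choose k) / (real N * (real N - 1))"
    using N0 by (simp add: field_simps)
  hence b: "(real ((N - 2) choose (k - 2)))\<^sup>2
      = (real k * (real k - 1))\<^sup>2 * (real (N choose k))\<^sup>2 / (real N * (real N - 1))\<^sup>2"
    by (simp add: power_mult_distrib power_divide)
  have "x / 2 * (y / x\<^sup>2) = y / (2 * x)" for x y :: real by (simp add: power2_eq_square)
  from this[of "real N * (real N - 1)"]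
  have "real (N choose 2) * (real ((N - 2) choose (k - 2)))\<^sup>2 = ?r"
    unfolding c2 b by (simp add: mult.assoc)
  thus ?thesis using le by simp
next
  case False
  have le: "card (A \<inter> A') \<le> k" if "card A = k" "A \<subseteq> {1..N}" for A A' :: "nat set"
    using that card_mono[of A "A \<inter> A'"] finite_subset[of A "{1..N}"] by auto
  have "\<not> 2 \<le> card (A \<inter> A')" if "card A = k" "A \<subseteq> {1..N}" for A A' :: "nat set"
    using le[OF that, of A'] False by linarith
  hence "?T = {}" by blast
  moreover have "?r \<ge> 0" using N by (intro mult_nonneg_nonneg divide_nonneg_nonneg) auto
  ultimately show ?thesis by (simp only: card.empty of_nat_0)
qed

section \<open>Mean-square convergence and Slutsky's lemmas\<close>

text \<open>Every remainder below is small in mean square, and in this form remainders can be added and rescaled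
  without extracting exceptional sets.\<close>
definition L2_null :: "'s measure \<Rightarrow> (nat \<Rightarrow> 's \<Rightarrow> real) \<Rightarrow> bool" where
  "L2_null M D \<longleftrightarrow> (\<forall>n. D n \<in> borel_measurable M \<and> integrable M (\<lambda>\<omega>. (D n \<omega>)\<^sup>2)) \<and>
     (\<lambda>n. \<integral>\<omega>. (D n \<omega>)\<^sup>2 \<partial>M) \<longlonglongrightarrow> 0"

lemma
  fixes f g :: "'s \<Rightarrow> real"
  assumes [measurable]: "f \<in> borel_measurable M" "g \<in> borel_measurable M"
    and f: "integrable M (\<lambda>\<omega>. (f \<omega>)\<^sup>2)" and g: "integrable M (\<lambda>\<omega>. (g \<omega>)\<^sup>2)"
  shows square_integrable_add: "integrable M (\<lambda>\<omega>. (f \<omega> + g \<omega>)\<^sup>2)"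
    and integrable_mult_of_squares: "integrable M (\<lambda>\<omega>. f \<omega> * g \<omega>)"
    and integral_square_add_le: "(\<integral>\<omega>. (f \<omega> + g \<omega>)\<^sup>2 \<partial>M) \<le> 2 * (\<integral>\<omega>. (f \<omega>)\<^sup>2 \<partial>M) + 2 * (\<integral>\<omega>. (g \<omega>)\<^sup>2 \<partial>M)"
    and abs_integral_mult_le: "\<bar>\<integral>\<omega>. f \<omega> * g \<omega> \<partial>M\<bar> \<le> ((\<integral>\<omega>. (f \<omega>)\<^sup>2 \<partial>M) + (\<integral>\<omega>. (g \<omega>)\<^sup>2 \<partial>M)) / 2"
proof -
  have b: "(x + y)\<^sup>2 \<le> 2 * x\<^sup>2 + 2 * y\<^sup>2" for x y :: real
    using sum_squares_bound[of x y] by (simp add: power2_sum)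
  have i: "integrable M (\<lambda>\<omega>. 2 * (f \<omega>)\<^sup>2 + 2 * (g \<omega>)\<^sup>2)" using f g by auto
  show 1: "integrable M (\<lambda>\<omega>. (f \<omega> + g \<omega>)\<^sup>2)"
    by (rule Bochner_Integration.integrable_bound[OF i]) (use b in \<open>auto intro!: AE_I2\<close>)
  have c: "\<bar>x * y\<bar> \<le> (x\<^sup>2 + y\<^sup>2) / 2" for x y :: real
    using sum_squares_bound[of x y] sum_squares_bound[of x "-y"] by (simp add: abs_le_iff)
  have i2: "integrable M (\<lambda>\<omega>. ((f \<omega>)\<^sup>2 + (g \<omega>)\<^sup>2) / 2)" using f g by auto
  show 2: "integrable M (\<lambda>\<omega>. f \<omega> * g \<omega>)"
    by (rule Bochner_Integration.integrable_bound[OF i2])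
       (use c in \<open>auto intro!: AE_I2 order_trans[OF c]\<close>)
  have "(\<integral>\<omega>. (f \<omega> + g \<omega>)\<^sup>2 \<partial>M) \<le> (\<integral>\<omega>. 2 * (f \<omega>)\<^sup>2 + 2 * (g \<omega>)\<^sup>2 \<partial>M)"
    by (intro integral_mono 1 i b)
  thus "(\<integral>\<omega>. (f \<omega> + g \<omega>)\<^sup>2 \<partial>M) \<le> 2 * (\<integral>\<omega>. (f \<omega>)\<^sup>2 \<partial>M) + 2 * (\<integral>\<omega>. (g \<omega>)\<^sup>2 \<partial>M)"
    using f g by simp
  have "\<bar>\<integral>\<omega>. f \<omega> * g \<omega> \<partial>M\<bar> \<le> (\<integral>\<omega>. \<bar>f \<omega> * g \<omega>\<bar> \<partial>M)" by simp
  also have "\<dots> \<le> (\<integral>\<omega>. ((f \<omega>)\<^sup>2 + (g \<omega>)\<^sup>2) / 2 \<partial>M)"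
    by (intro integral_mono integrable_abs 2 i2 c)
  finally show "\<bar>\<integral>\<omega>. f \<omega> * g \<omega> \<partial>M\<bar> \<le> ((\<integral>\<omega>. (f \<omega>)\<^sup>2 \<partial>M) + (\<integral>\<omega>. (g \<omega>)\<^sup>2 \<partial>M)) / 2"
    using f g by simp
qed

lemma square_integrable_sum:
  fixes f :: "'i \<Rightarrow> 's \<Rightarrow> real"
  assumes "\<And>i. i \<in> I \<Longrightarrow> f i \<in> borel_measurable M" "\<And>i. i \<in> I \<Longrightarrow> integrable M (\<lambda>\<omega>. (f i \<omega>)\<^sup>2)"
  shows "integrable M (\<lambda>\<omega>. (\<Sum>i\<in>I. f i \<omega>)\<^sup>2)"
  using assms
proof (induction I rule: infinite_finite_induct)
  case (insert i I)
  have "integrable M (\<lambda>\<omega>. (f i \<omega> + (\<Sum>i\<in>I. f i \<omega>))\<^sup>2)"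
    using insert by (intro square_integrable_add borel_measurable_sum) auto
  thus ?case using insert by simp
qed auto

lemma L2_null_add:
  assumes "L2_null M D" "L2_null M D'"
  shows "L2_null M (\<lambda>n \<omega>. D n \<omega> + D' n \<omega>)"
  unfolding L2_null_def
proof (intro conjI allI)
  fix n
  show "(\<lambda>\<omega>. D n \<omega> + D' n \<omega>) \<in> borel_measurable M"
    "integrable M (\<lambda>\<omega>. (D n \<omega> + D' n \<omega>)\<^sup>2)"
    using assms by (auto simp: L2_null_def intro!: square_integrable_add borel_measurable_add)
next
  have "(\<lambda>n. 2 * (\<integral>\<omega>. (D n \<omega>)\<^sup>2 \<partial>M) + 2 * (\<integral>\<omega>. (D' n \<omega>)\<^sup>2 \<partial>M)) \<longlonglongrightarrow> 2 * 0 + 2 * 0"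
    using assms by (intro tendsto_intros) (auto simp: L2_null_def)
  moreover have "norm (\<integral>\<omega>. (D n \<omega> + D' n \<omega>)\<^sup>2 \<partial>M)
      \<le> 2 * (\<integral>\<omega>. (D n \<omega>)\<^sup>2 \<partial>M) + 2 * (\<integral>\<omega>. (D' n \<omega>)\<^sup>2 \<partial>M)" for n
    using integral_square_add_le[of "D n" M "D' n"] assms by (simp add: L2_null_def)
  ultimately show "(\<lambda>n. \<integral>\<omega>. (D n \<omega> + D' n \<omega>)\<^sup>2 \<partial>M) \<longlonglongrightarrow> 0"
    using Lim_null_comparison always_eventually by (metis (no_types, lifting) add_0 mult_zero_right)
qed

lemma L2_null_scale:
  assumes "L2_null M D" and c: "\<And>n. \<bar>c n\<bar> \<le> C"
  shows "L2_null M (\<lambda>n \<omega>. c n * D n \<omega>)"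
  unfolding L2_null_def
proof (intro conjI allI)
  fix n
  show "(\<lambda>\<omega>. c n * D n \<omega>) \<in> borel_measurable M"
    "integrable M (\<lambda>\<omega>. (c n * D n \<omega>)\<^sup>2)"
    using assms by (auto simp: L2_null_def power_mult_distrib intro!: borel_measurable_times)
next
  have "(\<lambda>n. C\<^sup>2 * (\<integral>\<omega>. (D n \<omega>)\<^sup>2 \<partial>M)) \<longlonglongrightarrow> C\<^sup>2 * 0"
    using assms by (intro tendsto_intros) (auto simp: L2_null_def)
  moreover have "norm (\<integral>\<omega>. (c n * D n \<omega>)\<^sup>2 \<partial>M) \<le> C\<^sup>2 * (\<integral>\<omega>. (D n \<omega>)\<^sup>2 \<partial>M)" for n
    using power_mono[OF c[of n], of 2] by (simp add: power_mult_distrib mult_right_mono)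
  ultimately show "(\<lambda>n. \<integral>\<omega>. (c n * D n \<omega>)\<^sup>2 \<partial>M) \<longlonglongrightarrow> 0"
    using Lim_null_comparison always_eventually by (metis (no_types, lifting) mult_zero_right)
qed

lemma L2_null_zero: "L2_null M (\<lambda>n \<omega>. 0)"
  by (simp add: L2_null_def)

lemma L2_null_sum:
  assumes "\<And>i. i \<in> I \<Longrightarrow> L2_null M (D i)"
  shows "L2_null M (\<lambda>n \<omega>. \<Sum>i\<in>I. D i n \<omega>)"
  using assms by (induction I rule: infinite_finite_induct) (auto intro: L2_null_add L2_null_zero)

lemma (in prob_space) L2_null_prob:
  assumes D: "L2_null M D" and e: "\<epsilon> > 0"
  shows "(\<lambda>n. prob {\<omega>\<in>space M. \<epsilon> \<le> \<bar>D n \<omega>\<bar>}) \<longlonglongrightarrow> 0"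
proof (rule tendsto_sandwich[OF _ _ tendsto_const])
  have "(\<lambda>n. (\<integral>\<omega>. (D n \<omega>)\<^sup>2 \<partial>M) / \<epsilon>\<^sup>2) \<longlonglongrightarrow> 0 / \<epsilon>\<^sup>2"
    using D e by (intro tendsto_intros) (auto simp: L2_null_def)
  thus "(\<lambda>n. (\<integral>\<omega>. (D n \<omega>)\<^sup>2 \<partial>M) / \<epsilon>\<^sup>2) \<longlonglongrightarrow> 0" by simp
  show "\<forall>\<^sub>F n in sequentially. prob {\<omega>\<in>space M. \<epsilon> \<le> \<bar>D n \<omega>\<bar>} \<le> (\<integral>\<omega>. (D n \<omega>)\<^sup>2 \<partial>M) / \<epsilon>\<^sup>2"
  proof (intro always_eventually allI)
    fix n
    have [measurable]: "D n \<in> borel_measurable M" and i: "integrable M (\<lambda>\<omega>. (D n \<omega>)\<^sup>2)"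
      using D by (auto simp: L2_null_def)
    show "prob {\<omega>\<in>space M. \<epsilon> \<le> \<bar>D n \<omega>\<bar>} \<le> (\<integral>\<omega>. (D n \<omega>)\<^sup>2 \<partial>M) / \<epsilon>\<^sup>2"
      using second_moment_method[OF _ i, of \<epsilon>] e by simp
  qed
qed auto

text \<open>The limit distribution function has continuity points \<open>y\<close> on either side of any given continuity
  point \<open>x\<close> and arbitrarily close to it. The events \<open>W \<le> y\<close> and \<open>W + D \<le> x\<close> can be
  compared up to the event \<open>\<bar>y - x\<bar> \<le> \<bar>D\<bar>\<close>, which is negligible by Chebyshev's inequality.\<close>
lemma (in prob_space) slutsky_add:
  assumes W: "weak_conv_m (\<lambda>n. distr M borel (W n)) \<mu>" and \<mu>: "real_distribution \<mu>"
    and [measurable]: "\<And>n. W n \<in> borel_measurable M" and D: "L2_null M D"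
  shows "weak_conv_m (\<lambda>n. distr M borel (\<lambda>\<omega>. W n \<omega> + D n \<omega>)) \<mu>"
proof -
  interpret \<mu>: real_distribution \<mu> by fact
  have [measurable]: "D n \<in> borel_measurable M" for n using D by (auto simp: L2_null_def)
  have cdf_eq: "cdf (distr M borel Y) x = prob {\<omega>\<in>space M. Y \<omega> \<le> x}" 
    if [measurable]: "Y \<in> borel_measurable M" for Y :: "'a \<Rightarrow> real" and x
    by (auto simp: cdf_def measure_distr intro!: arg_cong[where f=prob])
  define F where "F = cdf \<mu>"
  define G where "G n y = prob {\<omega>\<in>space M. W n \<omega> \<le> y}" for n y
  have GF: "(\<lambda>n. G n y) \<longlonglongrightarrow> F y" if "isCont F y" for y
    using W that by (simp add: weak_conv_m_def weak_conv_def cdf_eq G_def F_def)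
  have dense: "\<exists>y. a < y \<and> y < b \<and> isCont F y" if "a < b" for a b
  proof (rule ccontr)
    assume "\<not> ?thesis"
    hence "{a<..<b} \<subseteq> {x. \<not> isCont F x}" by auto
    moreover have "countable {x. \<not> isCont F x}" unfolding F_def \<mu>.isCont_cdf
      using \<mu>.countable_support by simp
    ultimately have "countable {a<..<b}" by (rule countable_subset)
    thus False using uncountable_open_interval[of a b] that by simp
  qed
  show ?thesis unfolding weak_conv_m_def weak_conv_def F_def[symmetric]
  proof (intro allI impI)
    fix x assume x: "isCont F x"
    define p where "p n = prob {\<omega>\<in>space M. W n \<omega> + D n \<omega> \<le> x}" for n
    have up: "p n \<le> G n y + prob {\<omega>\<in>space M. y - x \<le> \<bar>D n \<omega>\<bar>}" for n y
    proof -
      have "p n \<le> prob ({\<omega>\<in>space M. W n \<omega> \<le> y} \<union> {\<omega>\<in>space M. y - x \<le> \<bar>D n \<omega>\<bar>})"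
        unfolding p_def by (intro finite_measure_mono) auto
      also have "\<dots> \<le> G n y + prob {\<omega>\<in>space M. y - x \<le> \<bar>D n \<omega>\<bar>}"
        unfolding G_def by (intro measure_Un_le) auto
      finally show ?thesis .
    qed
    have low: "G n y \<le> p n + prob {\<omega>\<in>space M. x - y \<le> \<bar>D n \<omega>\<bar>}" for n y
    proof -
      have "G n y \<le> prob ({\<omega>\<in>space M. W n \<omega> + D n \<omega> \<le> x} \<union> {\<omega>\<in>space M. x - y \<le> \<bar>D n \<omega>\<bar>})"
        unfolding G_def by (intro finite_measure_mono) auto
      also have "\<dots> \<le> p n + prob {\<omega>\<in>space M. x - y \<le> \<bar>D n \<omega>\<bar>}"
        unfolding p_def by (intro measure_Un_le) auto
      finally show ?thesis .
    qed
    have "p \<longlonglongrightarrow> F x"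
    proof (rule order_tendstoI)
      fix a assume "a < F x"
      with x have "eventually (\<lambda>y. a < F y) (at x)"
        by (intro order_tendstoD) (auto simp: isCont_def)
      then obtain d where d: "d > 0" "\<And>y. y \<noteq> x \<Longrightarrow> dist y x < d \<Longrightarrow> a < F y"
        by (auto simp: eventually_at)
      obtain y where y: "x - d < y" "y < x" "isCont F y" using dense[of "x - d" x] d by auto
      have "(\<lambda>n. G n y - prob {\<omega>\<in>space M. x - y \<le> \<bar>D n \<omega>\<bar>}) \<longlonglongrightarrow> F y - 0"
        using y by (intro tendsto_diff GF L2_null_prob[OF D]) auto
      moreover have "a < F y" using d(2)[of y] y by (auto simp: dist_real_def)
      ultimately have "eventually (\<lambda>n. a < G n y - prob {\<omega>\<in>space M. x - y \<le> \<bar>D n \<omega>\<bar>}) sequentially"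
        by (intro order_tendstoD) auto
      thus "eventually (\<lambda>n. a < p n) sequentially"
        by eventually_elim (use low[of _ y] in \<open>smt (verit)\<close>)
    next
      fix a assume "F x < a"
      with x have "eventually (\<lambda>y. F y < a) (at x)"
        by (intro order_tendstoD) (auto simp: isCont_def)
      then obtain d where d: "d > 0" "\<And>y. y \<noteq> x \<Longrightarrow> dist y x < d \<Longrightarrow> F y < a"
        by (auto simp: eventually_at)
      obtain y where y: "x < y" "y < x + d" "isCont F y" using dense[of x "x + d"] d by auto
      have "(\<lambda>n. G n y + prob {\<omega>\<in>space M. y - x \<le> \<bar>D n \<omega>\<bar>}) \<longlonglongrightarrow> F y + 0"
        using y by (intro tendsto_add GF L2_null_prob[OF D]) auto
      moreover have "F y < a" using d(2)[of y] y by (auto simp: dist_real_def)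
      ultimately have "eventually (\<lambda>n. G n y + prob {\<omega>\<in>space M. y - x \<le> \<bar>D n \<omega>\<bar>} < a) sequentially"
        by (intro order_tendstoD) auto
      thus "eventually (\<lambda>n. p n < a) sequentially"
        by eventually_elim (use up[of _ y] in \<open>smt (verit)\<close>)
    qed
    thus "(\<lambda>n. cdf (distr M borel (\<lambda>\<omega>. W n \<omega> + D n \<omega>)) x) \<longlonglongrightarrow> F x"
      by (simp add: cdf_eq p_def[abs_def])
  qed
qed

text \<open>Where \<open>1 + e\<close> is positive, \<open>L / (1 + e) \<le> x\<close> means \<open>L - x * e \<le> x\<close>, so for each fixed \<open>x\<close> the
  quotient reduces to the additive case with the perturbation \<open>- x * e\<close>. The values of \<open>R\<close> where
  \<open>1 + e \<le> 0\<close> are arbitrary since the probability of this event tends to \<open>0\<close>.\<close>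
lemma (in prob_space) slutsky_divide:
  assumes L: "weak_conv_m (\<lambda>n. distr M borel (L n)) \<nu>" and \<nu>: "real_distribution \<nu>"
    and [measurable]: "\<And>n. L n \<in> borel_measurable M" "\<And>n. R n \<in> borel_measurable M"
    and e: "L2_null M e"
    and R: "\<And>n \<omega>. 0 < 1 + e n \<omega> \<Longrightarrow> R n \<omega> = L n \<omega> / (1 + e n \<omega>)"
  shows "weak_conv_m (\<lambda>n. distr M borel (R n)) \<nu>"
  unfolding weak_conv_m_def weak_conv_def
proof (intro allI impI)
  fix x assume x: "isCont (cdf \<nu>) x"
  have [measurable]: "e n \<in> borel_measurable M" for n using e by (auto simp: L2_null_def)
  have cdf_eq: "cdf (distr M borel Y) x = prob {\<omega>\<in>space M. Y \<omega> \<le> x}"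
    if [measurable]: "Y \<in> borel_measurable M" for Y :: "'a \<Rightarrow> real"
    by (auto simp: cdf_def measure_distr intro!: arg_cong[where f=prob])
  define p where "p n = prob {\<omega>\<in>space M. R n \<omega> \<le> x}" for n
  define q where "q n = prob {\<omega>\<in>space M. L n \<omega> + (- x) * e n \<omega> \<le> x}" for n
  define d where "d n = prob {\<omega>\<in>space M. 1 \<le> \<bar>e n \<omega>\<bar>}" for n
  have iff: "R n \<omega> \<le> x \<longleftrightarrow> L n \<omega> + (- x) * e n \<omega> \<le> x" if "\<not> 1 \<le> \<bar>e n \<omega>\<bar>" for n \<omega>
  proof -
    have "0 < 1 + e n \<omega>" using that by linarith
    hence "R n \<omega> \<le> x \<longleftrightarrow> L n \<omega> \<le> x * (1 + e n \<omega>)"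
      using R[of n \<omega>] by (simp only: pos_divide_le_eq)
    thus ?thesis by (simp add: algebra_simps)
  qed
  have le: "q n - d n \<le> p n" "p n \<le> q n + d n" for n
  proof -
    have "p n \<le> prob ({\<omega>\<in>space M. L n \<omega> + (- x) * e n \<omega> \<le> x} \<union> {\<omega>\<in>space M. 1 \<le> \<bar>e n \<omega>\<bar>})"
      unfolding p_def by (rule finite_measure_mono) (use iff in blast, measurable)
    also have "\<dots> \<le> q n + d n" unfolding q_def d_def by (rule measure_Un_le) measurable
    finally show "p n \<le> q n + d n" .
    have "q n \<le> prob ({\<omega>\<in>space M. R n \<omega> \<le> x} \<union> {\<omega>\<in>space M. 1 \<le> \<bar>e n \<omega>\<bar>})"
      unfolding q_def by (rule finite_measure_mono) (use iff in blast, measurable)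
    also have "\<dots> \<le> p n + d n" unfolding p_def d_def by (rule measure_Un_le) measurable
    finally show "q n - d n \<le> p n" by simp
  qed
  have "L2_null M (\<lambda>n \<omega>. (- x) * e n \<omega>)"
    by (rule L2_null_scale[OF e, of _ "\<bar>x\<bar>"]) simp
  from slutsky_add[OF L \<nu> _ this]
  have "weak_conv_m (\<lambda>n. distr M borel (\<lambda>\<omega>. L n \<omega> + (- x) * e n \<omega>)) \<nu>" by simp
  hence "(\<lambda>n. cdf (distr M borel (\<lambda>\<omega>. L n \<omega> + (- x) * e n \<omega>)) x) \<longlonglongrightarrow> cdf \<nu> x"
    using x by (simp add: weak_conv_m_def weak_conv_def)
  hence q: "q \<longlonglongrightarrow> cdf \<nu> x" unfolding q_def[abs_def] by (subst (asm) cdf_eq) measurable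
  have d: "d \<longlonglongrightarrow> 0" unfolding d_def[abs_def] by (rule L2_null_prob[OF e]) simp
  have "p \<longlonglongrightarrow> cdf \<nu> x"
  proof (rule tendsto_sandwich[of "\<lambda>n. q n - d n" p sequentially "\<lambda>n. q n + d n"])
    show "(\<lambda>n. q n - d n) \<longlonglongrightarrow> cdf \<nu> x" using tendsto_diff[OF q d] by simp
    show "(\<lambda>n. q n + d n) \<longlonglongrightarrow> cdf \<nu> x" using tendsto_add[OF q d] by simp
  qed (use le in auto)
  thus "(\<lambda>n. cdf (distr M borel (R n)) x) \<longlonglongrightarrow> cdf \<nu> x"
    unfolding p_def[abs_def] by (subst cdf_eq) measurable
qed

text \<open>Averaging out one variable is a contraction in mean square: the variance of a section is
  nonnegative.\<close>
lemma pair_section_square_integral: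
  fixes F :: "'a \<times> 'b \<Rightarrow> real"
  assumes A: "prob_space A" and B: "prob_space B" 
    and F[measurable]: "F \<in> borel_measurable (A \<Otimes>\<^sub>M B)" and sq: "integrable (A \<Otimes>\<^sub>M B) (\<lambda>x. (F x)\<^sup>2)"
  shows "integrable A (\<lambda>x. (\<integral>y. F (x, y) \<partial>B)\<^sup>2)" and "AE x in A. integrable B (\<lambda>y. (F (x, y))\<^sup>2)"
proof -
  interpret A: prob_space A by fact
  interpret B: prob_space B by fact
  interpret AB: pair_prob_space A B ..
  show 2: "AE x in A. integrable B (\<lambda>y. (F (x, y))\<^sup>2)"
    using AB.AE_integrable_fst'[OF sq] .
  show "integrable A (\<lambda>x. (\<integral>y. F (x, y) \<partial>B)\<^sup>2)"
  proof (rule Bochner_Integration.integrable_bound[OF AB.integrable_fst'[OF sq]])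
    show "AE x in A. norm ((\<integral>y. F (x, y) \<partial>B)\<^sup>2) \<le> norm (\<integral>y. (F (x, y))\<^sup>2 \<partial>B)"
      using 2 AE_space
    proof eventually_elim
      case (elim x)
      have [measurable]: "(\<lambda>y. F (x, y)) \<in> borel_measurable B" using elim by measurable
      have i: "integrable B (\<lambda>y. F (x, y))"
        by (rule B.square_integrable_imp_integrable) (use elim in auto)
      have "0 \<le> B.variance (\<lambda>y. F (x, y))" by simp
      also have "\<dots> = (\<integral>y. (F (x, y))\<^sup>2 \<partial>B) - (\<integral>y. F (x, y) \<partial>B)\<^sup>2"
        by (rule B.variance_eq[OF i elim(1)])
      finally show ?case by simp
    qed
  qed measurable
qed

section \<open>Samples and the central limit theorem\<close>

(* Index sets are intervals starting at 1, which the simplifier should leave as they stand. *)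
declare One_nat_def [simp del]

locale iid_sample = Q: prob_space Q + S: prob_space S
  for Q :: "'a measure" and S :: "'s measure" +
  fixes Z :: "nat \<Rightarrow> 's \<Rightarrow> 'a"
  assumes Z_indep: "S.indep_vars (\<lambda>_. Q) Z {1..}"
    and Z_law: "\<And>i. i \<ge> 1 \<Longrightarrow> distr S Q (Z i) = Q"
begin

lemma Z_measurable: "i \<ge> 1 \<Longrightarrow> Z i \<in> S \<rightarrow>\<^sub>M Q"
  using Z_indep by (auto simp: S.indep_vars_def2)

lemma sample_measurable:
  assumes "i ` L \<subseteq> {1..}"
  shows "(\<lambda>\<omega>. \<lambda>l\<in>L. Z (i l) \<omega>) \<in> S \<rightarrow>\<^sub>M PiM L (\<lambda>_. Q)"
  using assms Z_measurable by (intro measurable_restrict) auto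

text \<open>The sample is indexed from \<open>1\<close>; selecting observations along any injective map of indices gives
  again an i.i.d. sample. This covers the tuples entering a U-statistic as well as the shift by one that
  turns the sample into a sequence indexed by all natural numbers.\<close>
lemma sample_law:
  assumes "inj_on i L" "i ` L \<subseteq> {1..}"
  shows "distr S (PiM L (\<lambda>_. Q)) (\<lambda>\<omega>. \<lambda>l\<in>L. Z (i l) \<omega>) = PiM L (\<lambda>_. Q)"
proof -
  have full: "distr S (PiM {1..} (\<lambda>_. Q)) (\<lambda>\<omega>. \<lambda>n\<in>{1..}. Z n \<omega>) = PiM {1..} (\<lambda>_. Q)"
  proof -
    have "distr S (PiM {1..} (\<lambda>_. Q)) (\<lambda>\<omega>. \<lambda>n\<in>{1..}. Z n \<omega>) = PiM {1..} (\<lambda>n. distr S Q (Z n))"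
      using Z_indep Z_measurable by (subst S.indep_vars_iff_distr_eq_PiM'[symmetric]) auto
    also have "\<dots> = PiM {1..} (\<lambda>_. Q)" using Z_law by (intro PiM_cong) auto
    finally show ?thesis .
  qed
  have "PiM L (\<lambda>_. Q) = distr (PiM {1..} (\<lambda>_. Q)) (PiM L (\<lambda>_. Q)) (\<lambda>x. \<lambda>l\<in>L. x (i l))"
    using assms Q.prob_space_axioms by (intro distr_PiM_reindex[symmetric]) auto
  also have "\<dots> = distr (distr S (PiM {1..} (\<lambda>_. Q)) (\<lambda>\<omega>. \<lambda>n\<in>{1..}. Z n \<omega>)) (PiM L (\<lambda>_. Q)) (\<lambda>x. \<lambda>l\<in>L. x (i l))"
    by (simp only: full)
  also have "\<dots> = distr S (PiM L (\<lambda>_. Q)) ((\<lambda>x. \<lambda>l\<in>L. x (i l)) \<circ> (\<lambda>\<omega>. \<lambda>n\<in>{1..}. Z n \<omega>))"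
    using assms(2) Z_measurable
    by (intro distr_distr measurable_restrict measurable_component_singleton) auto
  also have "(\<lambda>x. \<lambda>l\<in>L. x (i l)) \<circ> (\<lambda>\<omega>. \<lambda>n\<in>{1..}. Z n \<omega>) = (\<lambda>\<omega>. \<lambda>l\<in>L. Z (i l) \<omega>)"
    using assms(2) by (auto simp: fun_eq_iff)
  finally show ?thesis by (rule sym)
qed

lemma sample_integral:
  fixes F :: "(nat \<Rightarrow> 'a) \<Rightarrow> real"
  assumes "inj_on i L" "i ` L \<subseteq> {1..}" "F \<in> borel_measurable (PiM L (\<lambda>_. Q))"
  shows "(\<integral>\<omega>. F (\<lambda>l\<in>L. Z (i l) \<omega>) \<partial>S) = (\<integral>x. F x \<partial>PiM L (\<lambda>_. Q))"
    and "integrable S (\<lambda>\<omega>. F (\<lambda>l\<in>L. Z (i l) \<omega>)) \<longleftrightarrow> integrable (PiM L (\<lambda>_. Q)) F"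
  using integral_distr[OF sample_measurable[OF assms(2)] assms(3)]
    integrable_distr_eq[OF sample_measurable[OF assms(2)] assms(3)]
    sample_law[OF assms(1,2)] by auto

end

lemma centered_gaussian_scaling:
  assumes "\<sigma>2 > 0"
  shows "centered_gaussian \<sigma>2 = distr std_normal_distribution borel (\<lambda>x. sqrt \<sigma>2 * x)"
proof -
  interpret N: prob_space std_normal_distribution by (rule prob_space_normal_density) simp
  have "distributed std_normal_distribution lborel (\<lambda>x. x) std_normal_density"
    by (auto simp: distributed_def distr_id2)
  from N.normal_density_affine[OF this, of "sqrt \<sigma>2" 0] assms
  have "distributed std_normal_distribution lborel (\<lambda>x. sqrt \<sigma>2 * x) (normal_density 0 (sqrt \<sigma>2))"
    by simp
  hence "distr std_normal_distribution lborel (\<lambda>x. sqrt \<sigma>2 * x) = density lborel (normal_density 0 (sqrt \<sigma>2))"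
    by (rule distributed_distr_eq_density)
  moreover have "distr std_normal_distribution lborel (\<lambda>x. sqrt \<sigma>2 * x) 
     = distr std_normal_distribution borel (\<lambda>x. sqrt \<sigma>2 * x)"
    by (intro distr_cong) auto
  ultimately show ?thesis using assms by (simp add: centered_gaussian_def)
qed

lemma real_distribution_centered_gaussian:
  assumes "\<sigma>2 \<ge> 0"
  shows "real_distribution (centered_gaussian \<sigma>2)"
proof (cases "\<sigma>2 = 0")
  case True
  interpret prob_space "return borel (0::real)" by (rule prob_space_return) simp
  show ?thesis using True by (auto simp: centered_gaussian_def intro!: real_distribution.intro
        real_distribution_axioms.intro prob_space_axioms)
next
  case False
  interpret prob_space "density lborel (normal_density 0 (sqrt \<sigma>2))"
    using False assms by (intro prob_space_normal_density) auto
  show ?thesis using False by (auto simp: centered_gaussian_def intro!: real_distribution.intro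
        real_distribution_axioms.intro prob_space_axioms)
qed

text \<open>Used to pass from the standard normal law, in terms of which the central limit theorem is stated,
  to a centered Gaussian law of arbitrary variance.\<close>
lemma weak_conv_m_scale:
  fixes \<mu> :: "real measure"
  assumes W: "weak_conv_m (\<lambda>n. distr M borel (W n)) \<mu>" and \<mu>: "real_distribution \<mu>"
    and [measurable]: "\<And>n. W n \<in> borel_measurable M" and c: "c > 0"
  shows "weak_conv_m (\<lambda>n. distr M borel (\<lambda>\<omega>. c * W n \<omega>)) (distr \<mu> borel (\<lambda>x. c * x))"
proof -
  interpret \<mu>: real_distribution \<mu> by fact
  have [measurable]: "(\<lambda>x. c * x) \<in> borel_measurable \<mu>" by measurable
  have cdf: "cdf (distr K borel (\<lambda>\<omega>. c * V \<omega>)) x = cdf (distr K borel V) (x / c)"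
    if [measurable]: "V \<in> borel_measurable K" for K :: "'z measure" and V x
    using c by (auto simp: cdf_def measure_distr field_simps intro!: arg_cong[where f="measure K"])
  have cdf\<mu>: "cdf (distr \<mu> borel (\<lambda>x. c * x)) x = cdf \<mu> (x / c)" for x
    using c by (auto simp: cdf_def measure_distr field_simps intro!: arg_cong[where f="measure \<mu>"])
  show ?thesis unfolding weak_conv_m_def weak_conv_def
  proof (intro allI impI)
    fix x assume x: "isCont (cdf (distr \<mu> borel (\<lambda>x. c * x))) x"
    have "isCont (\<lambda>y. c * y) (x / c)" by (intro continuous_intros)
    moreover have "isCont (cdf (distr \<mu> borel (\<lambda>x. c * x))) (c * (x / c))" using x c by simp
    ultimately have "isCont (\<lambda>y. cdf (distr \<mu> borel (\<lambda>x. c * x)) (c * y)) (x / c)"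
      by (rule isCont_o2)
    moreover have "(\<lambda>y. cdf (distr \<mu> borel (\<lambda>x. c * x)) (c * y)) = cdf \<mu>"
      using c by (intro ext) (simp only: cdf\<mu>, simp)
    ultimately have "isCont (cdf \<mu>) (x / c)" by simp
    thus "(\<lambda>n. cdf (distr M borel (\<lambda>\<omega>. c * W n \<omega>)) x) \<longlonglongrightarrow> cdf (distr \<mu> borel (\<lambda>x. c * x)) x"
      using W by (simp add: weak_conv_m_def weak_conv_def cdf cdf\<mu>)
  qed
qed

context iid_sample begin

text \<open>The degenerate case is separate: if the variance is \<open>0\<close> then \<open>\<phi>\<close> vanishes almost surely, all the
  sums are \<open>0\<close>, and the limit is the unit mass at \<open>0\<close>.\<close>
lemma central_limit:
  fixes \<phi> :: "'a \<Rightarrow> real"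
  assumes \<phi>[measurable]: "\<phi> \<in> borel_measurable Q" and sq: "integrable Q (\<lambda>z. (\<phi> z)\<^sup>2)"
    and mean: "(\<integral>z. \<phi> z \<partial>Q) = 0"
  shows "weak_conv_m (\<lambda>N. distr S borel (\<lambda>\<omega>. (\<Sum>n\<in>{1..N}. \<phi> (Z n \<omega>)) / sqrt (real N)))
    (centered_gaussian (\<integral>z. (\<phi> z)\<^sup>2 \<partial>Q))"
proof -
  define v where "v = (\<integral>z. (\<phi> z)\<^sup>2 \<partial>Q)"
  have v: "v \<ge> 0" unfolding v_def by simp
  have m[measurable]: "(\<lambda>\<omega>. \<phi> (Z n \<omega>)) \<in> borel_measurable S" if "n \<ge> 1" for n
    using Z_measurable[OF that] by measurable
  have sm: "(\<lambda>\<omega>. \<Sum>n\<in>{1..N}. \<phi> (Z n \<omega>)) \<in> borel_measurable S" for N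
    using m by (intro borel_measurable_sum) auto
  show ?thesis
  proof (cases "v = 0")
    case True
    have "AE z in Q. (\<phi> z)\<^sup>2 = 0"
      using True sq integral_nonneg_eq_0_iff_AE[of Q "\<lambda>z. (\<phi> z)\<^sup>2"] by (simp add: v_def)
    hence "AE z in Q. \<phi> z = 0" by simp
    hence "AE \<omega> in S. \<phi> (Z n \<omega>) = 0" if "n \<ge> 1" for n
      by (intro AE_distrD[OF Z_measurable[OF that], of "\<lambda>z. \<phi> z = 0"]) (simp only: Z_law[OF that])
    hence "AE \<omega> in S. \<forall>n\<in>{1..}. \<phi> (Z n \<omega>) = 0"
      by (intro AE_ball_countable[THEN iffD2] ballI) auto
    hence "AE \<omega> in S. (\<Sum>n\<in>{1..N}. \<phi> (Z n \<omega>)) / sqrt (real N) = 0" for N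
      by eventually_elim simp
    hence "distr S borel (\<lambda>\<omega>. (\<Sum>n\<in>{1..N}. \<phi> (Z n \<omega>)) / sqrt (real N)) = distr S borel (\<lambda>_. 0)" for N
      using sm by (intro distr_cong_AE) auto
    thus ?thesis using True
      by (simp add: v_def[symmetric] centered_gaussian_def S.distr_const weak_conv_m_def weak_conv_def)
  next
    case False
    hence v: "v > 0" using v by simp
    define X where "X n = (\<lambda>\<omega>. \<phi> (Z (Suc n) \<omega>))" for n
    have "S.indep_vars (\<lambda>_. Q) (\<lambda>n. Z (Suc n)) UNIV"
    proof (subst S.indep_vars_iff_distr_eq_PiM')
      have "PiM UNIV (\<lambda>n. distr S Q (Z (Suc n))) = PiM UNIV (\<lambda>_. Q)"
        using Z_law by (intro PiM_cong) auto
      thus "distr S (PiM UNIV (\<lambda>_. Q)) (\<lambda>\<omega>. \<lambda>n\<in>UNIV. Z (Suc n) \<omega>) = PiM UNIV (\<lambda>n. distr S Q (Z (Suc n)))"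
        using sample_law[of Suc UNIV] by (simp add: image_subset_iff)
    qed (auto intro!: Z_measurable)
    hence X: "S.indep_vars (\<lambda>_. borel) X UNIV"
      unfolding X_def by (rule S.indep_vars_compose2) (rule \<phi>)
    have Zm: "Z (Suc n) \<in> S \<rightarrow>\<^sub>M Q" and Zl: "distr S Q (Z (Suc n)) = Q" for n
      by (auto intro!: Z_measurable Z_law)
    have X0: "S.expectation (X n) = 0" for n
      using integral_distr[OF Zm \<phi>, of n] Zl[of n] mean by (simp add: X_def)
    have Xi: "integrable S (\<lambda>\<omega>. (X n \<omega>)\<^sup>2)" for n
      using integrable_distr_eq[OF Zm, of "\<lambda>z. (\<phi> z)\<^sup>2" n] Zl[of n] sq by (simp add: X_def)
    have Xv: "S.variance (X n) = (sqrt v)\<^sup>2" for n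
      using integral_distr[OF Zm, of "\<lambda>z. (\<phi> z)\<^sup>2" n] Zl[of n] v X0[of n] by (simp add: X_def v_def)
    have Xd: "distr S borel (X n) = distr Q borel \<phi>" for n
      using distr_distr[OF \<phi> Zm, of n] Zl[of n] by (simp add: X_def comp_def)
    have "weak_conv_m (\<lambda>n. distr S borel (\<lambda>\<omega>. (\<Sum>i<n. X i \<omega>) / sqrt (n * (sqrt v)\<^sup>2))) std_normal_distribution"
      using v by (intro S.central_limit_theorem_zero_mean[OF X X0 _ Xi Xv Xd]) simp
    moreover have "(\<Sum>i<n. X i \<omega>) = (\<Sum>i\<in>{1..n}. \<phi> (Z i \<omega>))" for n \<omega>
      unfolding X_def by (rule sum.reindex_bij_witness[of _ "\<lambda>i. i - 1" Suc]) auto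
    ultimately have "weak_conv_m (\<lambda>n. distr S borel (\<lambda>\<omega>. (\<Sum>i\<in>{1..n}. \<phi> (Z i \<omega>)) / sqrt (n * (sqrt v)\<^sup>2))) std_normal_distribution"
      by simp
    hence "weak_conv_m (\<lambda>n. distr S borel (\<lambda>\<omega>. sqrt v * ((\<Sum>i\<in>{1..n}. \<phi> (Z i \<omega>)) / sqrt (n * (sqrt v)\<^sup>2))))
       (distr std_normal_distribution borel (\<lambda>x. sqrt v * x))"
      using v sm by (intro weak_conv_m_scale real_dist_normal_dist) auto
    moreover have "sqrt v * (s / sqrt (n * (sqrt v)\<^sup>2)) = s / sqrt n" for s n :: real
      using v by (simp add: real_sqrt_mult)
    ultimately show ?thesis
      using centered_gaussian_scaling[OF v] by (simp add: v_def[symmetric])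
  qed
qed

end

text \<open>Weak law of large numbers: centred observations with different indices are orthogonal, so only the
  \<open>N\<close> diagonal terms of the squared sum contribute.\<close>
lemma (in iid_sample) sample_mean_L2_null:
  fixes \<phi> :: "'a \<Rightarrow> real"
  assumes \<phi>[measurable]: "\<phi> \<in> borel_measurable Q" and sq: "integrable Q (\<lambda>z. (\<phi> z)\<^sup>2)"
    and mean: "(\<integral>z. \<phi> z \<partial>Q) = 0"
  shows "L2_null S (\<lambda>N \<omega>. (\<Sum>n\<in>{1..N}. \<phi> (Z n \<omega>)) / real N)"
proof -
  have int: "integrable Q \<phi>" by (rule Q.square_integrable_imp_integrable[OF \<phi> sq])
  have m: "(\<lambda>\<omega>. \<phi> (Z n \<omega>)) \<in> borel_measurable S" if "n \<ge> 1" for n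
    using measurable_compose[OF Z_measurable[OF that] \<phi>] .
  have s: "integrable S (\<lambda>\<omega>. (\<phi> (Z n \<omega>))\<^sup>2)" "(\<integral>\<omega>. (\<phi> (Z n \<omega>))\<^sup>2 \<partial>S) = (\<integral>z. (\<phi> z)\<^sup>2 \<partial>Q)" if "n \<ge> 1" for n
    using integrable_distr_eq[OF Z_measurable[OF that], of "\<lambda>z. (\<phi> z)\<^sup>2"]
      integral_distr[OF Z_measurable[OF that], of "\<lambda>z. (\<phi> z)\<^sup>2"] Z_law[OF that] sq by auto
  have orth: "(\<integral>\<omega>. \<phi> (Z n \<omega>) * \<phi> (Z n' \<omega>) \<partial>S) = 0" if n: "n \<ge> 1" "n' \<ge> 1" "n \<noteq> n'" for n n'
  proof -
    interpret PQ: product_prob_space "\<lambda>_::nat. Q" UNIV by unfold_locales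
    have L: "id ` {n, n'} \<subseteq> {1..}" using n by auto
    have Fm: "(\<lambda>x. \<Prod>i\<in>{n, n'}. \<phi> (x i)) \<in> borel_measurable (PiM {n, n'} (\<lambda>_. Q))" by measurable
    have "(\<integral>\<omega>. \<phi> (Z n \<omega>) * \<phi> (Z n' \<omega>) \<partial>S) = (\<integral>x. (\<Prod>i\<in>{n, n'}. \<phi> (x i)) \<partial>PiM {n, n'} (\<lambda>_. Q))"
      using sample_integral(1)[OF inj_on_id L Fm] n by simp
    also have "\<dots> = (\<Prod>i\<in>{n, n'}. \<integral>z. \<phi> z \<partial>Q)"
      by (rule PQ.product_integral_prod) (auto intro: int)
    finally show ?thesis using mean n by simp
  qed
  have sm: "(\<lambda>\<omega>. \<Sum>n\<in>{1..N}. \<phi> (Z n \<omega>)) \<in> borel_measurable S" for N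
    using m by (intro borel_measurable_sum) auto
  have second: "(\<integral>\<omega>. (\<Sum>n\<in>{1..N}. \<phi> (Z n \<omega>))\<^sup>2 \<partial>S) = real N * (\<integral>z. (\<phi> z)\<^sup>2 \<partial>Q)" for N
  proof -
    have i: "integrable S (\<lambda>\<omega>. \<phi> (Z n \<omega>) * \<phi> (Z n' \<omega>))" if "n \<in> {1..N}" "n' \<in> {1..N}" for n n'
      using that m s by (intro integrable_mult_of_squares) auto
    have "(\<integral>\<omega>. (\<Sum>n\<in>{1..N}. \<phi> (Z n \<omega>))\<^sup>2 \<partial>S) = (\<integral>\<omega>. (\<Sum>n\<in>{1..N}. \<Sum>n'\<in>{1..N}. \<phi> (Z n \<omega>) * \<phi> (Z n' \<omega>)) \<partial>S)"
      by (simp add: power2_eq_square sum_product)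
    also have "\<dots> = (\<Sum>n\<in>{1..N}. \<integral>\<omega>. (\<Sum>n'\<in>{1..N}. \<phi> (Z n \<omega>) * \<phi> (Z n' \<omega>)) \<partial>S)"
      using i by (intro Bochner_Integration.integral_sum Bochner_Integration.integrable_sum)
    also have "\<dots> = (\<Sum>n\<in>{1..N}. \<Sum>n'\<in>{1..N}. \<integral>\<omega>. \<phi> (Z n \<omega>) * \<phi> (Z n' \<omega>) \<partial>S)"
      using i by (intro sum.cong[OF refl] Bochner_Integration.integral_sum)
    also have "\<dots> = (\<Sum>n\<in>{1..N}. \<Sum>n'\<in>{1..N}. if n' = n then \<integral>z. (\<phi> z)\<^sup>2 \<partial>Q else 0)"
    proof (rule sum.cong[OF refl], rule sum.cong[OF refl])
      fix n n' assume n: "n \<in> {1..N}" "n' \<in> {1..N}"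
      show "(\<integral>\<omega>. \<phi> (Z n \<omega>) * \<phi> (Z n' \<omega>) \<partial>S) = (if n' = n then \<integral>z. (\<phi> z)\<^sup>2 \<partial>Q else 0)"
        using orth[of n n'] s(2)[of n] n by (auto simp: power2_eq_square)
    qed
    also have "\<dots> = real N * (\<integral>z. (\<phi> z)\<^sup>2 \<partial>Q)" by (simp add: sum.delta)
    finally show ?thesis .
  qed
  show ?thesis unfolding L2_null_def
  proof (intro conjI allI)
    fix N
    show "(\<lambda>\<omega>. (\<Sum>n\<in>{1..N}. \<phi> (Z n \<omega>)) / real N) \<in> borel_measurable S"
      using sm by (rule borel_measurable_divide) simp
    have "integrable S (\<lambda>\<omega>. (\<Sum>n\<in>{1..N}. \<phi> (Z n \<omega>))\<^sup>2)"
      using m s by (intro square_integrable_sum) auto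
    thus "integrable S (\<lambda>\<omega>. ((\<Sum>n\<in>{1..N}. \<phi> (Z n \<omega>)) / real N)\<^sup>2)"
      by (simp add: power_divide)
  next
    have "(\<lambda>N. inverse (real N) * (\<integral>z. (\<phi> z)\<^sup>2 \<partial>Q)) \<longlonglongrightarrow> 0 * (\<integral>z. (\<phi> z)\<^sup>2 \<partial>Q)"
      by (intro tendsto_mult tendsto_const lim_inverse_n)
    moreover have "inverse (real N) * (\<integral>z. (\<phi> z)\<^sup>2 \<partial>Q) = (\<integral>\<omega>. ((\<Sum>n\<in>{1..N}. \<phi> (Z n \<omega>)) / real N)\<^sup>2 \<partial>S)" for N
      using second[of N] by (simp add: power_divide power2_eq_square field_simps)
    ultimately show "(\<lambda>N. \<integral>\<omega>. ((\<Sum>n\<in>{1..N}. \<phi> (Z n \<omega>)) / real N)\<^sup>2 \<partial>S) \<longlonglongrightarrow> 0" by simp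
  qed
qed

section \<open>Hoeffding projection of a U-statistic\<close>

locale square_integrable_kernel = Q: prob_space Q for Q :: "'a measure" +
  fixes k :: nat and h :: "(nat \<Rightarrow> 'a) \<Rightarrow> real"
  assumes k: "k \<ge> 1"
    and h[measurable]: "h \<in> borel_measurable (PiM {1..k} (\<lambda>_. Q))"
    and h_sym: "\<And>\<tau> z. \<tau> permutes {1..k} \<Longrightarrow> h (\<lambda>i. z (\<tau> i)) = h z"
    and h_sq: "integrable (PiM {1..k} (\<lambda>_. Q)) (\<lambda>z. (h z)\<^sup>2)"
begin

abbreviation "P I \<equiv> PiM I (\<lambda>_::nat. Q)"

sublocale product_prob_space "\<lambda>_::nat. Q" UNIV
  by unfold_locales

lemma prob_P: "prob_space (P I)"
  by (intro prob_space_PiM Q.prob_space_axioms)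

definition mean :: real where "mean = (\<integral>z. h z \<partial>P {1..k})"

text \<open>The first-order term of Hoeffding's decomposition: the conditional expectation of \<open>h\<close> given one of
  its arguments, centred. By symmetry of \<open>h\<close> it does not matter which argument is kept; the first one
  is chosen here.\<close>
definition proj :: "'a \<Rightarrow> real" where
  "proj z = (\<integral>w. h (w(1 := z)) \<partial>P ({1..k} - {1})) - mean"

definition res :: "(nat \<Rightarrow> 'a) \<Rightarrow> real" where
  "res x = h x - mean - (\<Sum>l\<in>{1..k}. proj (x l))"

lemma h_int: "integrable (P {1..k}) h"
proof -
  interpret prob_space "P {1..k}" by (rule prob_P)
  show ?thesis by (rule square_integrable_imp_integrable[OF h h_sq])
qed

lemma distr_split_coordinate:
  assumes "l \<in> {1..k}"
  shows "distr (Q \<Otimes>\<^sub>M P ({1..k} - {l})) (P {1..k}) (\<lambda>(z, w). w(l := z)) = P {1..k}"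
  using distr_pair_PiM_eq_PiM[of "{1..k} - {l}" "\<lambda>_. Q" l] assms
  by (simp add: Q.prob_space_axioms insert_absorb)

lemma upd_measurable:
  assumes "l \<in> {1..k}"
  shows "(\<lambda>(z, w). w(l := z)) \<in> Q \<Otimes>\<^sub>M P ({1..k} - {l}) \<rightarrow>\<^sub>M P {1..k}"
proof -
  have "(\<lambda>(z, w). w(l := z)) \<in> Q \<Otimes>\<^sub>M P ({1..k} - {l}) \<rightarrow>\<^sub>M P (insert l ({1..k} - {l}))"
    by measurable
  thus ?thesis using assms by (simp add: insert_absorb)
qed

lemma integrable_split_coordinate:
  fixes F :: "(nat \<Rightarrow> 'a) \<Rightarrow> real"
  assumes l: "l \<in> {1..k}" and F: "integrable (P {1..k}) F"
  shows "integrable (Q \<Otimes>\<^sub>M P ({1..k} - {l})) (\<lambda>(z, w). F (w(l := z)))"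
    and "AE z in Q. integrable (P ({1..k} - {l})) (\<lambda>w. F (w(l := z)))"
    and "integrable Q (\<lambda>z. \<integral>w. F (w(l := z)) \<partial>P ({1..k} - {l}))"
    and "(\<integral>z. (\<integral>w. F (w(l := z)) \<partial>P ({1..k} - {l})) \<partial>Q) = (\<integral>x. F x \<partial>P {1..k})"
proof -
  interpret R: prob_space "P ({1..k} - {l})" by (rule prob_P)
  interpret QR: pair_prob_space Q "P ({1..k} - {l})" ..
  have [measurable]: "F \<in> borel_measurable (P {1..k})" using F by auto
  have "integrable (distr (Q \<Otimes>\<^sub>M P ({1..k} - {l})) (P {1..k}) (\<lambda>(z, w). w(l := z))) F"
    unfolding distr_split_coordinate[OF l] by (rule F)
  from integrable_distr[OF upd_measurable[OF l] this]
  show 1: "integrable (Q \<Otimes>\<^sub>M P ({1..k} - {l})) (\<lambda>(z, w). F (w(l := z)))"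
    by (simp add: case_prod_unfold)
  show "AE z in Q. integrable (P ({1..k} - {l})) (\<lambda>w. F (w(l := z)))"
    using QR.AE_integrable_fst'[OF 1] by simp
  show "integrable Q (\<lambda>z. \<integral>w. F (w(l := z)) \<partial>P ({1..k} - {l}))"
    using QR.integrable_fst'[OF 1] by simp
  have "(\<integral>x. F x \<partial>P {1..k}) = (\<integral>x. F x \<partial>distr (Q \<Otimes>\<^sub>M P ({1..k} - {l})) (P {1..k}) (\<lambda>(z, w). w(l := z)))"
    by (simp only: distr_split_coordinate[OF l])
  also have "\<dots> = (\<integral>x. (case x of (z, w) \<Rightarrow> F (w(l := z))) \<partial>(Q \<Otimes>\<^sub>M P ({1..k} - {l})))"
    by (subst integral_distr[OF upd_measurable[OF l]]) (auto simp: case_prod_unfold)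
  finally show "(\<integral>z. (\<integral>w. F (w(l := z)) \<partial>P ({1..k} - {l})) \<partial>Q) = (\<integral>x. F x \<partial>P {1..k})"
    using QR.integral_fst'[OF 1] by simp
qed

lemma
  shows proj_measurable[measurable]: "proj \<in> borel_measurable Q"
    and proj_integrable: "integrable Q proj"
    and proj_sq: "integrable Q (\<lambda>z. (proj z)\<^sup>2)"
    and proj_mean: "(\<integral>z. proj z \<partial>Q) = 0"
proof -
  have 1: "1 \<in> {1..k}" using k by auto
  note s = integrable_split_coordinate[OF 1 h_int]
  show i: "integrable Q proj"
    unfolding proj_def using s(3) by (auto intro!: Bochner_Integration.integrable_diff)
  thus m: "proj \<in> borel_measurable Q" by auto
  show "(\<integral>z. proj z \<partial>Q) = 0"
    unfolding proj_def using s(3,4) by (simp add: mean_def Q.prob_space)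
  have "(\<lambda>(z, w). h (w(1 := z))) \<in> borel_measurable (Q \<Otimes>\<^sub>M P ({1..k} - {1}))"
    using measurable_compose[OF upd_measurable[OF 1] h] by (simp add: case_prod_unfold)
  from pair_section_square_integral(1)[OF Q.prob_space_axioms prob_P this]
  have "integrable Q (\<lambda>z. (\<integral>w. h (w(1 := z)) \<partial>P ({1..k} - {1}))\<^sup>2)"
    using integrable_split_coordinate(1)[OF 1 h_sq] by (simp add: case_prod_unfold)
  hence "integrable Q (\<lambda>z. ((\<integral>w. h (w(1 := z)) \<partial>P ({1..k} - {1})) + (- mean))\<^sup>2)"
    using s(3) by (intro square_integrable_add[where g="\<lambda>_. - mean"]) auto
  thus "integrable Q (\<lambda>z. (proj z)\<^sup>2)" unfolding proj_def by simp
qed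

text \<open>Exchanging the coordinates \<open>1\<close> and \<open>l\<close> leaves \<open>h\<close> unchanged and carries the product measure over
  the remaining coordinates in one case to that in the other.\<close>
lemma section_integral_any_coordinate:
  assumes l: "l \<in> {1..k}" and z: "z \<in> space Q"
  shows "(\<integral>w. h (w(l := z)) \<partial>P ({1..k} - {l})) = proj z + mean"
proof -
  define \<tau> where "\<tau> = Transposition.transpose 1 l"
  have 1: "1 \<in> {1..k}" using k by auto
  have \<tau>: "\<tau> permutes {1..k}" unfolding \<tau>_def using 1 l by (rule permutes_swap_id)
  let ?t = "\<lambda>w. \<lambda>n\<in>{1..k} - {1}. w (\<tau> n)"
  have maps: "inj_on \<tau> ({1..k} - {1})" "\<tau> \<in> {1..k} - {1} \<rightarrow> {1..k} - {l}"
    using permutes_in_image[OF \<tau>] permutes_inj[OF \<tau>] permutes_inj_on[OF \<tau>]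
    by (auto simp: \<tau>_def Transposition.transpose_def)
  have d: "distr (P ({1..k} - {l})) (P ({1..k} - {1})) ?t = P ({1..k} - {1})"
    using distr_PiM_reindex[of "{1..k} - {l}" "\<lambda>_. Q", OF Q.prob_space_axioms maps] .
  have upd: "(\<lambda>w. w(1 := z)) \<in> P ({1..k} - {1}) \<rightarrow>\<^sub>M P {1..k}"
    using measurable_compose[OF measurable_Pair1' upd_measurable[OF 1], OF z] by simp
  have t: "?t \<in> P ({1..k} - {l}) \<rightarrow>\<^sub>M P ({1..k} - {1})"
    using maps by (intro measurable_restrict measurable_component_singleton) auto
  have "proj z + mean = (\<integral>w. h (w(1 := z)) \<partial>distr (P ({1..k} - {l})) (P ({1..k} - {1})) ?t)"
    unfolding d proj_def by simp
  also have "\<dots> = (\<integral>w. h ((?t w)(1 := z)) \<partial>P ({1..k} - {l}))"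
    using measurable_compose[OF upd h] t by (intro integral_distr) auto
  also have "\<dots> = (\<integral>w. h (w(l := z)) \<partial>P ({1..k} - {l}))"
  proof (intro Bochner_Integration.integral_cong refl)
    fix w assume w: "w \<in> space (P ({1..k} - {l}))"
    have "(?t w)(1 := z) = (\<lambda>i. (w(l := z)) (\<tau> i))"
    proof
      fix i 
      consider "i = 1" | "i \<noteq> 1" "i \<in> {1..k}" | "i \<notin> {1..k}" by blast
      thus "((?t w)(1 := z)) i = (w(l := z)) (\<tau> i)"
      proof cases
        case 3
        hence "\<tau> i = i" using \<tau> by (simp add: permutes_def)
        moreover have "w i = undefined" using w 3 by (auto simp: space_PiM PiE_def extensional_def)
        ultimately show ?thesis using 3 1 l by auto
      qed (auto simp: \<tau>_def Transposition.transpose_def)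
    qed
    thus "h ((?t w)(1 := z)) = h (w(l := z))" using h_sym[OF \<tau>, of "w(l := z)"] by simp
  qed
  finally show ?thesis by simp
qed

lemma P_component:
  fixes F :: "'a \<Rightarrow> real"
  assumes "l \<in> I" and F[measurable]: "F \<in> borel_measurable Q"
  shows "integrable (P I) (\<lambda>w. F (w l)) \<longleftrightarrow> integrable Q F"
    and "(\<integral>w. F (w l) \<partial>P I) = (\<integral>z. F z \<partial>Q)"
proof -
  have d: "distr (P I) Q (\<lambda>w. w l) = Q"
    using assms by (intro distr_PiM_component Q.prob_space_axioms) auto
  have m: "(\<lambda>w. w l) \<in> P I \<rightarrow>\<^sub>M Q" using assms by auto
  show "integrable (P I) (\<lambda>w. F (w l)) \<longleftrightarrow> integrable Q F"
    using integrable_distr_eq[OF m F] d by simp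
  show "(\<integral>w. F (w l) \<partial>P I) = (\<integral>z. F z \<partial>Q)"
    using integral_distr[OF m F] d by simp
qed

lemma res_measurable[measurable]: "res \<in> borel_measurable (P {1..k})"
  unfolding res_def by measurable

lemma res_sq: "integrable (P {1..k}) (\<lambda>x. (res x)\<^sup>2)"
proof -
  interpret prob_space "P {1..k}" by (rule prob_P)
  have a: "integrable (P {1..k}) (\<lambda>x. (\<Sum>l\<in>{1..k}. - proj (x l))\<^sup>2)"
    by (intro square_integrable_sum) (auto simp: P_component(1)[where F="\<lambda>z. (proj z)\<^sup>2"] proj_sq)
  have b: "integrable (P {1..k}) (\<lambda>x. (h x + (- mean))\<^sup>2)"
    by (rule square_integrable_add) (use h_sq in auto)
  have "integrable (P {1..k}) (\<lambda>x. ((h x + (- mean)) + (\<Sum>l\<in>{1..k}. - proj (x l)))\<^sup>2)"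
    by (rule square_integrable_add[OF _ _ b a]) measurable
  thus ?thesis by (simp add: res_def sum_negf)
qed

text \<open>Integrating the residual over all arguments but the \<open>l\<close>-th cancels \<open>h\<close> against the mean and the
  \<open>l\<close>-th projection, while the other projections have mean \<open>0\<close>.\<close>
lemma res_degenerate:
  assumes l: "l \<in> {1..k}"
  shows "AE z in Q. (\<integral>w. res (w(l := z)) \<partial>P ({1..k} - {l})) = 0"
  using integrable_split_coordinate(2)[OF l h_int] AE_space
proof eventually_elim
  case (elim z)
  let ?P = "P ({1..k} - {l})"
  interpret R: prob_space ?P by (rule prob_P)
  have pi: "integrable ?P (\<lambda>w. proj (w i))" if "i \<in> {1..k} - {l}" for i
    using P_component(1)[OF that, of proj] proj_integrable by simp
  have eq: "res (w(l := z)) = h (w(l := z)) - mean - (proj z + (\<Sum>i\<in>{1..k} - {l}. proj (w i)))" for w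
  proof -
    have "(\<Sum>i\<in>{1..k}. proj ((w(l := z)) i)) = proj z + (\<Sum>i\<in>{1..k} - {l}. proj ((w(l := z)) i))"
      using l by (subst sum.remove[of _ l]) auto
    also have "(\<Sum>i\<in>{1..k} - {l}. proj ((w(l := z)) i)) = (\<Sum>i\<in>{1..k} - {l}. proj (w i))"
      by (intro sum.cong) auto
    finally show ?thesis by (simp add: res_def)
  qed
  have "(\<integral>w. res (w(l := z)) \<partial>?P) = (\<integral>w. h (w(l := z)) \<partial>?P) - mean - (proj z + (\<Sum>i\<in>{1..k} - {l}. \<integral>w. proj (w i) \<partial>?P))"
  proof -
    have si: "integrable ?P (\<lambda>w. \<Sum>i\<in>{1..k} - {l}. proj (w i))"
      by (intro Bochner_Integration.integrable_sum pi)
    have "(\<integral>w. res (w(l := z)) \<partial>?P) = (\<integral>w. h (w(l := z)) - mean \<partial>?P)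
        - (\<integral>w. proj z + (\<Sum>i\<in>{1..k} - {l}. proj (w i)) \<partial>?P)"
      unfolding eq using elim si
      by (intro Bochner_Integration.integral_diff Bochner_Integration.integrable_diff
          Bochner_Integration.integrable_add) auto
    also have "(\<integral>w. h (w(l := z)) - mean \<partial>?P) = (\<integral>w. h (w(l := z)) \<partial>?P) - mean"
      using elim by (simp add: R.prob_space)
    also have "(\<integral>w. proj z + (\<Sum>i\<in>{1..k} - {l}. proj (w i)) \<partial>?P)
        = proj z + (\<integral>w. (\<Sum>i\<in>{1..k} - {l}. proj (w i)) \<partial>?P)"
      using si by (simp add: R.prob_space)
    also have "(\<integral>w. (\<Sum>i\<in>{1..k} - {l}. proj (w i)) \<partial>?P) = (\<Sum>i\<in>{1..k} - {l}. \<integral>w. proj (w i) \<partial>?P)"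
      by (rule Bochner_Integration.integral_sum) (rule pi)
    finally show ?thesis .
  qed
  also have "(\<Sum>i\<in>{1..k} - {l}. \<integral>w. proj (w i) \<partial>?P) = 0"
    by (intro sum.neutral ballI) (simp add: P_component(2) proj_mean)
  also have "(\<integral>w. h (w(l := z)) \<partial>?P) = proj z + mean"
    using section_integral_any_coordinate[OF l] elim by simp
  finally show ?case by linarith
qed

end

locale iid_kernel_sample = square_integrable_kernel Q k h + iid_sample Q S Z
  for Q :: "'a measure" and k h and S :: "'s measure" and Z
begin

definition res_at :: "(nat \<Rightarrow> nat) \<Rightarrow> 's \<Rightarrow> real" where
  "res_at i \<omega> = res (\<lambda>l\<in>{1..k}. Z (i l) \<omega>)"

lemma res_at_measurable[measurable]: "i ` {1..k} \<subseteq> {1..} \<Longrightarrow> res_at i \<in> borel_measurable S"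
  unfolding res_at_def by (rule measurable_compose[OF sample_measurable res_measurable])

lemma res_at_sq:
  assumes "inj_on i {1..k}" "i ` {1..k} \<subseteq> {1..}"
  shows "integrable S (\<lambda>\<omega>. (res_at i \<omega>)\<^sup>2)"
    and "(\<integral>\<omega>. (res_at i \<omega>)\<^sup>2 \<partial>S) = (\<integral>x. (res x)\<^sup>2 \<partial>P {1..k})"
  using sample_integral[of i "{1..k}" "\<lambda>x. (res x)\<^sup>2"] assms res_sq by (auto simp: res_at_def)

text \<open>If the two index sets meet at most in \<open>i l\<close>, then the observations with indices \<open>J\<close>, that is, those
  entering the first residual except number \<open>i l\<close>, are independent of all the others. Integrating them
  out first makes the first factor vanish by degeneracy, while the second factor stays fixed.\<close>
lemma res_at_orthogonal:
  assumes i: "inj_on i {1..k}" "i ` {1..k} \<subseteq> {1..}" and i': "inj_on i' {1..k}" "i' ` {1..k} \<subseteq> {1..}"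
    and l: "l \<in> {1..k}" and share: "i ` {1..k} \<inter> i' ` {1..k} \<subseteq> {i l}"
  shows "(\<integral>\<omega>. res_at i \<omega> * res_at i' \<omega> \<partial>S) = 0"
proof -
  define J where "J = i ` ({1..k} - {l})"
  define C where "C = insert (i l) (i' ` {1..k})"
  have fin: "finite J" "finite C" by (auto simp: J_def C_def)
  have disj: "C \<inter> J = {}"
  proof -
    have "x \<notin> C" if x: "x \<in> J" for x
    proof -
      obtain p where p: "p \<in> {1..k}" "p \<noteq> l" "x = i p" using x unfolding J_def by blast
      have "i p \<noteq> i l" using inj_onD[OF i(1), of p l] p l by blast
      moreover have "i p \<notin> i' ` {1..k}"
      proof
        assume "i p \<in> i' ` {1..k}"
        hence "i p \<in> {i l}" using imageI[OF p(1), of i] by (intro subsetD[OF share] IntI)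
        thus False using \<open>i p \<noteq> i l\<close> by simp
      qed
      ultimately show ?thesis unfolding C_def p(3) by simp
    qed
    thus ?thesis by blast
  qed
  define F where "F x = res (\<lambda>p\<in>{1..k}. x (i p)) * res (\<lambda>p\<in>{1..k}. x (i' p))" for x :: "nat \<Rightarrow> 'a"
  have sub: "i p \<in> C \<union> J" "i' p \<in> C \<union> J" if "p \<in> {1..k}" for p
    using that by (auto simp: J_def C_def)
  have CJ: "C \<union> J \<subseteq> {1..}" using i i' l unfolding C_def J_def by blast
  have [measurable]: "(\<lambda>x. \<lambda>p\<in>{1..k}. x (i p)) \<in> P (C \<union> J) \<rightarrow>\<^sub>M P {1..k}"
       "(\<lambda>x. \<lambda>p\<in>{1..k}. x (i' p)) \<in> P (C \<union> J) \<rightarrow>\<^sub>M P {1..k}"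
    by (rule measurable_restrict, rule measurable_component_singleton, erule sub)+
  have Fm: "F \<in> borel_measurable (P (C \<union> J))" unfolding F_def by measurable
  have FZ: "F (\<lambda>n\<in>C \<union> J. Z n \<omega>) = res_at i \<omega> * res_at i' \<omega>" for \<omega>
    unfolding F_def res_at_def using sub by (intro arg_cong2[where f="(*)"] arg_cong[where f=res]) (auto simp: restrict_def fun_eq_iff)
  have CJ': "id ` (C \<union> J) \<subseteq> {1..}" using CJ by (simp only: image_id id_apply)
  note si = sample_integral[OF inj_on_id CJ' Fm, unfolded id_apply FZ]
  have int: "integrable (P (C \<union> J)) F"
    unfolding si(2)[symmetric] using i i' by (intro integrable_mult_of_squares res_at_sq res_at_measurable)
  have mC: "(\<lambda>y. y (i l)) \<in> P C \<rightarrow>\<^sub>M Q" by (intro measurable_component_singleton) (auto simp: C_def)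
  have "AE z in distr (P C) Q (\<lambda>y. y (i l)). (\<integral>w. res (w(l := z)) \<partial>P ({1..k} - {l})) = 0"
    unfolding distr_PiM_component[of C "\<lambda>_. Q", OF Q.prob_space_axioms, of "i l", unfolded C_def, OF insertI1, folded C_def]
    by (rule res_degenerate[OF l])
  hence ae: "AE y in P C. (\<integral>w. res (w(l := y (i l))) \<partial>P ({1..k} - {l})) = 0"
    by (rule AE_distrD[OF mC])
  have d: "distr (P J) (P ({1..k} - {l})) (\<lambda>x. \<lambda>p\<in>{1..k} - {l}. x (i p)) = P ({1..k} - {l})"
    using distr_PiM_reindex[of J "\<lambda>_. Q", OF Q.prob_space_axioms inj_on_subset[OF i(1) Diff_subset]]
    by (simp add: J_def)
  have inner: "(\<integral>x. F (merge C J (y, x)) \<partial>P J) = 0"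
    if y: "y \<in> space (P C)" and zero: "(\<integral>w. res (w(l := y (i l))) \<partial>P ({1..k} - {l})) = 0" for y
  proof -
    have il: "y (i l) \<in> space Q" using measurable_space[OF mC y] .
    have "(\<lambda>p\<in>{1..k}. merge C J (y, x) (i p)) = (\<lambda>p\<in>{1..k} - {l}. x (i p))(l := y (i l))" for x
    proof
      fix p
      have "i p \<in> J" "i p \<notin> C" if "p \<noteq> l" "p \<in> {1..k}" using that disj by (auto simp: J_def)
      moreover have "i l \<in> C" by (simp add: C_def)
      ultimately show "(\<lambda>p\<in>{1..k}. merge C J (y, x) (i p)) p = ((\<lambda>p\<in>{1..k} - {l}. x (i p))(l := y (i l))) p"
        using l by (cases "p = l") (simp_all add: merge_def restrict_def)
    qed
    moreover have "(\<lambda>p\<in>{1..k}. merge C J (y, x) (i' p)) = (\<lambda>p\<in>{1..k}. y (i' p))" for x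
      by (auto simp: fun_eq_iff merge_def C_def)
    ultimately have "(\<integral>x. F (merge C J (y, x)) \<partial>P J) 
      = (\<integral>x. res ((\<lambda>p\<in>{1..k} - {l}. x (i p))(l := y (i l))) \<partial>P J) * res (\<lambda>p\<in>{1..k}. y (i' p))"
      unfolding F_def by simp
    also have "(\<integral>x. res ((\<lambda>p\<in>{1..k} - {l}. x (i p))(l := y (i l))) \<partial>P J)
       = (\<integral>w. res (w(l := y (i l))) \<partial>distr (P J) (P ({1..k} - {l})) (\<lambda>x. \<lambda>p\<in>{1..k} - {l}. x (i p)))"
    proof (rule integral_distr[symmetric])
      show "(\<lambda>x. \<lambda>p\<in>{1..k} - {l}. x (i p)) \<in> P J \<rightarrow>\<^sub>M P ({1..k} - {l})"
        by (intro measurable_restrict measurable_component_singleton) (auto simp: J_def)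
      have "(\<lambda>w. w(l := y (i l))) \<in> P ({1..k} - {l}) \<rightarrow>\<^sub>M P {1..k}"
        using measurable_compose[OF measurable_Pair1' upd_measurable[OF l], OF il] by simp
      thus "(\<lambda>w. res (w(l := y (i l)))) \<in> borel_measurable (P ({1..k} - {l}))"
        by (rule measurable_compose) measurable
    qed
    finally show ?thesis using d zero by simp
  qed
  have "(\<integral>\<omega>. res_at i \<omega> * res_at i' \<omega> \<partial>S) = (\<integral>x. F x \<partial>P (C \<union> J))" by (rule si(1))
  also have "\<dots> = (\<integral>y. (\<integral>x. F (merge C J (y, x)) \<partial>P J) \<partial>P C)"
    by (rule product_integral_fold[OF disj fin(2) fin(1) int])
  also have "\<dots> = 0"
  proof (rule integral_eq_zero_AE)
    show "AE y in P C. (\<integral>x. F (merge C J (y, x)) \<partial>P J) = 0"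
      using AE_space ae by eventually_elim (rule inner)
  qed
  finally show ?thesis .
qed

definition index_maps :: "nat \<Rightarrow> (nat \<Rightarrow> nat) set" where
  "index_maps N = {i \<in> {1..k} \<rightarrow>\<^sub>E {1..N}. strict_mono_on {1..k} i}"

lemma index_maps_D:
  assumes "i \<in> index_maps N"
  shows "inj_on i {1..k}" "i ` {1..k} \<subseteq> {1..N}" "i ` {1..k} \<subseteq> {1..}" "card (i ` {1..k}) = k"
proof -
  show "inj_on i {1..k}" using assms strict_mono_on_imp_inj_on by (auto simp: index_maps_def)
  thus "card (i ` {1..k}) = k" by (simp add: card_image)
  show "i ` {1..k} \<subseteq> {1..N}" "i ` {1..k} \<subseteq> {1..}" using assms by (auto simp: index_maps_def)
qed

lemma bij_index_maps: "bij_betw (\<lambda>i. i ` {1..k}) (index_maps N) {A. A \<subseteq> {1..N} \<and> card A = k}"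
  unfolding index_maps_def by (rule bij_betw_increasing_maps_subsets)

lemma finite_index_maps: "finite (index_maps N)"
  using bij_betw_finite[OF bij_index_maps, of N] by simp

lemma card_index_maps: "card (index_maps N) = N choose k"
  using bij_betw_same_card[OF bij_index_maps, of N] n_subsets[of "{1..N}" k] by simp

text \<open>Each index \<open>n\<close> lies in exactly \<open>(N - 1) choose (k - 1)\<close> of the \<open>k\<close>-subsets of \<open>{1..N}\<close>.\<close>
lemma sum_over_increasing_maps:
  fixes \<phi> :: "nat \<Rightarrow> real"
  shows "(\<Sum>i\<in>index_maps N. \<Sum>l\<in>{1..k}. \<phi> (i l)) = real ((N - 1) choose (k - 1)) * (\<Sum>n\<in>{1..N}. \<phi> n)"
proof -
  let ?S = "{A. A \<subseteq> {1..N} \<and> card A = k}"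
  have "(\<Sum>i\<in>index_maps N. \<Sum>l\<in>{1..k}. \<phi> (i l)) = (\<Sum>i\<in>index_maps N. \<Sum>n\<in>i ` {1..k}. \<phi> n)"
    by (rule sum.cong[OF refl]) (simp only: sum.reindex[OF index_maps_D(1)] comp_def)
  also have "\<dots> = (\<Sum>A\<in>?S. \<Sum>n\<in>A. \<phi> n)"
    by (rule sum.reindex_bij_betw[OF bij_index_maps])
  also have "\<dots> = (\<Sum>A\<in>?S. \<Sum>n\<in>{1..N}. if n \<in> A then \<phi> n else 0)"
  proof (rule sum.cong[OF refl])
    fix A assume "A \<in> ?S"
    hence "{1..N} \<inter> A = A" by blast
    thus "(\<Sum>n\<in>A. \<phi> n) = (\<Sum>n\<in>{1..N}. if n \<in> A then \<phi> n else 0)"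
      using sum.inter_restrict[of "{1..N}" \<phi> A] by simp
  qed
  also have "\<dots> = (\<Sum>n\<in>{1..N}. \<Sum>A\<in>?S. if n \<in> A then \<phi> n else 0)"
    by (rule sum.swap)
  also have "\<dots> = (\<Sum>n\<in>{1..N}. real ((N - 1) choose (k - 1)) * \<phi> n)"
  proof (intro sum.cong refl)
    fix n assume n: "n \<in> {1..N}"
    have "(\<Sum>A\<in>?S. if n \<in> A then \<phi> n else 0) = real (card (?S \<inter> {A. n \<in> A})) * \<phi> n"
      by (subst sum.If_cases) auto
    also have "?S \<inter> {A. n \<in> A} = {A. A \<subseteq> {1..N} \<and> card A = k \<and> {n} \<subseteq> A}" by auto
    also have "card \<dots> = (N - 1) choose (k - 1)"
      using card_supersets_of_size[of "{1..N}" "{n}" k] n k by (simp add: One_nat_def)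
    finally show "(\<Sum>A\<in>?S. if n \<in> A then \<phi> n else 0) = real ((N - 1) choose (k - 1)) * \<phi> n" .
  qed
  finally show ?thesis by (simp add: sum_distrib_left)
qed

lemma u_statistic_decomposition:
  assumes N: "k \<le> N"
  shows "u_statistic k h N (\<lambda>i. Z i \<omega>) - mean
     = real k / real N * (\<Sum>n\<in>{1..N}. proj (Z n \<omega>)) + (\<Sum>i\<in>index_maps N. res_at i \<omega>) / real (N choose k)"
proof -
  have pos: "real (N choose k) > 0" using N by simp
  have "(\<Sum>i\<in>index_maps N. h (\<lambda>l\<in>{1..k}. Z (i l) \<omega>))
      = (\<Sum>i\<in>index_maps N. res_at i \<omega> + mean + (\<Sum>l\<in>{1..k}. proj (Z (i l) \<omega>)))"
    by (intro sum.cong refl) (simp add: res_at_def res_def)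
  also have "\<dots> = (\<Sum>i\<in>index_maps N. res_at i \<omega>) + real (N choose k) * mean
       + real ((N - 1) choose (k - 1)) * (\<Sum>n\<in>{1..N}. proj (Z n \<omega>))"
    using sum_over_increasing_maps[of "\<lambda>n. proj (Z n \<omega>)" N] by (simp add: sum.distrib card_index_maps)
  finally have "u_statistic k h N (\<lambda>i. Z i \<omega>) = ((\<Sum>i\<in>index_maps N. res_at i \<omega>) + real (N choose k) * mean
       + real ((N - 1) choose (k - 1)) * (\<Sum>n\<in>{1..N}. proj (Z n \<omega>))) / real (N choose k)"
    unfolding u_statistic_def index_maps_def by simp
  moreover have "real ((N - 1) choose (k - 1)) / real (N choose k) = real k / real N"
  proof -
    have "real k * real (N choose k) = real N * real ((N - 1) choose (k - 1))"
      unfolding of_nat_mult[symmetric] of_nat_eq_iff using k by (intro times_binomial_minus1_eq) simp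
    thus ?thesis using pos k N by (simp add: divide_simps mult.commute)
  qed
  ultimately show ?thesis using pos
    by (simp add: add_divide_distrib times_divide_eq_left[symmetric] del: times_divide_eq_left)
qed

text \<open>In the expanded square only the pairs of index sets with at least two common elements survive, and
  each of them contributes at most the second moment of one residual.\<close>
lemma res_sum_second_moment:
  assumes N: "2 \<le> N" "k \<le> N"
  shows "(\<integral>\<omega>. (\<Sum>i\<in>index_maps N. res_at i \<omega>)\<^sup>2 \<partial>S)
     \<le> (\<integral>x. (res x)\<^sup>2 \<partial>P {1..k}) *
       ((real k * (real k - 1))\<^sup>2 / (2 * real N * (real N - 1)) * (real (N choose k))\<^sup>2)"
proof -
  let ?c = "\<integral>x. (res x)\<^sup>2 \<partial>P {1..k}"
  let ?sh = "\<lambda>i i'. 2 \<le> card (i ` {1..k} \<inter> i' ` {1..k})"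
  have c: "?c \<ge> 0" by simp
  have int: "integrable S (\<lambda>\<omega>. res_at i \<omega> * res_at i' \<omega>)" if "i \<in> index_maps N" "i' \<in> index_maps N" for i i'
    using that by (intro integrable_mult_of_squares res_at_sq res_at_measurable index_maps_D)
  have le: "(\<integral>\<omega>. res_at i \<omega> * res_at i' \<omega> \<partial>S) \<le> (if ?sh i i' then ?c else 0)"
    if "i \<in> index_maps N" "i' \<in> index_maps N" for i i'
  proof (cases "?sh i i'")
    case True
    have "\<bar>\<integral>\<omega>. res_at i \<omega> * res_at i' \<omega> \<partial>S\<bar>
       \<le> ((\<integral>\<omega>. (res_at i \<omega>)\<^sup>2 \<partial>S) + (\<integral>\<omega>. (res_at i' \<omega>)\<^sup>2 \<partial>S)) / 2"
      using that by (intro abs_integral_mult_le res_at_sq res_at_measurable index_maps_D)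
    also have "\<dots> = ?c" using that res_at_sq(2)[OF index_maps_D(1,3)] by simp
    finally show ?thesis using True by simp
  next
    case False
    hence "card (i ` {1..k} \<inter> i' ` {1..k}) \<le> 1" by simp
    hence "\<exists>l\<in>{1..k}. i ` {1..k} \<inter> i' ` {1..k} \<subseteq> {i l}"
    proof (cases "i ` {1..k} \<inter> i' ` {1..k} = {}")
      case True thus ?thesis using k by (intro bexI[of _ 1]) auto
    next
      case ne: False
      then obtain l where l: "l \<in> {1..k}" "i l \<in> i' ` {1..k}" by blast
      have "x = i l" if "x \<in> i ` {1..k} \<inter> i' ` {1..k}" for x
      proof -
        have "\<forall>a\<in>i ` {1..k} \<inter> i' ` {1..k}. \<forall>b\<in>i ` {1..k} \<inter> i' ` {1..k}. a = b"
          using \<open>card (i ` {1..k} \<inter> i' ` {1..k}) \<le> 1\<close> unfolding One_nat_def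
          by (subst card_le_Suc0_iff_eq[symmetric]) auto
        moreover have "i l \<in> i ` {1..k} \<inter> i' ` {1..k}" using l by blast
        ultimately show ?thesis using that by blast
      qed
      thus ?thesis using l by blast
    qed
    then obtain l where "l \<in> {1..k}" "i ` {1..k} \<inter> i' ` {1..k} \<subseteq> {i l}" by blast
    hence "(\<integral>\<omega>. res_at i \<omega> * res_at i' \<omega> \<partial>S) = 0"
      using that by (intro res_at_orthogonal index_maps_D)
    thus ?thesis using c by simp
  qed
  have "(\<integral>\<omega>. (\<Sum>i\<in>index_maps N. res_at i \<omega>)\<^sup>2 \<partial>S) = (\<integral>\<omega>. (\<Sum>i\<in>index_maps N. \<Sum>i'\<in>index_maps N. res_at i \<omega> * res_at i' \<omega>) \<partial>S)"
    by (simp add: power2_eq_square sum_product)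
  also have "\<dots> = (\<Sum>i\<in>index_maps N. \<Sum>i'\<in>index_maps N. \<integral>\<omega>. res_at i \<omega> * res_at i' \<omega> \<partial>S)"
    using int by (subst Bochner_Integration.integral_sum; (intro Bochner_Integration.integrable_sum sum.cong refl Bochner_Integration.integral_sum)?)
  also have "\<dots> \<le> (\<Sum>i\<in>index_maps N. \<Sum>i'\<in>index_maps N. if ?sh i i' then ?c else 0)"
    by (intro sum_mono le)
  also have "\<dots> = (\<Sum>p\<in>index_maps N \<times> index_maps N. if ?sh (fst p) (snd p) then ?c else 0)"
    by (simp add: sum.cartesian_product case_prod_unfold)
  also have "\<dots> = ?c * real (card {p \<in> index_maps N \<times> index_maps N. ?sh (fst p) (snd p)})"
    using finite_index_maps by (subst sum.If_cases) (auto simp: Int_def intro!: arg_cong[where f=card])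
  also have "\<dots> \<le> ?c * real (card {(A, A'). A \<subseteq> {1..N} \<and> card A = k \<and> A' \<subseteq> {1..N} \<and> card A' = k \<and> 2 \<le> card (A \<inter> A')})"
    (is "_ \<le> _ * real (card ?T)")
  proof (intro mult_left_mono c)
    have "finite ?T" by (rule finite_subset[of _ "Pow {1..N} \<times> Pow {1..N}"]) auto
    moreover have "inj_on (\<lambda>p. (fst p ` {1..k}, snd p ` {1..k})) {p \<in> index_maps N \<times> index_maps N. ?sh (fst p) (snd p)}"
      using bij_betw_imp_inj_on[OF bij_index_maps, of N] by (auto simp: inj_on_def prod_eq_iff)
    moreover have "(\<lambda>p. (fst p ` {1..k}, snd p ` {1..k})) ` {p \<in> index_maps N \<times> index_maps N. ?sh (fst p) (snd p)} \<subseteq> ?T"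
      using index_maps_D(2,4) by (auto simp: image_subset_iff)
    ultimately show "real (card {p \<in> index_maps N \<times> index_maps N. ?sh (fst p) (snd p)}) \<le> real (card ?T)"
      unfolding of_nat_le_iff by (intro card_inj_on_le)
  qed
  also have "\<dots> \<le> ?c * ((real k * (real k - 1))\<^sup>2 / (2 * real N * (real N - 1)) * (real (N choose k))\<^sup>2)"
    using N k by (intro mult_left_mono c fraction_of_pairs_sharing_two)
  finally show ?thesis .
qed

text \<open>After multiplication by \<open>sqrt N\<close> the averaged residual has a second moment of order \<open>1 / N\<close>.\<close>
lemma hoeffding_projection:
  "L2_null S (\<lambda>N \<omega>. sqrt (real N) * (u_statistic k h N (\<lambda>i. Z i \<omega>) - mean)
      - real k / sqrt (real N) * (\<Sum>n\<in>{1..N}. proj (Z n \<omega>)))" (is "L2_null S ?D")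
  unfolding L2_null_def
proof (intro conjI allI)
  fix N
  have hm: "(\<lambda>\<omega>. h (\<lambda>l\<in>{1..k}. Z (i l) \<omega>)) \<in> borel_measurable S" if "i \<in> index_maps N" for i
    using sample_measurable[OF index_maps_D(3)[OF that]] h by (rule measurable_compose)
  have hi: "integrable S (\<lambda>\<omega>. (h (\<lambda>l\<in>{1..k}. Z (i l) \<omega>))\<^sup>2)" if "i \<in> index_maps N" for i
    using sample_integral(2)[OF index_maps_D(1,3)[OF that], of "\<lambda>x. (h x)\<^sup>2"] h_sq by simp
  have pm[measurable]: "(\<lambda>\<omega>. proj (Z n \<omega>)) \<in> borel_measurable S" if "n \<ge> 1" for n
    using Z_measurable[OF that] by measurable
  have pi: "integrable S (\<lambda>\<omega>. (proj (Z n \<omega>))\<^sup>2)" if n: "n \<ge> 1" for n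
    using integrable_distr_eq[OF Z_measurable[OF n], of "\<lambda>z. (proj z)\<^sup>2"] proj_sq Z_law[OF n] by simp
  have um: "(\<lambda>\<omega>. \<Sum>i\<in>index_maps N. h (\<lambda>l\<in>{1..k}. Z (i l) \<omega>)) \<in> borel_measurable S"
    using hm by (rule borel_measurable_sum)
  have ui: "integrable S (\<lambda>\<omega>. (\<Sum>i\<in>index_maps N. h (\<lambda>l\<in>{1..k}. Z (i l) \<omega>))\<^sup>2)"
    using hm hi by (rule square_integrable_sum)
  have sm: "(\<lambda>\<omega>. \<Sum>n\<in>{1..N}. proj (Z n \<omega>)) \<in> borel_measurable S"
    using pm by (intro borel_measurable_sum) auto
  have si: "integrable S (\<lambda>\<omega>. (\<Sum>n\<in>{1..N}. proj (Z n \<omega>))\<^sup>2)"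
    using pm pi by (intro square_integrable_sum) auto
  define a where "a = sqrt (real N) / real (N choose k)"
  define b where "b = - (sqrt (real N) * mean)"
  define c where "c = - (real k / sqrt (real N))"
  have eq: "?D N \<omega> = (a * (\<Sum>i\<in>index_maps N. h (\<lambda>l\<in>{1..k}. Z (i l) \<omega>)) + b) + c * (\<Sum>n\<in>{1..N}. proj (Z n \<omega>))" for \<omega>
    by (simp add: u_statistic_def a_def b_def c_def index_maps_def algebra_simps)
  show "?D N \<in> borel_measurable S" unfolding eq using um sm by measurable
  have i1: "integrable S (\<lambda>\<omega>. (a * (\<Sum>i\<in>index_maps N. h (\<lambda>l\<in>{1..k}. Z (i l) \<omega>)) + b)\<^sup>2)"
    by (rule square_integrable_add) (use um ui in \<open>auto simp: power_mult_distrib\<close>)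
  show "integrable S (\<lambda>\<omega>. (?D N \<omega>)\<^sup>2)" unfolding eq
    by (rule square_integrable_add) (use um i1 sm si in \<open>auto simp: power_mult_distrib\<close>)
next
  let ?c = "\<integral>x. (res x)\<^sup>2 \<partial>P {1..k}"
  let ?K = "?c * (real k * (real k - 1))\<^sup>2 / 2"
  have "(\<lambda>N. 1 / (real N - 1)) \<longlonglongrightarrow> 0"
    by real_asymp
  from tendsto_mult_right_zero[OF this, of ?K]
  have "(\<lambda>N. ?K / (real N - 1)) \<longlonglongrightarrow> 0" by simp
  moreover have "\<forall>\<^sub>F N in sequentially. norm (\<integral>\<omega>. (?D N \<omega>)\<^sup>2 \<partial>S) \<le> ?K / (real N - 1)"
    using eventually_ge_at_top[of k] eventually_ge_at_top[of 2]
  proof eventually_elim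
    case (elim N)
    let ?R = "\<lambda>\<omega>. \<Sum>i\<in>index_maps N. res_at i \<omega>"
    have N0: "real N > 0" "real N - 1 > 0" using elim by auto
    have C: "real (N choose k) > 0" using elim by simp
    have D: "?D N \<omega> = sqrt (real N) * (?R \<omega> / real (N choose k))" for \<omega>
    proof -
      have "sqrt (real N) * (real k / real N) = real k / sqrt (real N)"
        using N0 by (simp add: field_simps)
      moreover have "s * (a * x + b) - c * x = s * b" if "s * a = c" for s a b c x :: real
        by (simp add: that[symmetric] algebra_simps)
      ultimately show ?thesis unfolding u_statistic_decomposition[OF elim(1)] by blast
    qed
    have "norm (\<integral>\<omega>. (?D N \<omega>)\<^sup>2 \<partial>S) = real N / (real (N choose k))\<^sup>2 * (\<integral>\<omega>. (?R \<omega>)\<^sup>2 \<partial>S)"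
      unfolding D by (simp add: power_mult_distrib power_divide)
    also have "\<dots> \<le> real N / (real (N choose k))\<^sup>2 *
       (?c * ((real k * (real k - 1))\<^sup>2 / (2 * real N * (real N - 1)) * (real (N choose k))\<^sup>2))"
      by (intro mult_left_mono res_sum_second_moment elim) simp
    also have "\<dots> = ?K / (real N - 1)" using N0 C by (simp add: field_simps)
    finally show ?case .
  qed
  ultimately show "(\<lambda>N. \<integral>\<omega>. (?D N \<omega>)\<^sup>2 \<partial>S) \<longlonglongrightarrow> 0"
    by (rule Lim_null_comparison[rotated])
qed

text \<open>By Fubini's theorem, \<open>h\<close> and its partial integral over the arguments other than the first have the
  same integral over every event described by the first observation.\<close>
lemma conditional_expectation_given_first:
  "AE \<omega> in S. real_cond_exp S (vimage_algebra (space S) (Z 1) Q)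
     (\<lambda>\<omega>. h (\<lambda>i\<in>{1..k}. Z i \<omega>)) \<omega> = proj (Z 1 \<omega>) + mean"
proof -
  let ?F = "vimage_algebra (space S) (Z 1) Q"
  have Z1[measurable]: "Z 1 \<in> S \<rightarrow>\<^sub>M Q" by (rule Z_measurable) simp
  have Z1_law: "distr S Q (Z 1) = Q" by (rule Z_law) simp
  have sub: "subalgebra S ?F"
    using measurable_sets[OF Z1] measurable_space[OF Z1]
    by (auto simp: subalgebra_def sets_vimage_algebra2)
  have "finite_measure_subalgebra S ?F"
    using sub by unfold_locales
  then interpret finite_measure_subalgebra S ?F .
  have 1: "1 \<in> {1..k}" using k by simp
  have inj: "inj_on id {1..k}" "id ` {1..k} \<subseteq> {1..}" by auto
  note si = sample_integral[OF inj, unfolded id_apply]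
  have hi: "integrable S (\<lambda>\<omega>. h (\<lambda>i\<in>{1..k}. Z i \<omega>))"
    using si(2)[OF h] h_int by simp
  have pi: "integrable S (\<lambda>\<omega>. proj (Z 1 \<omega>) + mean)"
    using integrable_distr_eq[OF Z1, of "\<lambda>z. proj z + mean"] proj_integrable Z1_law by simp
  show ?thesis
  proof (rule real_cond_exp_charact[OF _ hi pi])
    have "Z 1 \<in> ?F \<rightarrow>\<^sub>M Q" using measurable_space[OF Z1] by (intro measurable_vimage_algebra1) auto
    thus "(\<lambda>\<omega>. proj (Z 1 \<omega>) + mean) \<in> borel_measurable ?F" by measurable
    fix A assume "A \<in> sets ?F"
    then obtain B where B[measurable]: "B \<in> sets Q" and A: "A = Z 1 -` B \<inter> space S"
      using measurable_space[OF Z1] by (auto simp: sets_vimage_algebra2)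
    have "(\<integral>\<omega>\<in>A. h (\<lambda>i\<in>{1..k}. Z i \<omega>) \<partial>S)
        = (\<integral>\<omega>. indicator B ((\<lambda>i\<in>{1..k}. Z i \<omega>) 1) * h (\<lambda>i\<in>{1..k}. Z i \<omega>) \<partial>S)"
      unfolding set_lebesgue_integral_def A using 1
      by (intro Bochner_Integration.integral_cong refl) (auto simp: indicator_def)
    also have "\<dots> = (\<integral>x. indicator B (x 1) * h x \<partial>P {1..k})"
      by (rule si(1)) (use 1 in measurable)
    also have "\<dots> = (\<integral>z. (\<integral>w. indicator B ((w(1 := z)) 1) * h (w(1 := z)) \<partial>P ({1..k} - {1})) \<partial>Q)"
    proof (rule integrable_split_coordinate(4)[OF 1, symmetric])
      show "integrable (P {1..k}) (\<lambda>x. indicator B (x 1) * h x)"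
        by (rule Bochner_Integration.integrable_bound[OF h_int])
           (use 1 in \<open>auto simp: indicator_def intro!: AE_I2\<close>)
    qed
    also have "\<dots> = (\<integral>z. indicator B z * (proj z + mean) \<partial>Q)"
      using section_integral_any_coordinate[OF 1]
      by (intro Bochner_Integration.integral_cong refl) simp
    also have "\<dots> = (\<integral>\<omega>. indicator B (Z 1 \<omega>) * (proj (Z 1 \<omega>) + mean) \<partial>S)"
      using integral_distr[OF Z1, of "\<lambda>z. indicator B z * (proj z + mean)"] Z1_law by simp
    also have "\<dots> = (\<integral>\<omega>\<in>A. proj (Z 1 \<omega>) + mean \<partial>S)"
      unfolding set_lebesgue_integral_def A
      by (intro Bochner_Integration.integral_cong refl) (auto simp: indicator_def)
    finally show "(\<integral>\<omega>\<in>A. h (\<lambda>i\<in>{1..k}. Z i \<omega>) \<partial>S) = (\<integral>\<omega>\<in>A. proj (Z 1 \<omega>) + mean \<partial>S)" .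
  qed
qed

end

text \<open>Dividing the projection theorem by \<open>sqrt N\<close> leaves the sample mean of the projections, to which the
  weak law of large numbers applies.\<close>
lemma (in iid_kernel_sample) u_statistic_L2_consistent:
  "L2_null S (\<lambda>N \<omega>. u_statistic k h N (\<lambda>i. Z i \<omega>) - mean)"
proof -
  let ?D = "\<lambda>N \<omega>. sqrt (real N) * (u_statistic k h N (\<lambda>i. Z i \<omega>) - mean)
      - real k / sqrt (real N) * (\<Sum>n\<in>{1..N}. proj (Z n \<omega>))"
  let ?E = "\<lambda>N \<omega>. inverse (sqrt (real N)) * ?D N \<omega> + real k * ((\<Sum>n\<in>{1..N}. proj (Z n \<omega>)) / real N)"
  have "inverse (sqrt (real N)) \<le> 1" for N
  proof (cases "N = 0")
    case False
    hence "1 \<le> sqrt (real N)" by simp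
    thus ?thesis by (simp add: inverse_le_1_iff)
  qed simp
  hence a: "L2_null S (\<lambda>N \<omega>. inverse (sqrt (real N)) * ?D N \<omega>)"
    by (intro L2_null_scale[OF hoeffding_projection, of _ 1]) simp
  have b: "L2_null S (\<lambda>N \<omega>. real k * ((\<Sum>n\<in>{1..N}. proj (Z n \<omega>)) / real N))"
    by (rule L2_null_scale[OF sample_mean_L2_null[OF proj_measurable proj_sq proj_mean], of _ "real k"]) simp
  have E: "L2_null S ?E" by (rule L2_null_add[OF a b])
  have eq: "?E N \<omega> = (if N = 0 then 0 else u_statistic k h N (\<lambda>i. Z i \<omega>) - mean)" for N \<omega>
  proof (cases "N = 0")
    case False
    have "inverse s * (s * x - c / s * y) + c * (y / (s * s)) = x" if "s > 0" for s x y c :: real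
      using that by (simp add: field_simps)
    from this[of "sqrt (real N)"] False show ?thesis by simp
  qed simp
  \<comment> \<open>\<open>N = 0\<close> is the only index at which the two sequences differ.\<close>
  have c: "L2_null S (\<lambda>N \<omega>. if N = 0 then - mean else 0)"
  proof -
    have "(\<lambda>N. if N = 0 then mean\<^sup>2 else 0) \<longlonglongrightarrow> 0"
      by (rule tendsto_eventually) (use eventually_gt_at_top[of 0] in \<open>eventually_elim, simp\<close>)
    moreover have "(\<integral>\<omega>. (if N = 0 then - mean else 0)\<^sup>2 \<partial>S) = (if N = 0 then mean\<^sup>2 else 0)" for N :: nat
      by (simp add: S.prob_space)
    ultimately have "(\<lambda>N. \<integral>\<omega>. (if N = (0::nat) then - mean else 0)\<^sup>2 \<partial>S) \<longlonglongrightarrow> 0"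
      by (simp only:)
    thus ?thesis unfolding L2_null_def by (intro conjI allI) simp_all
  qed
  have "u_statistic k h 0 (\<lambda>i. Z i \<omega>) = 0" for \<omega>
    using k by (simp add: u_statistic_def)
  hence "u_statistic k h N (\<lambda>i. Z i \<omega>) - mean = ?E N \<omega> + (if N = 0 then - mean else 0)" for N \<omega>
    unfolding eq by simp
  thus ?thesis using L2_null_add[OF E c] by simp
qed

section \<open>Conditional expectation by resampling\<close>

text \<open>Abstract form of the Pick-Freeze scheme: keeping the coordinates in \<open>u\<close> and redrawing the others from
  an independent copy does not change the law \<open>\<mu>\<close>. For independent inputs this is
  \<open>product_resample\<close>.\<close>
locale resampling = prob_space \<mu> for \<mu> :: "(nat \<Rightarrow> 'e) measure" +
  fixes E :: "nat \<Rightarrow> 'e measure" and I u :: "nat set"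
  assumes sets_\<mu>[measurable_cong]: "sets \<mu> = sets (PiM I E)"
    and u: "u \<subseteq> I"
    and resample_law: "distr (\<mu> \<Otimes>\<^sub>M \<mu>) \<mu> (\<lambda>(x, y). \<lambda>i\<in>I. if i \<in> u then x i else y i) = \<mu>"
begin

sublocale pair: pair_prob_space \<mu> \<mu> ..

definition mix :: "(nat \<Rightarrow> 'e) \<Rightarrow> (nat \<Rightarrow> 'e) \<Rightarrow> nat \<Rightarrow> 'e" where
  "mix x y = (\<lambda>i\<in>I. if i \<in> u then x i else y i)"

lemma mix_restrict: "mix (restrict x u) y = mix x y"
  by (auto simp: mix_def fun_eq_iff)

lemma restrict_mix: "restrict (mix x y) u = restrict x u"
  using u by (auto simp: mix_def fun_eq_iff)

lemma mix_measurable_frozen[measurable]: "(\<lambda>(a, y). mix a y) \<in> PiM u E \<Otimes>\<^sub>M \<mu> \<rightarrow>\<^sub>M \<mu>"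
proof -
  have "(\<lambda>(a, y). mix a y) \<in> PiM u E \<Otimes>\<^sub>M PiM I E \<rightarrow>\<^sub>M PiM I E"
    unfolding mix_def case_prod_unfold
  proof (rule measurable_restrict)
    fix i assume "i \<in> I"
    thus "(\<lambda>x. if i \<in> u then fst x i else snd x i) \<in> PiM u E \<Otimes>\<^sub>M PiM I E \<rightarrow>\<^sub>M E i"
      by (cases "i \<in> u") simp_all
  qed
  thus ?thesis
    by (simp cong: measurable_cong_sets add: sets_\<mu> sets_pair_measure_cong[OF refl sets_\<mu>])
qed

lemma restrict_measurable[measurable]: "(\<lambda>x. restrict x u) \<in> \<mu> \<rightarrow>\<^sub>M PiM u E"
  using measurable_restrict_subset[OF u, of E] by (simp cong: measurable_cong_sets add: sets_\<mu>)

lemma mix_measurable[measurable]: "(\<lambda>(x, y). mix x y) \<in> \<mu> \<Otimes>\<^sub>M \<mu> \<rightarrow>\<^sub>M \<mu>"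
proof -
  have "(\<lambda>(x, y). mix (restrict x u) y) \<in> \<mu> \<Otimes>\<^sub>M \<mu> \<rightarrow>\<^sub>M \<mu>" by measurable
  thus ?thesis by (simp only: mix_restrict)
qed

lemma distr_mix: "distr (\<mu> \<Otimes>\<^sub>M \<mu>) \<mu> (\<lambda>(x, y). mix x y) = \<mu>"
  using resample_law by (simp add: mix_def)

text \<open>The pair formed by the frozen coordinates \<open>restrict x u\<close> and the whole tuple has the same law whether
  or not the coordinates outside \<open>u\<close> are redrawn.\<close>
lemma nn_integral_resample:
  assumes F[measurable]: "F \<in> borel_measurable (PiM u E \<Otimes>\<^sub>M \<mu>)"
  shows "(\<integral>\<^sup>+x. F (restrict x u, x) \<partial>\<mu>) = (\<integral>\<^sup>+x. (\<integral>\<^sup>+y. F (restrict x u, mix (restrict x u) y) \<partial>\<mu>) \<partial>\<mu>)"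
proof -
  have "(\<integral>\<^sup>+x. F (restrict x u, x) \<partial>\<mu>)
      = (\<integral>\<^sup>+x. F (restrict x u, x) \<partial>distr (\<mu> \<Otimes>\<^sub>M \<mu>) \<mu> (\<lambda>(x, y). mix x y))"
    by (simp only: distr_mix)
  also have "\<dots> = (\<integral>\<^sup>+z. F (restrict (fst z) u, mix (fst z) (snd z)) \<partial>(\<mu> \<Otimes>\<^sub>M \<mu>))"
    by (subst nn_integral_distr) (auto simp: case_prod_unfold restrict_mix)
  also have "\<dots> = (\<integral>\<^sup>+x. (\<integral>\<^sup>+y. F (restrict x u, mix x y) \<partial>\<mu>) \<partial>\<mu>)"
    by (subst nn_integral_fst[symmetric]) auto
  finally show ?thesis by (simp only: mix_restrict)
qed

lemma integral_resample:
  fixes F :: "_ \<Rightarrow> real"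
  assumes F[measurable]: "F \<in> borel_measurable (PiM u E \<Otimes>\<^sub>M \<mu>)"
    and int: "integrable \<mu> (\<lambda>x. F (restrict x u, x))"
  shows "integrable (\<mu> \<Otimes>\<^sub>M \<mu>) (\<lambda>(x, y). F (restrict x u, mix x y))"
    and "(\<integral>x. F (restrict x u, x) \<partial>\<mu>) = (\<integral>x. (\<integral>y. F (restrict x u, mix x y) \<partial>\<mu>) \<partial>\<mu>)"
proof -
  have m: "(\<lambda>(x, y). mix x y) \<in> \<mu> \<Otimes>\<^sub>M \<mu> \<rightarrow>\<^sub>M \<mu>" by measurable
  have mF: "(\<lambda>x. F (restrict x u, x)) \<in> borel_measurable \<mu>" by measurable
  have i: "integrable (distr (\<mu> \<Otimes>\<^sub>M \<mu>) \<mu> (\<lambda>(x, y). mix x y)) (\<lambda>x. F (restrict x u, x))"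
    unfolding distr_mix by (rule int)
  from integrable_distr[OF m i]
  show 1: "integrable (\<mu> \<Otimes>\<^sub>M \<mu>) (\<lambda>(x, y). F (restrict x u, mix x y))"
    by (simp add: case_prod_unfold restrict_mix)
  have "(\<integral>x. F (restrict x u, x) \<partial>\<mu>)
      = (\<integral>x. F (restrict x u, x) \<partial>distr (\<mu> \<Otimes>\<^sub>M \<mu>) \<mu> (\<lambda>(x, y). mix x y))"
    by (simp only: distr_mix)
  also have "\<dots> = (\<integral>z. F (restrict (fst z) u, mix (fst z) (snd z)) \<partial>(\<mu> \<Otimes>\<^sub>M \<mu>))"
    by (subst integral_distr[OF m mF]) (simp add: case_prod_unfold restrict_mix)
  also have "\<dots> = (\<integral>x. (\<integral>y. F (restrict x u, mix x y) \<partial>\<mu>) \<partial>\<mu>)"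
    using pair.integral_fst'[OF 1] by (simp add: case_prod_unfold)
  finally show "(\<integral>x. F (restrict x u, x) \<partial>\<mu>) = (\<integral>x. (\<integral>y. F (restrict x u, mix x y) \<partial>\<mu>) \<partial>\<mu>)" .
qed

definition frozen_nn :: "((nat \<Rightarrow> 'e) \<Rightarrow> real) \<Rightarrow> (nat \<Rightarrow> 'e) \<Rightarrow> ennreal" where
  "frozen_nn t a = (\<integral>\<^sup>+y. ennreal (t (mix a y)) \<partial>\<mu>)"

text \<open>An explicit version of the conditional expectation given the coordinates in \<open>u\<close>. It follows the
  construction of \<open>real_cond_exp\<close> from the positive and the negative part, with \<open>enn2real\<close> applied to each,
  and hence agrees with it almost surely even when \<open>t\<close> is not integrable. This matters because the
  index integrates over the parameters \<open>a\<close> an expression in the conditional expectation of \<open>T a\<close>: the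
  integrand must be measurable in \<open>a\<close> also at the exceptional \<open>a\<close> for which \<open>T a\<close> is not integrable.\<close>
definition frozen_mean :: "((nat \<Rightarrow> 'e) \<Rightarrow> real) \<Rightarrow> (nat \<Rightarrow> 'e) \<Rightarrow> real" where
  "frozen_mean t a = enn2real (frozen_nn t a) - enn2real (frozen_nn (\<lambda>x. - t x) a)"

lemma frozen_nn_measurable:
  assumes [measurable]: "t \<in> borel_measurable \<mu>"
  shows "frozen_nn t \<in> borel_measurable (PiM u E)"
  unfolding frozen_nn_def by measurable

lemma frozen_mean_measurable:
  assumes "t \<in> borel_measurable \<mu>"
  shows "frozen_mean t \<in> borel_measurable (PiM u E)"
  unfolding frozen_mean_def
  using frozen_nn_measurable[OF assms] frozen_nn_measurable[OF borel_measurable_uminus[OF assms]]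
  by measurable

lemma frozen_mean_eq_integral:
  assumes "integrable \<mu> (\<lambda>y. t (mix a y))"
  shows "frozen_mean t a = (\<integral>y. t (mix a y) \<partial>\<mu>)"
  using real_lebesgue_integral_def[OF assms] by (simp add: frozen_mean_def frozen_nn_def)

text \<open>Let \<open>r x\<close> be the average of \<open>t\<close> over the redrawn coordinates. By Fubini's theorem the right-hand
  side is the integral of \<open>t * r\<close> minus the squared mean. Since \<open>r\<close> depends on the frozen
  coordinates only, resampling \<open>t * r\<close> turns its integral into that of \<open>r\<^sup>2\<close>, and \<open>r\<close> has mean \<open>m\<close>.\<close>
lemma frozen_mean_square_integral:
  assumes t[measurable]: "t \<in> borel_measurable \<mu>" and sq: "integrable \<mu> (\<lambda>x. (t x)\<^sup>2)"
  defines "m \<equiv> \<integral>x. t x \<partial>\<mu>"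
  shows "(\<integral>x. (m - frozen_mean t (restrict x u))\<^sup>2 \<partial>\<mu>) = (\<integral>x. (\<integral>y. t x * t (mix x y) \<partial>\<mu>) \<partial>\<mu>) - m\<^sup>2"
    and "integrable (\<mu> \<Otimes>\<^sub>M \<mu>) (\<lambda>(x, y). t x * t (mix x y))"
proof -
  define r where "r x = (\<integral>y. t (mix x y) \<partial>\<mu>)" for x
  have r_restrict: "r (restrict x u) = r x" for x by (simp add: r_def mix_restrict)
  have rm[measurable]: "r \<in> borel_measurable (PiM u E)" unfolding r_def by measurable
  have rm'[measurable]: "r \<in> borel_measurable \<mu>" unfolding r_def by measurable
  have t1: "integrable \<mu> t" by (rule square_integrable_imp_integrable[OF t sq])
  note R1 = integral_resample[of "\<lambda>(a, x). t x", simplified, OF t1]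
  note R2 = integral_resample[of "\<lambda>(a, x). (t x)\<^sup>2", simplified, OF sq]
  have mixm: "(\<lambda>z. t (mix (fst z) (snd z))) \<in> borel_measurable (\<mu> \<Otimes>\<^sub>M \<mu>)" by measurable
  have sq2: "integrable (\<mu> \<Otimes>\<^sub>M \<mu>) (\<lambda>z. (t (mix (fst z) (snd z)))\<^sup>2)"
    using R2(1) by (simp add: case_prod_unfold)
  have r2: "integrable \<mu> (\<lambda>x. (r x)\<^sup>2)"
    using pair_section_square_integral(1)[OF prob_space_axioms prob_space_axioms mixm sq2] by (simp add: r_def)
  have r1: "integrable \<mu> r" by (rule square_integrable_imp_integrable[OF rm' r2])
  have rmean: "(\<integral>x. r x \<partial>\<mu>) = m" using R1(2) by (simp add: r_def m_def)
  have ae: "AE x in \<mu>. frozen_mean t (restrict x u) = r x"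
    using pair.AE_integrable_fst'[OF R1(1)]
  proof eventually_elim
    case (elim x)
    thus ?case using frozen_mean_eq_integral[of t "restrict x u"] by (simp add: mix_restrict r_def)
  qed
  have fm[measurable]: "(\<lambda>x. frozen_mean t (restrict x u)) \<in> borel_measurable \<mu>"
    using frozen_mean_measurable[OF t] by measurable
  have tsq: "integrable (\<mu> \<Otimes>\<^sub>M \<mu>) (\<lambda>z. (t (fst z))\<^sup>2)"
    using integrable_distr_eq[of fst "\<mu> \<Otimes>\<^sub>M \<mu>" \<mu> "\<lambda>x. (t x)\<^sup>2"] sq
    by (simp add: distr_pair_fst)
  have prod: "integrable (\<mu> \<Otimes>\<^sub>M \<mu>) (\<lambda>z. t (fst z) * t (mix (fst z) (snd z)))"
    by (rule integrable_mult_of_squares[OF _ mixm tsq sq2]) measurable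
  thus "integrable (\<mu> \<Otimes>\<^sub>M \<mu>) (\<lambda>(x, y). t x * t (mix x y))" by (simp add: case_prod_unfold)
  have tr: "integrable \<mu> (\<lambda>x. t x * r x)" by (rule integrable_mult_of_squares[OF t rm' sq r2])
  have "(\<integral>x. (\<integral>y. t x * t (mix x y) \<partial>\<mu>) \<partial>\<mu>) = (\<integral>x. t x * r x \<partial>\<mu>)" by (simp add: r_def)
  also have "\<dots> = (\<integral>x. (\<integral>y. t (mix x y) * r x \<partial>\<mu>) \<partial>\<mu>)"
    using integral_resample(2)[of "\<lambda>(a, x). t x * r a"] tr by (simp add: r_restrict)
  also have "\<dots> = (\<integral>x. (r x)\<^sup>2 \<partial>\<mu>)" by (simp add: r_def power2_eq_square)
  finally have T: "(\<integral>x. (\<integral>y. t x * t (mix x y) \<partial>\<mu>) \<partial>\<mu>) = (\<integral>x. (r x)\<^sup>2 \<partial>\<mu>)" .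
  have "(\<integral>x. (m - frozen_mean t (restrict x u))\<^sup>2 \<partial>\<mu>) = (\<integral>x. (r x - m)\<^sup>2 \<partial>\<mu>)"
    using ae by (intro integral_cong_AE) (auto simp: power2_commute)
  also have "\<dots> = (\<integral>x. (r x)\<^sup>2 \<partial>\<mu>) - m\<^sup>2" using variance_eq[OF r1 r2] rmean by simp
  finally show "(\<integral>x. (m - frozen_mean t (restrict x u))\<^sup>2 \<partial>\<mu>)
      = (\<integral>x. (\<integral>y. t x * t (mix x y) \<partial>\<mu>) \<partial>\<mu>) - m\<^sup>2" using T by simp
qed

text \<open>The defining property of the conditional expectation, tested on events \<open>restrict (X \<omega>) u \<in> B\<close>, is
  resampling applied to \<open>s x * indicator B a\<close> for \<open>s = t\<close> and \<open>s = - t\<close>.\<close>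
lemma conditional_expectation_frozen:
  assumes M: "prob_space M" and X[measurable]: "X \<in> M \<rightarrow>\<^sub>M \<mu>" and law: "distr M \<mu> X = \<mu>"
    and t[measurable]: "t \<in> borel_measurable \<mu>"
  shows "AE \<omega> in M. real_cond_exp M (vimage_algebra (space M) (\<lambda>\<omega>. restrict (X \<omega>) u) (PiM u E))
    (\<lambda>\<omega>. t (X \<omega>)) \<omega> = frozen_mean t (restrict (X \<omega>) u)"
proof -
  interpret M: prob_space M by fact
  let ?Y = "\<lambda>\<omega>. restrict (X \<omega>) u"
  let ?F = "vimage_algebra (space M) ?Y (PiM u E)"
  have Y[measurable]: "?Y \<in> M \<rightarrow>\<^sub>M PiM u E" by measurable
  have Ysp: "?Y \<in> space M \<rightarrow> space (PiM u E)" using measurable_space[OF Y] by blast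
  have sub: "subalgebra M ?F"
    using measurable_sets[OF Y] Ysp by (auto simp: subalgebra_def sets_vimage_algebra2)
  have "finite_measure_subalgebra M ?F"
    using sub by unfold_locales
  then interpret finite_measure_subalgebra M ?F .
  have nn: "AE \<omega> in M. frozen_nn s (?Y \<omega>) = nn_cond_exp M ?F (\<lambda>\<omega>. ennreal (s (X \<omega>))) \<omega>"
    if s[measurable]: "s \<in> borel_measurable \<mu>" for s
  proof (rule nn_cond_exp_charact)
    have fm[measurable]: "frozen_nn s \<in> borel_measurable (PiM u E)" by (rule frozen_nn_measurable[OF s])
    have "?Y \<in> ?F \<rightarrow>\<^sub>M PiM u E" by (rule measurable_vimage_algebra1[OF Ysp])
    thus "(\<lambda>\<omega>. frozen_nn s (?Y \<omega>)) \<in> borel_measurable ?F" by measurable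
    show "(\<lambda>\<omega>. ennreal (s (X \<omega>))) \<in> borel_measurable M" by measurable
    fix A assume "A \<in> sets ?F"
    then obtain B where B[measurable]: "B \<in> sets (PiM u E)" and A: "A = ?Y -` B \<inter> space M"
      using Ysp by (auto simp: sets_vimage_algebra2)
    have trans: "(\<integral>\<^sup>+\<omega>. G (X \<omega>) \<partial>M) = (\<integral>\<^sup>+x. G x \<partial>\<mu>)" if [measurable]: "G \<in> borel_measurable \<mu>" for G
      using nn_integral_distr[OF X, of G] law that by simp
    have "(\<integral>\<^sup>+\<omega>\<in>A. ennreal (s (X \<omega>)) \<partial>M) = (\<integral>\<^sup>+\<omega>. ennreal (s (X \<omega>)) * indicator B (?Y \<omega>) \<partial>M)"
      unfolding A by (intro nn_integral_cong) (simp add: indicator_def)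
    also have "\<dots> = (\<integral>\<^sup>+x. ennreal (s x) * indicator B (restrict x u) \<partial>\<mu>)"
      by (rule trans) measurable
    also have "\<dots> = (\<integral>\<^sup>+x. (\<integral>\<^sup>+y. ennreal (s (mix (restrict x u) y)) * indicator B (restrict x u) \<partial>\<mu>) \<partial>\<mu>)"
      using nn_integral_resample[of "\<lambda>(a, x). ennreal (s x) * indicator B a"] by simp
    also have "\<dots> = (\<integral>\<^sup>+x. frozen_nn s (restrict x u) * indicator B (restrict x u) \<partial>\<mu>)"
    proof (rule nn_integral_cong)
      fix x assume x: "x \<in> space \<mu>"
      have [measurable]: "(\<lambda>y. mix (restrict x u) y) \<in> \<mu> \<rightarrow>\<^sub>M \<mu>"
        using measurable_compose[OF measurable_Pair1' mix_measurable_frozen, OF measurable_space[OF restrict_measurable x]]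
        by simp
      show "(\<integral>\<^sup>+y. ennreal (s (mix (restrict x u) y)) * indicator B (restrict x u) \<partial>\<mu>)
          = frozen_nn s (restrict x u) * indicator B (restrict x u)"
        unfolding frozen_nn_def by (intro nn_integral_multc) measurable
    qed
    also have "\<dots> = (\<integral>\<^sup>+\<omega>. frozen_nn s (?Y \<omega>) * indicator B (?Y \<omega>) \<partial>M)"
      by (rule trans[symmetric]) measurable
    also have "\<dots> = (\<integral>\<^sup>+\<omega>\<in>A. frozen_nn s (?Y \<omega>) \<partial>M)"
      unfolding A by (intro nn_integral_cong) (simp add: indicator_def)
    finally show "(\<integral>\<^sup>+\<omega>\<in>A. ennreal (s (X \<omega>)) \<partial>M) = (\<integral>\<^sup>+\<omega>\<in>A. frozen_nn s (?Y \<omega>) \<partial>M)" .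
  qed
  show ?thesis
    using nn[OF t] nn[OF borel_measurable_uminus[OF t]]
    by eventually_elim (simp add: real_cond_exp_def frozen_mean_def)
qed

end

text \<open>On a box the event splits into a condition on the first tuple in the coordinates of \<open>u\<close> and a condition
  on the second tuple in the others, and the two probabilities multiply to that of the box.\<close>
lemma product_resample:
  fixes D :: "nat \<Rightarrow> 'e measure"
  assumes I: "finite I" and D: "\<And>i. i \<in> I \<Longrightarrow> prob_space (D i)" and u: "u \<subseteq> I"
  shows "distr (PiM I D \<Otimes>\<^sub>M PiM I D) (PiM I D) (\<lambda>(x, y). \<lambda>i\<in>I. if i \<in> u then x i else y i) = PiM I D"
proof -
  \<comment> \<open>Point masses outside \<open>I\<close> extend the family to all indices, as \<open>product_prob_space\<close> demands.\<close>
  define D' where "D' i = (if i \<in> I then D i else return (count_space UNIV) undefined)" for i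
  have pD': "prob_space (D' i)" for i
    using D by (auto simp: D'_def intro!: prob_space_return)
  interpret D': product_prob_space D' by (rule product_prob_spaceI) (rule pD')
  have eq: "PiM I D = PiM I D'" by (intro PiM_cong) (auto simp: D'_def)
  have sf: "sigma_finite_measure (PiM I D')"
    by (intro prob_space_imp_sigma_finite prob_space_PiM pD')
  let ?f = "\<lambda>(x, y). \<lambda>i\<in>I. if i \<in> u then x i else y i"
  have f: "?f \<in> PiM I D' \<Otimes>\<^sub>M PiM I D' \<rightarrow>\<^sub>M PiM I D'"
    unfolding case_prod_unfold
  proof (rule measurable_restrict)
    fix i assume "i \<in> I"
    thus "(\<lambda>x. if i \<in> u then fst x i else snd x i) \<in> PiM I D' \<Otimes>\<^sub>M PiM I D' \<rightarrow>\<^sub>M D' i"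
      by (cases "i \<in> u") simp_all
  qed
  have "distr (PiM I D' \<Otimes>\<^sub>M PiM I D') (PiM I D') ?f = PiM I D'"
  proof (rule D'.PiM_eqI[OF I])
    fix A assume A: "\<And>i. i \<in> I \<Longrightarrow> A i \<in> sets (D' i)"
    define B where "B i = (if i \<in> u then A i else space (D' i))" for i
    define C where "C i = (if i \<in> u then space (D' i) else A i)" for i
    have BC: "B i \<in> sets (D' i)" "C i \<in> sets (D' i)" if "i \<in> I" for i
      using A[OF that] by (auto simp: B_def C_def)
    have "?f -` Pi\<^sub>E I A \<inter> space (PiM I D' \<Otimes>\<^sub>M PiM I D') = Pi\<^sub>E I B \<times> Pi\<^sub>E I C"
    proof (intro set_eqI iffI)
      fix z assume z: "z \<in> ?f -` Pi\<^sub>E I A \<inter> space (PiM I D' \<Otimes>\<^sub>M PiM I D')"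
      have 1: "fst z \<in> Pi\<^sub>E I (\<lambda>i. space (D' i))" "snd z \<in> Pi\<^sub>E I (\<lambda>i. space (D' i))"
        using z by (auto simp: space_pair_measure space_PiM)
      have 2: "(if i \<in> u then fst z i else snd z i) \<in> A i" if "i \<in> I" for i
        using z that by (auto simp: case_prod_unfold PiE_iff)
      have "fst z i \<in> B i" "snd z i \<in> C i" if "i \<in> I" for i
        using 1 2[OF that] that by (auto simp: B_def C_def PiE_iff split: if_splits)
      thus "z \<in> Pi\<^sub>E I B \<times> Pi\<^sub>E I C"
        using 1 by (auto simp: mem_Times_iff PiE_iff)
    next
      fix z assume "z \<in> Pi\<^sub>E I B \<times> Pi\<^sub>E I C"
      hence 1: "fst z \<in> Pi\<^sub>E I B" "snd z \<in> Pi\<^sub>E I C" by auto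
      have "fst z \<in> Pi\<^sub>E I (\<lambda>i. space (D' i))" "snd z \<in> Pi\<^sub>E I (\<lambda>i. space (D' i))"
        using 1 subsetD[OF sets.sets_into_space[OF BC(1)]] subsetD[OF sets.sets_into_space[OF BC(2)]]
        by (simp_all add: PiE_iff)
      moreover have "?f z \<in> Pi\<^sub>E I A"
        using 1 by (auto simp: PiE_iff B_def C_def case_prod_unfold split: if_splits)
      ultimately show "z \<in> ?f -` Pi\<^sub>E I A \<inter> space (PiM I D' \<Otimes>\<^sub>M PiM I D')"
        by (auto simp: space_pair_measure space_PiM mem_Times_iff)
    qed
    hence "emeasure (distr (PiM I D' \<Otimes>\<^sub>M PiM I D') (PiM I D') ?f) (Pi\<^sub>E I A)
        = emeasure (PiM I D' \<Otimes>\<^sub>M PiM I D') (Pi\<^sub>E I B \<times> Pi\<^sub>E I C)"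
      using f A I by (subst emeasure_distr) auto
    also have "\<dots> = (\<Prod>i\<in>I. emeasure (D' i) (B i)) * (\<Prod>i\<in>I. emeasure (D' i) (C i))"
      using BC I by (simp add: sigma_finite_measure.emeasure_pair_measure_Times[OF sf] D'.emeasure_PiM)
    also have "\<dots> = (\<Prod>i\<in>I. emeasure (D' i) (A i))"
      unfolding prod.distrib[symmetric] using prob_space.emeasure_space_1[OF pD']
      by (intro prod.cong refl) (auto simp: B_def C_def)
    finally show "emeasure (distr (PiM I D' \<Otimes>\<^sub>M PiM I D') (PiM I D') ?f) (Pi\<^sub>E I A)
       = (\<Prod>i\<in>I. emeasure (D' i) (A i))" .
  qed simp
  thus ?thesis unfolding eq .
qed

section \<open>Means of the symmetrized kernels\<close>

lemma symmetrize_permute: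
  assumes "\<sigma> permutes {1..k}"
  shows "symmetrize k \<Phi> (\<lambda>i. z (\<sigma> i)) = symmetrize k \<Phi> z"
proof -
  have "(\<Sum>\<tau> | \<tau> permutes {1..k}. \<Phi> (\<lambda>i. z (\<tau> i))) = (\<Sum>\<tau> | \<tau> permutes {1..k}. \<Phi> (\<lambda>i. z ((\<sigma> \<circ> \<tau>) i)))"
    by (rule setum_permutations_compose_left[OF assms])
  thus ?thesis by (simp add: symmetrize_def)
qed

lemma
  assumes Q: "prob_space Q" and \<Phi>: "\<Phi> \<in> borel_measurable (PiM {1..k} (\<lambda>_. Q))"
  shows symmetrize_measurable: "symmetrize k \<Phi> \<in> borel_measurable (PiM {1..k} (\<lambda>_. Q))"
    and integral_symmetrize: "integrable (PiM {1..k} (\<lambda>_. Q)) \<Phi> \<Longrightarrow>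
      (\<integral>z. symmetrize k \<Phi> z \<partial>PiM {1..k} (\<lambda>_. Q)) = (\<integral>z. \<Phi> z \<partial>PiM {1..k} (\<lambda>_. Q))"
proof -
  let ?P = "PiM {1..k} (\<lambda>_. Q)"
  define \<rho> where "\<rho> \<tau> z = (\<lambda>i\<in>{1..k}. z (\<tau> i))" for \<tau> :: "nat \<Rightarrow> nat" and z :: "nat \<Rightarrow> 'a"
  let ?\<tau>s = "{\<tau>. \<tau> permutes {1..k}}"
  have \<rho>_m: "\<rho> \<tau> \<in> ?P \<rightarrow>\<^sub>M ?P" if "\<tau> permutes {1..k}" for \<tau>
    unfolding \<rho>_def
  proof (rule measurable_restrict)
    fix i assume "i \<in> {1..k}"
    hence "\<tau> i \<in> {1..k}" using permutes_in_image[OF that] by simp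
    thus "(\<lambda>z. z (\<tau> i)) \<in> ?P \<rightarrow>\<^sub>M Q" by (rule measurable_component_singleton)
  qed
  have \<rho>_eq: "(\<lambda>i. z (\<tau> i)) = \<rho> \<tau> z" if \<tau>: "\<tau> permutes {1..k}" and z: "z \<in> space ?P" for \<tau> z
  proof
    fix i show "z (\<tau> i) = \<rho> \<tau> z i"
    proof (cases "i \<in> {1..k}")
      case False
      hence "\<tau> i = i" using \<tau> by (simp add: permutes_def)
      moreover have "z i = undefined" using z False unfolding space_PiM by (rule PiE_arb)
      ultimately show ?thesis using False by (simp add: \<rho>_def)
    qed (simp add: \<rho>_def)
  qed
  have \<rho>_law: "distr ?P ?P (\<rho> \<tau>) = ?P" if \<tau>: "\<tau> permutes {1..k}" for \<tau>
    unfolding \<rho>_def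
    by (rule distr_PiM_reindex) (use Q \<tau> permutes_inj_on[OF \<tau>] permutes_in_image[OF \<tau>] in auto)
  have sym: "symmetrize k \<Phi> z = (\<Sum>\<tau>\<in>?\<tau>s. \<Phi> (\<rho> \<tau> z)) / fact k" if "z \<in> space ?P" for z
    unfolding symmetrize_def using \<rho>_eq[OF _ that] by simp
  have "(\<lambda>z. (\<Sum>\<tau>\<in>?\<tau>s. \<Phi> (\<rho> \<tau> z)) / fact k) \<in> borel_measurable ?P"
    using measurable_compose[OF \<rho>_m \<Phi>] by (intro borel_measurable_divide borel_measurable_sum) auto
  thus "symmetrize k \<Phi> \<in> borel_measurable ?P"
    by (subst measurable_cong[OF sym])
  assume int: "integrable ?P \<Phi>"
  have i: "integrable ?P (\<lambda>z. \<Phi> (\<rho> \<tau> z))" "(\<integral>z. \<Phi> (\<rho> \<tau> z) \<partial>?P) = (\<integral>z. \<Phi> z \<partial>?P)" if "\<tau> \<in> ?\<tau>s" for \<tau>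
    using that integrable_distr_eq[OF \<rho>_m \<Phi>, of \<tau>] integral_distr[OF \<rho>_m \<Phi>, of \<tau>] \<rho>_law[of \<tau>] int by auto
  have "(\<integral>z. symmetrize k \<Phi> z \<partial>?P) = (\<integral>z. (\<Sum>\<tau>\<in>?\<tau>s. \<Phi> (\<rho> \<tau> z)) / fact k \<partial>?P)"
    by (rule Bochner_Integration.integral_cong[OF refl sym])
  also have "\<dots> = (\<Sum>\<tau>\<in>?\<tau>s. \<integral>z. \<Phi> (\<rho> \<tau> z) \<partial>?P) / fact k"
    by (simp add: Bochner_Integration.integral_sum i(1))
  also have "\<dots> = real (card ?\<tau>s) * (\<integral>z. \<Phi> z \<partial>?P) / fact k"
    by (simp add: i(2))
  also have "card ?\<tau>s = fact k" using card_permutations[of "{1..k}" k] by simp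
  finally show "(\<integral>z. symmetrize k \<Phi> z \<partial>?P) = (\<integral>z. \<Phi> z \<partial>?P)" by simp
qed

text \<open>A statistic of the first \<open>n\<close> observations is independent of the next one. Applied once and twice, this
  gives the joint law of the parameters of the test function with one and with two further pairs.\<close>
lemma distr_append_coordinate:
  fixes Q :: "'a measure" and B :: "'b measure" and n :: nat
  assumes Q: "prob_space Q" and B: "prob_space B"
    and \<psi>: "\<psi> \<in> PiM {1..n} (\<lambda>_. Q) \<rightarrow>\<^sub>M B" and law: "distr (PiM {1..n} (\<lambda>_. Q)) B \<psi> = B"
  shows "(\<lambda>z. (\<psi> (restrict z {1..n}), z (n + 1))) \<in> PiM {1..n + 1} (\<lambda>_. Q) \<rightarrow>\<^sub>M B \<Otimes>\<^sub>M Q"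
    and "distr (PiM {1..n + 1} (\<lambda>_. Q)) (B \<Otimes>\<^sub>M Q) (\<lambda>z. (\<psi> (restrict z {1..n}), z (n + 1))) = B \<Otimes>\<^sub>M Q"
proof -
  let ?P = "\<lambda>n. PiM {1..n} (\<lambda>_. Q)"
  let ?f = "\<lambda>z. (\<psi> (restrict z {1..n}), z (n + 1))"
  interpret Q: prob_space Q by fact
  interpret B: prob_space B by fact
  interpret Pn: prob_space "?P n" by (intro prob_space_PiM Q)
  interpret QP: pair_prob_space Q "?P n" ..
  interpret PQ: pair_prob_space "?P n" Q ..
  have ins: "{1..n + 1} = insert (n + 1) {1..n}" by auto
  have r: "(\<lambda>z. restrict z {1..n}) \<in> ?P (n + 1) \<rightarrow>\<^sub>M ?P n"
    by (rule measurable_restrict_subset) simp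
  show f: "?f \<in> ?P (n + 1) \<rightarrow>\<^sub>M B \<Otimes>\<^sub>M Q"
    by (intro measurable_Pair measurable_compose[OF r \<psi>] measurable_component_singleton) auto
  have upd: "(\<lambda>(x, w). w(n + 1 := x)) \<in> Q \<Otimes>\<^sub>M ?P n \<rightarrow>\<^sub>M ?P (n + 1)"
    unfolding ins by measurable
  have \<psi>': "(\<lambda>(w, x). (\<psi> w, x)) \<in> ?P n \<Otimes>\<^sub>M Q \<rightarrow>\<^sub>M B \<Otimes>\<^sub>M Q"
    using \<psi> by measurable
  have "distr (?P (n + 1)) (B \<Otimes>\<^sub>M Q) ?f
      = distr (distr (Q \<Otimes>\<^sub>M ?P n) (?P (n + 1)) (\<lambda>(x, w). w(n + 1 := x))) (B \<Otimes>\<^sub>M Q) ?f"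
    using distr_pair_PiM_eq_PiM[of "{1..n}" "\<lambda>_. Q" "n + 1"] Q unfolding ins by simp
  also have "\<dots> = distr (Q \<Otimes>\<^sub>M ?P n) (B \<Otimes>\<^sub>M Q) (?f \<circ> (\<lambda>(x, w). w(n + 1 := x)))"
    by (rule distr_distr[OF f upd])
  also have "\<dots> = distr (Q \<Otimes>\<^sub>M ?P n) (B \<Otimes>\<^sub>M Q) ((\<lambda>(w, x). (\<psi> w, x)) \<circ> (\<lambda>(x, w). (w, x)))"
  proof (rule distr_cong[OF refl refl])
    fix z assume "z \<in> space (Q \<Otimes>\<^sub>M ?P n)"
    hence "snd z \<in> space (?P n)" by (auto simp: space_pair_measure)
    hence "snd z \<in> extensional {1..n}" by (auto simp: space_PiM PiE_def)
    hence "restrict ((snd z)(n + 1 := fst z)) {1..n} = snd z"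
      by (intro ext) (auto simp: restrict_def extensional_def)
    thus "(?f \<circ> (\<lambda>(x, w). w(n + 1 := x))) z = ((\<lambda>(w, x). (\<psi> w, x)) \<circ> (\<lambda>(x, w). (w, x))) z"
      by (simp add: case_prod_unfold)
  qed
  also have "\<dots> = distr (distr (Q \<Otimes>\<^sub>M ?P n) (?P n \<Otimes>\<^sub>M Q) (\<lambda>(x, w). (w, x))) (B \<Otimes>\<^sub>M Q) (\<lambda>(w, x). (\<psi> w, x))"
    by (rule distr_distr[OF \<psi>', symmetric]) measurable
  also have "\<dots> = distr (?P n \<Otimes>\<^sub>M Q) (B \<Otimes>\<^sub>M Q) (\<lambda>(w, x). (\<psi> w, x))"
    using PQ.distr_pair_swap by simp
  also have "\<dots> = distr (?P n) B \<psi> \<Otimes>\<^sub>M distr Q Q (\<lambda>x. x)"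
    using \<psi> by (intro pair_measure_distr[symmetric]) (auto simp: distr_id Q.sigma_finite_measure_axioms)
  also have "\<dots> = B \<Otimes>\<^sub>M Q" by (simp add: law distr_id)
  finally show "distr (?P (n + 1)) (B \<Otimes>\<^sub>M Q) ?f = B \<Otimes>\<^sub>M Q" .
qed

text \<open>\<open>Q\<close> stands for the law of \<open>(Z, Z\<^sup>u)\<close> and \<open>P\<close> for its two equal marginals. The first kernel evaluates
  the test function at both entries of one pair, so its mean depends on the joint law \<open>Q\<close>; the means of
  the other three are determined by \<open>P\<close>.\<close>
locale test_function_pairs = Q: prob_space Q
  for Q :: "('x::second_countable_topology \<times> 'x) measure" +
  fixes P :: "'x measure" and m :: nat and T :: "(nat \<Rightarrow> 'x) \<Rightarrow> 'x \<Rightarrow> real"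
  assumes sets_Q[measurable_cong]: "sets Q = sets (borel \<Otimes>\<^sub>M borel)"
    and sets_P[measurable_cong]: "sets P = sets borel"
    and fst_law: "distr Q P fst = P" and snd_law: "distr Q P snd = P"
    and T: "(\<lambda>(a, x). T a x) \<in> borel_measurable (PiM {1..m} (\<lambda>_. borel) \<Otimes>\<^sub>M borel)"
    and T_sq: "integrable (PiM {1..m} (\<lambda>_. P) \<Otimes>\<^sub>M P) (\<lambda>(a, x). (T a x)\<^sup>2)"
begin

abbreviation "A \<equiv> PiM {1..m} (\<lambda>_. P)"

lemma fst_m[measurable]: "fst \<in> Q \<rightarrow>\<^sub>M P" and snd_m[measurable]: "snd \<in> Q \<rightarrow>\<^sub>M P"
  by measurable

sublocale P: prob_space P
  using Q.prob_space_distr[OF fst_m] fst_law by simp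

sublocale A: prob_space A
  by (intro prob_space_PiM P.prob_space_axioms)

lemma sets_A: "sets A = sets (PiM {1..m} (\<lambda>_. borel))"
  by (intro sets_PiM_cong) (auto simp: sets_P)

lemma T_m[measurable]: "(\<lambda>(a, x). T a x) \<in> borel_measurable (A \<Otimes>\<^sub>M P)"
  using T by (simp cong: measurable_cong_sets add: sets_pair_measure_cong[OF sets_A sets_P])

definition params :: "(nat \<Rightarrow> 'x \<times> 'x) \<Rightarrow> nat \<Rightarrow> 'x" where
  "params z = (\<lambda>i\<in>{1..m}. fst (z i))"

lemma params_restrict: "m \<le> n \<Longrightarrow> params (restrict z {1..n}) = params z"
  by (auto simp: params_def fun_eq_iff)

lemma params_m: "params \<in> PiM {1..m} (\<lambda>_. Q) \<rightarrow>\<^sub>M A"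
  unfolding params_def by (intro measurable_restrict) measurable

lemma params_law: "distr (PiM {1..m} (\<lambda>_. Q)) A params = A"
proof -
  have "params = compose {1..m} fst" by (simp add: params_def[abs_def] compose_def fun_eq_iff)
  moreover have "distr (PiM {1..m} (\<lambda>_. Q)) A (compose {1..m} fst) = PiM {1..m} (\<lambda>_. distr Q P fst)"
    by (intro distr_PiM_finite_prob_space product_prob_spaceI Q.prob_space_axioms P.prob_space_axioms) auto
  ultimately show ?thesis by (simp only: fst_law)
qed

lemma one_copy:
  shows "(\<lambda>z. (params z, z (m + 1))) \<in> PiM {1..m + 1} (\<lambda>_. Q) \<rightarrow>\<^sub>M A \<Otimes>\<^sub>M Q"
    and "distr (PiM {1..m + 1} (\<lambda>_. Q)) (A \<Otimes>\<^sub>M Q) (\<lambda>z. (params z, z (m + 1))) = A \<Otimes>\<^sub>M Q"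
  using distr_append_coordinate[OF Q.prob_space_axioms A.prob_space_axioms params_m params_law]
  by (simp_all add: params_restrict)

lemma two_copies:
  shows "(\<lambda>z. ((params z, z (m + 1)), z (m + 2))) \<in> PiM {1..m + 2} (\<lambda>_. Q) \<rightarrow>\<^sub>M (A \<Otimes>\<^sub>M Q) \<Otimes>\<^sub>M Q"
    and "distr (PiM {1..m + 2} (\<lambda>_. Q)) ((A \<Otimes>\<^sub>M Q) \<Otimes>\<^sub>M Q) (\<lambda>z. ((params z, z (m + 1)), z (m + 2)))
      = (A \<Otimes>\<^sub>M Q) \<Otimes>\<^sub>M Q"
proof -
  interpret AQ: pair_prob_space A Q ..
  have 2: "m + 1 + 1 = m + 2" by simp
  note * = distr_append_coordinate[OF Q.prob_space_axioms AQ.prob_space_axioms one_copy, unfolded 2]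
  have r: "params (restrict z {1..m + 1}) = params z" "restrict z {1..m + 1} (m + 1) = z (m + 1)" for z
    by (auto simp: params_restrict)
  show "(\<lambda>z. ((params z, z (m + 1)), z (m + 2))) \<in> PiM {1..m + 2} (\<lambda>_. Q) \<rightarrow>\<^sub>M (A \<Otimes>\<^sub>M Q) \<Otimes>\<^sub>M Q"
    using *(1) unfolding r .
  show "distr (PiM {1..m + 2} (\<lambda>_. Q)) ((A \<Otimes>\<^sub>M Q) \<Otimes>\<^sub>M Q) (\<lambda>z. ((params z, z (m + 1)), z (m + 2)))
      = (A \<Otimes>\<^sub>M Q) \<Otimes>\<^sub>M Q"
    using *(2) unfolding r .
qed

text \<open>The four kernels as functions of the parameters, drawn from the first entries of the first \<open>m\<close> pairs,
  and of one or two further pairs.\<close>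
definition F1 :: "(nat \<Rightarrow> 'x) \<times> ('x \<times> 'x) \<Rightarrow> real" where "F1 = (\<lambda>(a, q). T a (fst q) * T a (snd q))"
definition F3 :: "(nat \<Rightarrow> 'x) \<times> ('x \<times> 'x) \<Rightarrow> real" where "F3 = (\<lambda>(a, q). (T a (fst q))\<^sup>2)"
definition F2 :: "((nat \<Rightarrow> 'x) \<times> ('x \<times> 'x)) \<times> ('x \<times> 'x) \<Rightarrow> real" where
  "F2 = (\<lambda>((a, q), q'). T a (fst q) * T a (snd q'))"
definition F4 :: "((nat \<Rightarrow> 'x) \<times> ('x \<times> 'x)) \<times> ('x \<times> 'x) \<Rightarrow> real" where
  "F4 = (\<lambda>((a, q), q'). T a (fst q) * T a (fst q'))"

lemma F_measurable[measurable]: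
  "F1 \<in> borel_measurable (A \<Otimes>\<^sub>M Q)" "F3 \<in> borel_measurable (A \<Otimes>\<^sub>M Q)"
  "F2 \<in> borel_measurable ((A \<Otimes>\<^sub>M Q) \<Otimes>\<^sub>M Q)" "F4 \<in> borel_measurable ((A \<Otimes>\<^sub>M Q) \<Otimes>\<^sub>M Q)"
  unfolding F1_def F2_def F3_def F4_def case_prod_unfold by measurable

lemma kernel_factors:
  "kernel m T 1 z = F1 (params z, z (m + 1))"
  "kernel m T 2 z = F2 ((params z, z (m + 1)), z (m + 2))"
  "kernel m T 3 z = F3 (params z, z (m + 1))"
  "kernel m T 4 z = F4 ((params z, z (m + 1)), z (m + 2))"
  by (simp_all add: kernel_def F1_def F2_def F3_def F4_def params_def Let_def)

lemma one_copy_moments: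
  assumes \<pi>[measurable]: "\<pi> \<in> Q \<rightarrow>\<^sub>M P" and law: "distr Q P \<pi> = P"
  shows "integrable (A \<Otimes>\<^sub>M Q) (\<lambda>z. (T (fst z) (\<pi> (snd z)))\<^sup>2)"
    and "AE a in A. (\<integral>q. (T a (\<pi> q))\<^sup>2 \<partial>Q) = (\<integral>x. (T a x)\<^sup>2 \<partial>P)"
    and "a \<in> space A \<Longrightarrow> (\<integral>q. T a (\<pi> q) \<partial>Q) = (\<integral>x. T a x \<partial>P)"
proof -
  have "A \<Otimes>\<^sub>M P = distr A A (\<lambda>a. a) \<Otimes>\<^sub>M distr Q P \<pi>" by (simp add: law distr_id)
  also have "\<dots> = distr (A \<Otimes>\<^sub>M Q) (A \<Otimes>\<^sub>M P) (\<lambda>(a, q). (a, \<pi> q))"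
    using P.sigma_finite_measure_axioms by (intro pair_measure_distr) (auto simp: law)
  finally have d: "distr (A \<Otimes>\<^sub>M Q) (A \<Otimes>\<^sub>M P) (\<lambda>(a, q). (a, \<pi> q)) = A \<Otimes>\<^sub>M P" by simp
  have m: "(\<lambda>(a, q). (a, \<pi> q)) \<in> A \<Otimes>\<^sub>M Q \<rightarrow>\<^sub>M A \<Otimes>\<^sub>M P" by measurable
  have "integrable (distr (A \<Otimes>\<^sub>M Q) (A \<Otimes>\<^sub>M P) (\<lambda>(a, q). (a, \<pi> q))) (\<lambda>(a, x). (T a x)\<^sup>2)"
    unfolding d by (rule T_sq)
  from integrable_distr[OF m this]
  show "integrable (A \<Otimes>\<^sub>M Q) (\<lambda>z. (T (fst z) (\<pi> (snd z)))\<^sup>2)" by (simp add: case_prod_unfold)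
  have tr: "(\<integral>q. G (\<pi> q) \<partial>Q) = (\<integral>x. G x \<partial>P)" if "G \<in> borel_measurable P" for G :: "'x \<Rightarrow> real"
    using integral_distr[OF \<pi> that] law by simp
  show "a \<in> space A \<Longrightarrow> (\<integral>q. T a (\<pi> q) \<partial>Q) = (\<integral>x. T a x \<partial>P)"
    by (rule tr) measurable
  show "AE a in A. (\<integral>q. (T a (\<pi> q))\<^sup>2 \<partial>Q) = (\<integral>x. (T a x)\<^sup>2 \<partial>P)"
  proof (rule AE_I2)
    fix a assume [measurable]: "a \<in> space A"
    show "(\<integral>q. (T a (\<pi> q))\<^sup>2 \<partial>Q) = (\<integral>x. (T a x)\<^sup>2 \<partial>P)"
      by (rule tr[of "\<lambda>x. (T a x)\<^sup>2"]) measurable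
  qed
qed

lemma two_copies_square_integrable:
  assumes \<pi>[measurable]: "\<pi> \<in> Q \<rightarrow>\<^sub>M P" and law: "distr Q P \<pi> = P"
  shows "integrable ((A \<Otimes>\<^sub>M Q) \<Otimes>\<^sub>M Q) (\<lambda>z. (T (fst (fst z)) (\<pi> (snd z)))\<^sup>2)"
    and "integrable ((A \<Otimes>\<^sub>M Q) \<Otimes>\<^sub>M Q) (\<lambda>z. (T (fst (fst z)) (\<pi> (snd (fst z))))\<^sup>2)"
proof -
  interpret AQ: pair_prob_space A Q ..
  have G: "(\<lambda>z. (T (fst z) (\<pi> (snd z)))\<^sup>2) \<in> borel_measurable (A \<Otimes>\<^sub>M Q)" by measurable
  have "A \<Otimes>\<^sub>M Q = distr (A \<Otimes>\<^sub>M Q) A fst \<Otimes>\<^sub>M distr Q Q (\<lambda>x. x)" by (simp add: Q.distr_pair_fst distr_id)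
  also have "\<dots> = distr ((A \<Otimes>\<^sub>M Q) \<Otimes>\<^sub>M Q) (A \<Otimes>\<^sub>M Q) (\<lambda>(x, q). (fst x, q))"
    using Q.sigma_finite_measure_axioms by (intro pair_measure_distr) (auto simp: distr_id)
  finally have d: "distr ((A \<Otimes>\<^sub>M Q) \<Otimes>\<^sub>M Q) (A \<Otimes>\<^sub>M Q) (\<lambda>(x, q). (fst x, q)) = A \<Otimes>\<^sub>M Q" by simp
  have m: "(\<lambda>(x, q). (fst x, q)) \<in> (A \<Otimes>\<^sub>M Q) \<Otimes>\<^sub>M Q \<rightarrow>\<^sub>M A \<Otimes>\<^sub>M Q" by measurable
  show "integrable ((A \<Otimes>\<^sub>M Q) \<Otimes>\<^sub>M Q) (\<lambda>z. (T (fst (fst z)) (\<pi> (snd z)))\<^sup>2)"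
    using integrable_distr_eq[OF m G] one_copy_moments(1)[OF assms] unfolding d by (simp add: case_prod_unfold)
  show "integrable ((A \<Otimes>\<^sub>M Q) \<Otimes>\<^sub>M Q) (\<lambda>z. (T (fst (fst z)) (\<pi> (snd (fst z))))\<^sup>2)"
    using integrable_distr_eq[OF measurable_fst G, of Q] one_copy_moments(1)[OF assms] by (simp add: Q.distr_pair_fst)
qed

lemma F_integrable:
  "integrable (A \<Otimes>\<^sub>M Q) F1" "integrable (A \<Otimes>\<^sub>M Q) F3"
  "integrable ((A \<Otimes>\<^sub>M Q) \<Otimes>\<^sub>M Q) F2" "integrable ((A \<Otimes>\<^sub>M Q) \<Otimes>\<^sub>M Q) F4"
proof -
  note f1 = one_copy_moments(1)[OF fst_m fst_law] and s1 = one_copy_moments(1)[OF snd_m snd_law]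
  show "integrable (A \<Otimes>\<^sub>M Q) F3" using f1 by (simp add: F3_def case_prod_unfold)
  show "integrable (A \<Otimes>\<^sub>M Q) F1" unfolding F1_def case_prod_unfold
    by (rule integrable_mult_of_squares[OF _ _ f1 s1]) measurable
  show "integrable ((A \<Otimes>\<^sub>M Q) \<Otimes>\<^sub>M Q) F2" unfolding F2_def case_prod_unfold
    by (rule integrable_mult_of_squares[OF _ _ two_copies_square_integrable(2)[OF fst_m fst_law] two_copies_square_integrable(1)[OF snd_m snd_law]]) measurable
  show "integrable ((A \<Otimes>\<^sub>M Q) \<Otimes>\<^sub>M Q) F4" unfolding F4_def case_prod_unfold
    by (rule integrable_mult_of_squares[OF _ _ two_copies_square_integrable(2)[OF fst_m fst_law] two_copies_square_integrable(1)[OF fst_m fst_law]]) measurable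
qed

text \<open>For fixed parameters the two pairs are independent, and the entry of either one has law \<open>P\<close>; the choice
  \<open>\<pi> = snd\<close> serves the second kernel and \<open>\<pi> = fst\<close> the fourth.\<close>
lemma F_product_integral:
  assumes \<pi>[measurable]: "\<pi> \<in> Q \<rightarrow>\<^sub>M P" and law: "distr Q P \<pi> = P"
  shows "(\<integral>z. T (fst (fst z)) (fst (snd (fst z))) * T (fst (fst z)) (\<pi> (snd z)) \<partial>((A \<Otimes>\<^sub>M Q) \<Otimes>\<^sub>M Q))
     = (\<integral>a. (\<integral>x. T a x \<partial>P)\<^sup>2 \<partial>A)"
proof -
  interpret AQ: pair_prob_space A Q ..
  interpret AQQ: pair_prob_space "A \<Otimes>\<^sub>M Q" Q ..
  have i: "integrable ((A \<Otimes>\<^sub>M Q) \<Otimes>\<^sub>M Q)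
      (\<lambda>z. T (fst (fst z)) (fst (snd (fst z))) * T (fst (fst z)) (\<pi> (snd z)))"
    by (rule integrable_mult_of_squares[OF _ _ two_copies_square_integrable(2)[OF fst_m fst_law] two_copies_square_integrable(1)[OF assms]]) measurable
  have "(\<integral>z. T (fst (fst z)) (fst (snd (fst z))) * T (fst (fst z)) (\<pi> (snd z)) \<partial>((A \<Otimes>\<^sub>M Q) \<Otimes>\<^sub>M Q))
      = (\<integral>x. (\<integral>q. T (fst x) (fst (snd x)) * T (fst x) (\<pi> q) \<partial>Q) \<partial>(A \<Otimes>\<^sub>M Q))"
    using AQQ.integral_fst'[OF i] by simp
  also have "\<dots> = (\<integral>x. T (fst x) (fst (snd x)) * (\<integral>y. T (fst x) y \<partial>P) \<partial>(A \<Otimes>\<^sub>M Q))"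
    by (intro Bochner_Integration.integral_cong refl)
       (auto simp: space_pair_measure one_copy_moments(3)[OF assms])
  also have "\<dots> = (\<integral>a. (\<integral>q. T a (fst q) * (\<integral>y. T a y \<partial>P) \<partial>Q) \<partial>A)"
  proof -
    have e: "(\<integral>q. T (fst x) (fst (snd x)) * T (fst x) (\<pi> q) \<partial>Q) = T (fst x) (fst (snd x)) * (\<integral>y. T (fst x) y \<partial>P)"
      if "x \<in> space (A \<Otimes>\<^sub>M Q)" for x
      using that by (auto simp: space_pair_measure one_copy_moments(3)[OF assms])
    have "integrable (A \<Otimes>\<^sub>M Q) (\<lambda>x. T (fst x) (fst (snd x)) * (\<integral>y. T (fst x) y \<partial>P))"
      using AQQ.integrable_fst'[OF i] by (subst Bochner_Integration.integrable_cong[OF refl e[symmetric]]) simp_all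
    from AQ.integral_fst'[OF this] show ?thesis by simp
  qed
  also have "\<dots> = (\<integral>a. (\<integral>x. T a x \<partial>P)\<^sup>2 \<partial>A)"
    by (intro Bochner_Integration.integral_cong refl) (simp add: one_copy_moments(3)[OF fst_m fst_law] power2_eq_square)
  finally show ?thesis .
qed

lemma kernel_measurable: "kernel m T j \<in> borel_measurable (PiM {1..arity m j} (\<lambda>_. Q))"
  and kernel_integrable: "integrable (PiM {1..arity m j} (\<lambda>_. Q)) (kernel m T j)"
proof -
  have "j = 1 \<or> j = 2 \<or> j = 3 \<or> j = 4" by (rule exhaust_4)
  thus "kernel m T j \<in> borel_measurable (PiM {1..arity m j} (\<lambda>_. Q))"
    "integrable (PiM {1..arity m j} (\<lambda>_. Q)) (kernel m T j)"
    using measurable_compose[OF one_copy(1) F_measurable(1)] measurable_compose[OF one_copy(1) F_measurable(2)]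
      measurable_compose[OF two_copies(1) F_measurable(3)] measurable_compose[OF two_copies(1) F_measurable(4)]
      integrable_distr_eq[OF one_copy(1) F_measurable(1)] integrable_distr_eq[OF one_copy(1) F_measurable(2)]
      integrable_distr_eq[OF two_copies(1) F_measurable(3)] integrable_distr_eq[OF two_copies(1) F_measurable(4)]
    unfolding one_copy(2) two_copies(2)
    by (auto simp: kernel_factors[abs_def] arity_def F_integrable)
qed

lemma kernel_means_eq:
  shows "kernel_means m T Q $ 1 = (\<integral>a. (\<integral>q. T a (fst q) * T a (snd q) \<partial>Q) \<partial>A)"
    and "kernel_means m T Q $ 2 = (\<integral>a. (\<integral>x. T a x \<partial>P)\<^sup>2 \<partial>A)"
    and "kernel_means m T Q $ 3 = (\<integral>a. (\<integral>x. (T a x)\<^sup>2 \<partial>P) \<partial>A)"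
    and "kernel_means m T Q $ 4 = (\<integral>a. (\<integral>x. T a x \<partial>P)\<^sup>2 \<partial>A)"
proof -
  interpret AQ: pair_prob_space A Q ..
  have k: "kernel_means m T Q $ j = (\<integral>z. kernel m T j z \<partial>PiM {1..arity m j} (\<lambda>_. Q))" for j
    using integral_symmetrize[OF Q.prob_space_axioms kernel_measurable kernel_integrable]
    by (simp add: kernel_means_def sym_kernel_def)
  have "kernel_means m T Q $ 1 = integral\<^sup>L (A \<Otimes>\<^sub>M Q) F1"
    using integral_distr[OF one_copy(1) F_measurable(1)] unfolding k one_copy(2)
    by (simp add: kernel_factors[abs_def] arity_def)
  also have "\<dots> = (\<integral>a. (\<integral>q. T a (fst q) * T a (snd q) \<partial>Q) \<partial>A)"
    using AQ.integral_fst'[OF F_integrable(1)] by (simp add: F1_def)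
  finally show "kernel_means m T Q $ 1 = (\<integral>a. (\<integral>q. T a (fst q) * T a (snd q) \<partial>Q) \<partial>A)" .
  have "kernel_means m T Q $ 3 = integral\<^sup>L (A \<Otimes>\<^sub>M Q) F3"
    using integral_distr[OF one_copy(1) F_measurable(2)] unfolding k one_copy(2)
    by (simp add: kernel_factors[abs_def] arity_def)
  also have "\<dots> = (\<integral>a. (\<integral>q. (T a (fst q))\<^sup>2 \<partial>Q) \<partial>A)"
    using AQ.integral_fst'[OF F_integrable(2)] by (simp add: F3_def)
  also have "\<dots> = (\<integral>a. (\<integral>x. (T a x)\<^sup>2 \<partial>P) \<partial>A)"
    using one_copy_moments(2)[OF fst_m fst_law] by (intro integral_cong_AE) measurable
  finally show "kernel_means m T Q $ 3 = (\<integral>a. (\<integral>x. (T a x)\<^sup>2 \<partial>P) \<partial>A)" .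
  have "kernel_means m T Q $ 2 = integral\<^sup>L ((A \<Otimes>\<^sub>M Q) \<Otimes>\<^sub>M Q) F2"
    using integral_distr[OF two_copies(1) F_measurable(3)] unfolding k two_copies(2)
    by (simp add: kernel_factors[abs_def] arity_def)
  also have "\<dots> = (\<integral>a. (\<integral>x. T a x \<partial>P)\<^sup>2 \<partial>A)"
    using F_product_integral[OF snd_m snd_law] by (simp add: F2_def case_prod_unfold)
  finally show "kernel_means m T Q $ 2 = (\<integral>a. (\<integral>x. T a x \<partial>P)\<^sup>2 \<partial>A)" .
  have "kernel_means m T Q $ 4 = integral\<^sup>L ((A \<Otimes>\<^sub>M Q) \<Otimes>\<^sub>M Q) F4"
    using integral_distr[OF two_copies(1) F_measurable(4)] unfolding k two_copies(2)
    by (simp add: kernel_factors[abs_def] arity_def)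
  also have "\<dots> = (\<integral>a. (\<integral>x. T a x \<partial>P)\<^sup>2 \<partial>A)"
    using F_product_integral[OF fst_m fst_law] by (simp add: F4_def case_prod_unfold)
  finally show "kernel_means m T Q $ 4 = (\<integral>a. (\<integral>x. T a x \<partial>P)\<^sup>2 \<partial>A)" .
qed

end

section \<open>Asymptotic normality of the ratio\<close>

locale pick_freeze_sample = test_function_pairs Q P m T + iid_sample Q S Z
  for Q :: "('x::second_countable_topology \<times> 'x) measure" and P m T and S :: "'s measure" and Z +
  assumes sym_sq: "\<And>j. integrable (PiM {1..arity m j} (\<lambda>_. Q)) (\<lambda>z. (sym_kernel m T j z)\<^sup>2)"
    and nondegenerate: "kernel_means m T Q $ 3 - kernel_means m T Q $ 4 > 0"
begin

lemma kernel_sample: "iid_kernel_sample Q (arity m j) (sym_kernel m T j) S Z"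
proof -
  have "square_integrable_kernel Q (arity m j) (sym_kernel m T j)"
  proof
    show "1 \<le> arity m j" by (simp add: arity_def)
    show "sym_kernel m T j \<in> borel_measurable (PiM {1..arity m j} (\<lambda>_. Q))"
      unfolding sym_kernel_def
      by (rule symmetrize_measurable[OF Q.prob_space_axioms kernel_measurable])
    show "sym_kernel m T j (\<lambda>i. z (\<tau> i)) = sym_kernel m T j z" if "\<tau> permutes {1..arity m j}" for \<tau> z
      unfolding sym_kernel_def by (rule symmetrize_permute[OF that])
  qed (rule sym_sq)
  thus ?thesis by (rule iid_kernel_sample.intro) (rule iid_sample_axioms)
qed

lemmas kernel_square_integrable = iid_kernel_sample.axioms(1)[OF kernel_sample]

definition \<theta> :: "4 \<Rightarrow> real" where "\<theta> j = kernel_means m T Q $ j"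

definition kernel_proj :: "4 \<Rightarrow> 'x \<times> 'x \<Rightarrow> real" where
  "kernel_proj j = square_integrable_kernel.proj Q (arity m j) (sym_kernel m T j)"

lemma mean_eq: "square_integrable_kernel.mean Q (arity m j) (sym_kernel m T j) = \<theta> j"
  by (simp add: \<theta>_def kernel_means_def square_integrable_kernel.mean_def[OF kernel_square_integrable])

lemma kernel_proj_facts:
  shows kernel_proj_m: "kernel_proj j \<in> borel_measurable Q" and kernel_proj_int: "integrable Q (kernel_proj j)"
    and kernel_proj_sq: "integrable Q (\<lambda>z. (kernel_proj j z)\<^sup>2)" and kernel_proj_mean: "(\<integral>z. kernel_proj j z \<partial>Q) = 0"
  using square_integrable_kernel.proj_measurable[OF kernel_square_integrable]
    square_integrable_kernel.proj_integrable[OF kernel_square_integrable]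
    square_integrable_kernel.proj_sq[OF kernel_square_integrable]
    square_integrable_kernel.proj_mean[OF kernel_square_integrable]
  by (auto simp: kernel_proj_def)

lemma Gamma_entry:
  "Gamma_matrix S m T Z $ i $ j = real (arity m i) * real (arity m j) * (\<integral>z. kernel_proj i z * kernel_proj j z \<partial>Q)"
proof -
  have Z1: "Z 1 \<in> S \<rightarrow>\<^sub>M Q" and Z1_law: "distr S Q (Z 1) = Q"
    by (rule Z_measurable, simp) (rule Z_law, simp)
  define V where "V j = cond_exp_given S (borel \<Otimes>\<^sub>M borel) (Z 1) (sample_kernel m T Z j)" for j
  have Vm[measurable]: "V j \<in> borel_measurable S" for j
    unfolding V_def cond_exp_given_def by (rule borel_measurable_cond_exp2)
  have prm[measurable]: "(\<lambda>\<omega>. kernel_proj j (Z 1 \<omega>)) \<in> borel_measurable S" for j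
    by (rule measurable_compose[OF Z1 kernel_proj_m])
  have alg: "vimage_algebra (space S) (Z 1) (borel \<Otimes>\<^sub>M borel) = vimage_algebra (space S) (Z 1) Q"
    by (simp add: vimage_algebra_def sets_Q)
  have ae: "AE \<omega> in S. V j \<omega> = kernel_proj j (Z 1 \<omega>) + \<theta> j" for j
    using iid_kernel_sample.conditional_expectation_given_first[OF kernel_sample, of j]
    by (simp add: V_def cond_exp_given_def alg sample_kernel_def[abs_def] kernel_proj_def mean_eq)
  have EV: "(\<integral>\<omega>. V j \<omega> \<partial>S) = \<theta> j" for j
  proof -
    have "(\<integral>\<omega>. V j \<omega> \<partial>S) = (\<integral>\<omega>. kernel_proj j (Z 1 \<omega>) + \<theta> j \<partial>S)"
      using ae by (intro integral_cong_AE) measurable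
    also have "\<dots> = (\<integral>z. kernel_proj j z + \<theta> j \<partial>Q)"
      using integral_distr[OF Z1, of "\<lambda>z. kernel_proj j z + \<theta> j"] kernel_proj_m Z1_law by simp
    finally show ?thesis using kernel_proj_int kernel_proj_mean by (simp add: Q.prob_space)
  qed
  have "covariance S (V i) (V j) = (\<integral>\<omega>. (V i \<omega> - \<theta> i) * (V j \<omega> - \<theta> j) \<partial>S)"
    by (simp add: covariance_def EV)
  also have "\<dots> = (\<integral>\<omega>. kernel_proj i (Z 1 \<omega>) * kernel_proj j (Z 1 \<omega>) \<partial>S)"
  proof (rule integral_cong_AE)
    show "AE \<omega> in S. (V i \<omega> - \<theta> i) * (V j \<omega> - \<theta> j) = kernel_proj i (Z 1 \<omega>) * kernel_proj j (Z 1 \<omega>)"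
      using ae[of i] ae[of j] by eventually_elim simp
  qed measurable
  also have "\<dots> = (\<integral>z. kernel_proj i z * kernel_proj j z \<partial>Q)"
    using integral_distr[OF Z1, of "\<lambda>z. kernel_proj i z * kernel_proj j z"] kernel_proj_m Z1_law by simp
  finally show ?thesis by (simp add: Gamma_matrix_def V_def)
qed

text \<open>The summand of the linear approximation: up to an error that is small compared with \<open>1 / sqrt N\<close>,
  \<open>g \<bullet> (U - \<theta>)\<close> is the sample mean of \<open>influence g (Z n)\<close>.\<close>
definition influence :: "real ^ 4 \<Rightarrow> 'x \<times> 'x \<Rightarrow> real" where
  "influence g z = (\<Sum>j\<in>UNIV. (g $ j * real (arity m j)) * kernel_proj j z)"

lemma influence_facts:
  shows "influence g \<in> borel_measurable Q" and "integrable Q (\<lambda>z. (influence g z)\<^sup>2)"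
    and "(\<integral>z. influence g z \<partial>Q) = 0"
proof -
  show "influence g \<in> borel_measurable Q" unfolding influence_def using kernel_proj_m by measurable
  show "integrable Q (\<lambda>z. (influence g z)\<^sup>2)" unfolding influence_def
    using kernel_proj_m kernel_proj_sq by (intro square_integrable_sum) (auto simp: power_mult_distrib)
  have "(\<integral>z. influence g z \<partial>Q) = (\<Sum>j\<in>UNIV. \<integral>z. (g $ j * real (arity m j)) * kernel_proj j z \<partial>Q)"
    unfolding influence_def using kernel_proj_int by (intro Bochner_Integration.integral_sum) auto
  thus "(\<integral>z. influence g z \<partial>Q) = 0" by (simp add: kernel_proj_mean)
qed

lemma influence_variance: "(\<integral>z. (influence g z)\<^sup>2 \<partial>Q) = g \<bullet> (Gamma_matrix S m T Z *v g)"
proof -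
  define c where "c j = g $ j * real (arity m j)" for j
  have i: "integrable Q (\<lambda>z. kernel_proj i z * kernel_proj j z)" for i j
    by (rule integrable_mult_of_squares[OF kernel_proj_m kernel_proj_m kernel_proj_sq kernel_proj_sq])
  have "(\<integral>z. (influence g z)\<^sup>2 \<partial>Q) = (\<integral>z. (\<Sum>i\<in>UNIV. \<Sum>j\<in>UNIV. (c i * c j) * (kernel_proj i z * kernel_proj j z)) \<partial>Q)"
    by (simp add: influence_def c_def power2_eq_square sum_product mult_ac)
  also have "\<dots> = (\<Sum>i\<in>UNIV. \<Sum>j\<in>UNIV. (c i * c j) * (\<integral>z. kernel_proj i z * kernel_proj j z \<partial>Q))"
    using i by (simp add: Bochner_Integration.integral_sum)
  also have "\<dots> = g \<bullet> (Gamma_matrix S m T Z *v g)"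
    unfolding inner_vec_def matrix_vector_mult_def
    by (simp add: Gamma_entry c_def sum_distrib_left mult_ac)
  finally show ?thesis .
qed

text \<open>Since \<open>Psi\<close> is a ratio, \<open>Psi U - Psi \<theta>\<close> equals \<open>g \<bullet> (U - \<theta>)\<close> divided by
  \<open>1 + e = (U\<^sub>3 - U\<^sub>4) / b\<close> whenever the latter is nonzero.\<close>
lemma estimator_clt:
  defines "g \<equiv> grad_Psi (kernel_means m T Q)"
  shows "weak_conv_m
     (\<lambda>N. distr S borel (\<lambda>\<omega>. sqrt (real N) *
        (estimator m T N (\<lambda>i. Z i \<omega>) - Psi (kernel_means m T Q))))
     (centered_gaussian (g \<bullet> (Gamma_matrix S m T Z *v g)))"
proof -
  define b where "b = \<theta> 3 - \<theta> 4"
  define r where "r = (\<theta> 1 - \<theta> 2) / b"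
  have b: "b > 0" using nondegenerate by (simp add: b_def \<theta>_def)
  have g: "g $ 1 = 1 / b" "g $ 2 = - (1 / b)" "g $ 3 = - (r / b)" "g $ 4 = r / b"
    using b by (simp_all add: g_def grad_Psi_def vector_def b_def[symmetric] \<theta>_def[symmetric] r_def
        power2_eq_square divide_simps) (simp_all add: b_def \<theta>_def)
  define U where "U j N \<omega> = u_statistic (arity m j) (sym_kernel m T j) N (\<lambda>i. Z i \<omega>)" for j N \<omega>
  have U_null: "L2_null S (\<lambda>N \<omega>. U j N \<omega> - \<theta> j)" for j
    using iid_kernel_sample.u_statistic_L2_consistent[OF kernel_sample, of j] by (simp add: U_def mean_eq)
  have Um[measurable]: "U j N \<in> borel_measurable S" for j N
  proof -
    have "(\<lambda>\<omega>. U j N \<omega> - \<theta> j) \<in> borel_measurable S" using U_null[of j] by (auto simp: L2_null_def)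
    hence "(\<lambda>\<omega>. (U j N \<omega> - \<theta> j) + \<theta> j) \<in> borel_measurable S" by measurable
    thus ?thesis by simp
  qed
  define D where "D j N \<omega> = sqrt (real N) * (U j N \<omega> - \<theta> j)
      - real (arity m j) / sqrt (real N) * (\<Sum>n\<in>{1..N}. kernel_proj j (Z n \<omega>))" for j N \<omega>
  have D_null: "L2_null S (D j)" for j
    using iid_kernel_sample.hoeffding_projection[OF kernel_sample, of j]
    unfolding D_def[abs_def] U_def kernel_proj_def mean_eq .
  define W where "W N \<omega> = (\<Sum>n\<in>{1..N}. influence g (Z n \<omega>)) / sqrt (real N)" for N \<omega>
  have Wm: "W N \<in> borel_measurable S" for N
    unfolding W_def using measurable_compose[OF Z_measurable influence_facts(1)]
    by (intro borel_measurable_divide borel_measurable_sum) auto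
  have W: "weak_conv_m (\<lambda>N. distr S borel (W N)) (centered_gaussian (g \<bullet> (Gamma_matrix S m T Z *v g)))"
    using central_limit[OF influence_facts, of g] unfolding W_def[abs_def] influence_variance .
  have var_nonneg: "g \<bullet> (Gamma_matrix S m T Z *v g) \<ge> 0"
    unfolding influence_variance[symmetric] by simp
  define L where "L N \<omega> = W N \<omega> + (\<Sum>j\<in>UNIV. g $ j * D j N \<omega>)" for N \<omega>
  have L_eq: "L N \<omega> = sqrt (real N) * (\<Sum>j\<in>UNIV. g $ j * (U j N \<omega> - \<theta> j))" for N \<omega>
  proof -
    have "W N \<omega> = (\<Sum>j\<in>UNIV. g $ j * (real (arity m j) / sqrt (real N) * (\<Sum>n\<in>{1..N}. kernel_proj j (Z n \<omega>))))"
      unfolding W_def influence_def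
      by (subst sum.swap) (simp add: sum_divide_distrib sum_distrib_left mult_ac)
    thus ?thesis unfolding L_def D_def
      by (simp add: sum.distrib[symmetric] sum_distrib_left algebra_simps)
  qed
  have gD: "L2_null S (\<lambda>N \<omega>. \<Sum>j\<in>UNIV. g $ j * D j N \<omega>)"
  proof (rule L2_null_sum)
    show "L2_null S (\<lambda>N \<omega>. g $ j * D j N \<omega>)" for j
      by (rule L2_null_scale[OF D_null, of _ "\<bar>g $ j\<bar>"]) simp
  qed
  have L: "weak_conv_m (\<lambda>N. distr S borel (L N)) (centered_gaussian (g \<bullet> (Gamma_matrix S m T Z *v g)))"
    unfolding L_def[abs_def]
    by (rule S.slutsky_add[OF W real_distribution_centered_gaussian[OF var_nonneg] Wm gD])
  define e where "e N \<omega> = (1 / b) * (U 3 N \<omega> - \<theta> 3) + (- (1 / b)) * (U 4 N \<omega> - \<theta> 4)" for N \<omega>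
  have e_null: "L2_null S e" unfolding e_def[abs_def]
    by (intro L2_null_add L2_null_scale[OF U_null, of _ "\<bar>1 / b\<bar>"]) auto
  have e_eq: "1 + e N \<omega> = (U 3 N \<omega> - U 4 N \<omega>) / b" for N \<omega>
  proof -
    have t3: "\<theta> 3 = b + \<theta> 4" by (simp add: b_def)
    show ?thesis unfolding e_def t3 using b by (simp add: field_simps)
  qed
  define R where "R N \<omega> = sqrt (real N) * (estimator m T N (\<lambda>i. Z i \<omega>) - Psi (kernel_means m T Q))" for N \<omega>
  have R_eq: "R N \<omega> = sqrt (real N) * ((U 1 N \<omega> - U 2 N \<omega>) / (U 3 N \<omega> - U 4 N \<omega>) - r)" for N \<omega>
    by (simp add: R_def estimator_def Psi_def U_def r_def b_def \<theta>_def)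
  have Rm: "R N \<in> borel_measurable S" for N unfolding R_eq by measurable
  have Lm: "L N \<in> borel_measurable S" for N unfolding L_eq by measurable
  have ratio: "R N \<omega> = L N \<omega> / (1 + e N \<omega>)" if "0 < 1 + e N \<omega>" for N \<omega>
  proof -
    define c where "c = U 3 N \<omega> - U 4 N \<omega>"
    have c: "c > 0" using that b by (simp add: e_eq c_def zero_less_divide_iff)
    have "(\<Sum>j\<in>UNIV. g $ j * (U j N \<omega> - \<theta> j)) = ((U 1 N \<omega> - U 2 N \<omega>) - r * c) / b - ((\<theta> 1 - \<theta> 2) - r * b) / b"
      using b by (simp add: sum_4 g c_def b_def[symmetric] field_simps) (simp add: b_def algebra_simps)
    also have "(\<theta> 1 - \<theta> 2) - r * b = 0" using b by (simp add: r_def)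
    finally have "L N \<omega> / (1 + e N \<omega>) = sqrt (real N) * (((U 1 N \<omega> - U 2 N \<omega>) - r * c) / b) / (c / b)"
      by (simp add: L_eq e_eq c_def)
    also have "\<dots> = R N \<omega>" unfolding R_eq c_def[symmetric] using b c by (simp add: field_simps)
    finally show ?thesis by simp
  qed
  have "weak_conv_m (\<lambda>N. distr S borel (R N)) (centered_gaussian (g \<bullet> (Gamma_matrix S m T Z *v g)))"
    by (rule S.slutsky_divide[OF L real_distribution_centered_gaussian[OF var_nonneg] Lm Rm e_null ratio])
  thus ?thesis unfolding R_def[abs_def] .
qed

end

section \<open>The Pick-Freeze model\<close>

text \<open>The empty family is treated by hand, since a model may have no inputs at all.\<close>
lemma (in prob_space) law_of_independent_tuple:
  assumes X: "indep_vars E X I"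
  shows "distr M (PiM I E) (random_tuple I X) = PiM I (\<lambda>i. distr M (E i) (X i))"
proof (cases "I = {}")
  case True
  show ?thesis unfolding True
  proof (rule measure_eqI)
    fix A assume "A \<in> sets (distr M (PiM {} E) (random_tuple {} X))"
    hence A: "A \<subseteq> {\<lambda>_. undefined}" by (simp add: PiM_empty)
    have "random_tuple {} X \<in> M \<rightarrow>\<^sub>M PiM {} E"
      by (simp add: PiM_empty random_tuple_def[abs_def] restrict_def)
    hence "emeasure (distr M (PiM {} E) (random_tuple {} X)) A = emeasure M (random_tuple {} X -` A \<inter> space M)"
      using A by (intro emeasure_distr) (simp_all add: PiM_empty)
    also have "\<dots> = emeasure (PiM {} (\<lambda>i. distr M (E i) (X i))) A"
    proof (cases "A = {}")
      case False
      hence "A = {\<lambda>_. undefined}" using A by auto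
      thus ?thesis
        by (simp add: PiM_empty random_tuple_def[abs_def] restrict_def emeasure_space_1)
    qed simp
    finally show "emeasure (distr M (PiM {} E) (random_tuple {} X)) A
        = emeasure (PiM {} (\<lambda>i. distr M (E i) (X i))) A" .
  qed (simp add: PiM_empty)
next
  case False
  have "distr M (PiM I E) (\<lambda>\<omega>. \<lambda>i\<in>I. X i \<omega>) = PiM I (\<lambda>i. distr M (E i) (X i))"
    using X by (subst indep_vars_iff_distr_eq_PiM'[OF False, symmetric]) (auto simp: indep_vars_def2)
  thus ?thesis by (simp add: random_tuple_def[abs_def])
qed

locale pick_freeze_model = M: prob_space M for M :: "'w measure" +
  fixes E :: "nat \<Rightarrow> 'e measure" and p m :: nat and u :: "nat set"
    and f :: "(nat \<Rightarrow> 'e) \<Rightarrow> 'x::{metric_space, second_countable_topology}"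
    and X X' :: "nat \<Rightarrow> 'w \<Rightarrow> 'e" and T :: "(nat \<Rightarrow> 'x) \<Rightarrow> 'x \<Rightarrow> real"
  assumes u: "u \<subseteq> {1..p}"
    and f: "f \<in> PiM {1..p} E \<rightarrow>\<^sub>M borel"
    and X: "M.indep_vars E X {1..p}"
    and copy: "M.indep_var (PiM {1..p} E) (random_tuple {1..p} X) (PiM {1..p} E) (random_tuple {1..p} X')"
    and copy_law: "distr M (PiM {1..p} E) (random_tuple {1..p} X') = distr M (PiM {1..p} E) (random_tuple {1..p} X)"
    and T: "(\<lambda>(a, x). T a x) \<in> borel_measurable (PiM {1..m} (\<lambda>_. borel) \<Otimes>\<^sub>M borel)"
    and T_sq: "integrable (PiM {1..m} (\<lambda>_. output_law M p f X) \<Otimes>\<^sub>M output_law M p f X) (\<lambda>(a, x). (T a x)\<^sup>2)"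
begin

definition \<mu> :: "(nat \<Rightarrow> 'e) measure" where "\<mu> = distr M (PiM {1..p} E) (random_tuple {1..p} X)"

abbreviation "Q \<equiv> pair_law M p f u X X'"
abbreviation "P \<equiv> output_law M p f X"

lemma X_m: "random_tuple {1..p} X \<in> M \<rightarrow>\<^sub>M PiM {1..p} E"
  and X'_m: "random_tuple {1..p} X' \<in> M \<rightarrow>\<^sub>M PiM {1..p} E"
  using M.indep_var_rv1[OF copy] M.indep_var_rv2[OF copy] .

lemma sets_\<mu>: "sets \<mu> = sets (PiM {1..p} E)"
  by (simp add: \<mu>_def)

lemma resampling: "resampling \<mu> E {1..p} u"
proof -
  let ?D = "\<lambda>i. distr M (E i) (X i)"
  have \<mu>: "\<mu> = PiM {1..p} ?D" unfolding \<mu>_def by (rule M.law_of_independent_tuple[OF X])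
  have D: "prob_space (?D i)" if "i \<in> {1..p}" for i
    using X that by (intro M.prob_space_distr) (auto simp: M.indep_vars_def2)
  show ?thesis
  proof (intro resampling.intro resampling_axioms.intro)
    show "prob_space \<mu>" unfolding \<mu> using D by (rule prob_space_PiM)
    show "sets \<mu> = sets (PiM {1..p} E)" by (rule sets_\<mu>)
    show "distr (\<mu> \<Otimes>\<^sub>M \<mu>) \<mu> (\<lambda>(x, y). \<lambda>i\<in>{1..p}. if i \<in> u then x i else y i) = \<mu>"
      unfolding \<mu> using u D by (intro product_resample) auto
  qed (rule u)
qed

sublocale R: resampling \<mu> E "{1..p}" u by (rule resampling)

lemma f_m[measurable]: "f \<in> \<mu> \<rightarrow>\<^sub>M borel"
  using f by (simp cong: measurable_cong_sets add: sets_\<mu>)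

lemma X_m'[measurable]: "random_tuple {1..p} X \<in> M \<rightarrow>\<^sub>M \<mu>"
  using X_m by (simp cong: measurable_cong_sets add: sets_\<mu>)

lemma X_law: "distr M \<mu> (random_tuple {1..p} X) = \<mu>"
  unfolding \<mu>_def by (intro distr_cong) simp_all

lemma P_eq: "P = distr \<mu> borel f"
  unfolding output_law_def \<mu>_def model_output_def[abs_def]
  using distr_distr[OF f X_m] by (simp add: comp_def)

lemma Q_eq: "Q = distr (\<mu> \<Otimes>\<^sub>M \<mu>) (borel \<Otimes>\<^sub>M borel) (\<lambda>(x, y). (f x, f (R.mix x y)))"
proof -
  have "random_tuple {1..p} (pick_freeze u X X') \<omega>
      = R.mix (random_tuple {1..p} X \<omega>) (random_tuple {1..p} X' \<omega>)" for \<omega>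
    by (auto simp: random_tuple_def R.mix_def pick_freeze_def fun_eq_iff)
  hence "Q = distr M (borel \<Otimes>\<^sub>M borel) ((\<lambda>(x, y). (f x, f (R.mix x y))) \<circ>
     (\<lambda>\<omega>. (random_tuple {1..p} X \<omega>, random_tuple {1..p} X' \<omega>)))"
    by (simp add: pair_law_def model_output_def comp_def)
  also have "\<dots> = distr (distr M (\<mu> \<Otimes>\<^sub>M \<mu>) (\<lambda>\<omega>. (random_tuple {1..p} X \<omega>, random_tuple {1..p} X' \<omega>)))
     (borel \<Otimes>\<^sub>M borel) (\<lambda>(x, y). (f x, f (R.mix x y)))"
  proof (rule distr_distr[symmetric])
    have "random_tuple {1..p} X' \<in> M \<rightarrow>\<^sub>M \<mu>" using X'_m by (simp cong: measurable_cong_sets add: sets_\<mu>)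
    thus "(\<lambda>\<omega>. (random_tuple {1..p} X \<omega>, random_tuple {1..p} X' \<omega>)) \<in> M \<rightarrow>\<^sub>M \<mu> \<Otimes>\<^sub>M \<mu>" by measurable
  qed measurable
  also have "distr M (\<mu> \<Otimes>\<^sub>M \<mu>) (\<lambda>\<omega>. (random_tuple {1..p} X \<omega>, random_tuple {1..p} X' \<omega>)) = \<mu> \<Otimes>\<^sub>M \<mu>"
  proof -
    have "distr M (\<mu> \<Otimes>\<^sub>M \<mu>) (\<lambda>\<omega>. (random_tuple {1..p} X \<omega>, random_tuple {1..p} X' \<omega>))
        = distr M (PiM {1..p} E \<Otimes>\<^sub>M PiM {1..p} E) (\<lambda>\<omega>. (random_tuple {1..p} X \<omega>, random_tuple {1..p} X' \<omega>))"
      by (intro distr_cong refl sets_pair_measure_cong sets_\<mu>)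
    also have "\<dots> = distr M (PiM {1..p} E) (random_tuple {1..p} X) \<Otimes>\<^sub>M distr M (PiM {1..p} E) (random_tuple {1..p} X')"
      using copy unfolding M.indep_var_distribution_eq by simp
    finally show ?thesis unfolding copy_law \<mu>_def[symmetric] .
  qed
  finally show ?thesis .
qed

lemma pair_m[measurable]: "(\<lambda>(x, y). (f x, f (R.mix x y))) \<in> \<mu> \<Otimes>\<^sub>M \<mu> \<rightarrow>\<^sub>M borel \<Otimes>\<^sub>M borel"
  by measurable

lemma test_function_pairs: "test_function_pairs Q P m T"
proof (intro test_function_pairs.intro test_function_pairs_axioms.intro)
  show "prob_space Q" unfolding Q_eq by (rule R.pair.prob_space_distr) measurable
  show "sets Q = sets (borel \<Otimes>\<^sub>M borel)" by (simp add: pair_law_def)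
  show "sets P = sets borel" by (simp add: output_law_def)
  have "distr Q P fst = distr Q borel fst" by (intro distr_cong) (simp_all add: output_law_def)
  also have "\<dots> = distr (\<mu> \<Otimes>\<^sub>M \<mu>) borel (f \<circ> fst)"
    unfolding Q_eq by (subst distr_distr) (auto simp: comp_def case_prod_unfold)
  also have "\<dots> = distr (distr (\<mu> \<Otimes>\<^sub>M \<mu>) \<mu> fst) borel f" by (rule distr_distr[symmetric]) measurable
  also have "distr (\<mu> \<Otimes>\<^sub>M \<mu>) \<mu> fst = \<mu>" by (rule R.distr_pair_fst)
  finally show "distr Q P fst = P" by (simp only: P_eq)
  have "distr Q P snd = distr Q borel snd" by (intro distr_cong) (simp_all add: output_law_def)
  also have "\<dots> = distr (\<mu> \<Otimes>\<^sub>M \<mu>) borel (f \<circ> (\<lambda>(x, y). R.mix x y))"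
    unfolding Q_eq by (subst distr_distr) (auto simp: comp_def case_prod_unfold)
  also have "\<dots> = distr (distr (\<mu> \<Otimes>\<^sub>M \<mu>) \<mu> (\<lambda>(x, y). R.mix x y)) borel f"
    by (rule distr_distr[symmetric]) measurable
  finally show "distr Q P snd = P" by (simp only: P_eq R.distr_mix)
qed (rule T, rule T_sq)

sublocale Q: test_function_pairs Q P m T by (rule test_function_pairs)

abbreviation "A \<equiv> PiM {1..m} (\<lambda>_. P)"

lemma T_f_m[measurable]: "(\<lambda>(a, x). T a (f x)) \<in> borel_measurable (A \<Otimes>\<^sub>M \<mu>)"
proof -
  have "f \<in> \<mu> \<rightarrow>\<^sub>M P" by measurable
  thus ?thesis by measurable
qed

lemma output_integral:
  fixes G :: "'x \<Rightarrow> real"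
  assumes "G \<in> borel_measurable borel"
  shows "(\<integral>\<omega>. G (model_output p f X \<omega>) \<partial>M) = (\<integral>x. G x \<partial>P)"
    and "(\<integral>x. G (f x) \<partial>\<mu>) = (\<integral>x. G x \<partial>P)"
    and "integrable \<mu> (\<lambda>x. G (f x)) \<longleftrightarrow> integrable P G"
proof -
  have mo: "model_output p f X \<in> M \<rightarrow>\<^sub>M borel"
    unfolding model_output_def[abs_def] by measurable
  show "(\<integral>\<omega>. G (model_output p f X \<omega>) \<partial>M) = (\<integral>x. G x \<partial>P)"
    unfolding output_law_def by (rule integral_distr[OF mo assms, symmetric])
  show "(\<integral>x. G (f x) \<partial>\<mu>) = (\<integral>x. G x \<partial>P)"
    unfolding P_eq by (rule integral_distr[OF f_m assms, symmetric])
  show "integrable \<mu> (\<lambda>x. G (f x)) \<longleftrightarrow> integrable P G"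
    unfolding P_eq by (rule integrable_distr_eq[OF f_m assms, symmetric])
qed

lemma T_section: "a \<in> space A \<Longrightarrow> T a \<in> borel_measurable borel"
proof -
  assume "a \<in> space A"
  hence "T a \<in> borel_measurable P" by measurable
  thus ?thesis by (simp cong: measurable_cong_sets add: output_law_def)
qed

lemma T_pair_sq: "integrable (A \<Otimes>\<^sub>M P) (\<lambda>z. (T (fst z) (snd z))\<^sup>2)"
  using T_sq by (simp add: case_prod_unfold)

lemma T_section_sq: "AE a in A. integrable P (\<lambda>x. (T a x)\<^sup>2)"
  and mean_sq_integrable: "integrable A (\<lambda>a. (\<integral>x. T a x \<partial>P)\<^sup>2)"
  and second_moment_integrable: "integrable A (\<lambda>a. \<integral>x. (T a x)\<^sup>2 \<partial>P)"
proof -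
  interpret AP: pair_prob_space A P ..
  have "(\<lambda>z. T (fst z) (snd z)) \<in> borel_measurable (A \<Otimes>\<^sub>M P)" by measurable
  from pair_section_square_integral[OF Q.A.prob_space_axioms Q.P.prob_space_axioms this T_pair_sq]
  show "AE a in A. integrable P (\<lambda>x. (T a x)\<^sup>2)" "integrable A (\<lambda>a. (\<integral>x. T a x \<partial>P)\<^sup>2)" by simp_all
  show "integrable A (\<lambda>a. \<integral>x. (T a x)\<^sup>2 \<partial>P)" using AP.integrable_fst'[OF T_pair_sq] by simp
qed

lemma denominator_eq:
  "gms_denominator M p f X m T = kernel_means m T Q $ 3 - kernel_means m T Q $ 4"
proof -
  have "gms_denominator M p f X m T = (\<integral>a. (\<integral>x. (T a x - (\<integral>y. T a y \<partial>P))\<^sup>2 \<partial>P) \<partial>A)"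
    unfolding gms_denominator_def
  proof (rule Bochner_Integration.integral_cong[OF refl])
    fix a assume "a \<in> space A"
    note Ta[measurable] = T_section[OF this]
    have Gm: "(\<lambda>x. (T a x - c)\<^sup>2) \<in> borel_measurable borel" for c by measurable
    show "M.variance (\<lambda>v. T a (model_output p f X v)) = (\<integral>x. (T a x - (\<integral>y. T a y \<partial>P))\<^sup>2 \<partial>P)"
      unfolding output_integral(1)[OF Ta]
      by (rule output_integral(1)[OF Gm])
  qed
  also have "\<dots> = (\<integral>a. (\<integral>x. (T a x)\<^sup>2 \<partial>P) - (\<integral>x. T a x \<partial>P)\<^sup>2 \<partial>A)"
  proof (rule integral_cong_AE)
    show "AE a in A. (\<integral>x. (T a x - (\<integral>y. T a y \<partial>P))\<^sup>2 \<partial>P) = (\<integral>x. (T a x)\<^sup>2 \<partial>P) - (\<integral>x. T a x \<partial>P)\<^sup>2"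
      using T_section_sq AE_space
    proof eventually_elim
      case (elim a)
      have "T a \<in> borel_measurable P" using elim by measurable
      from Q.P.square_integrable_imp_integrable[OF this elim(1)]
      show ?case by (rule Q.P.variance_eq[OF _ elim(1)])
    qed
  qed measurable
  finally show ?thesis
    using second_moment_integrable mean_sq_integrable by (simp add: Q.kernel_means_eq)
qed

lemma denominator_nonneg: "gms_denominator M p f X m T \<ge> 0"
  unfolding gms_denominator_def by simp

text \<open>For every \<open>a\<close> the conditional expectation is replaced by its explicit version, which makes the integrand
  measurable in \<open>a\<close>; for almost every \<open>a\<close> the test function \<open>T a\<close> is square integrable, and the
  integrand is \<open>E[T a Z * T a Z\<^sup>u] - (E[T a Z])\<^sup>2\<close>.\<close>
lemma numerator_eq:
  "gms_numerator M E p f u X m T = kernel_means m T Q $ 1 - kernel_means m T Q $ 2"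
proof -
  let ?t = "\<lambda>a x. T a (f x)"
  have rt: "random_tuple u X = (\<lambda>\<omega>. restrict (random_tuple {1..p} X \<omega>) u)"
    using u by (auto simp: random_tuple_def fun_eq_iff)
  have "gms_numerator M E p f u X m T
      = (\<integral>a. (\<integral>x. ((\<integral>y. T a y \<partial>P) - R.frozen_mean (?t a) (restrict x u))\<^sup>2 \<partial>\<mu>) \<partial>A)"
    unfolding gms_numerator_def
  proof (rule Bochner_Integration.integral_cong[OF refl])
    fix a assume a: "a \<in> space A"
    have ta[measurable]: "?t a \<in> borel_measurable \<mu>" using a by measurable
    have fm[measurable]: "R.frozen_mean (?t a) \<in> borel_measurable (PiM u E)"
      by (rule R.frozen_mean_measurable[OF ta])
    have [measurable]: "(\<lambda>\<omega>. R.frozen_mean (?t a) (restrict (random_tuple {1..p} X \<omega>) u)) \<in> borel_measurable M"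
      by (rule measurable_compose[OF measurable_compose[OF X_m' R.restrict_measurable] fm])
    have ae: "AE \<omega> in M. cond_exp_given M (PiM u E) (random_tuple u X) (\<lambda>v. T a (model_output p f X v)) \<omega>
        = R.frozen_mean (?t a) (restrict (random_tuple {1..p} X \<omega>) u)"
      using R.conditional_expectation_frozen[OF M.prob_space_axioms X_m' X_law ta]
      by (simp add: cond_exp_given_def rt model_output_def)
    have "(\<integral>\<omega>. ((\<integral>v. T a (model_output p f X v) \<partial>M)
         - cond_exp_given M (PiM u E) (random_tuple u X) (\<lambda>v. T a (model_output p f X v)) \<omega>)\<^sup>2 \<partial>M)
       = (\<integral>\<omega>. ((\<integral>y. T a y \<partial>P) - R.frozen_mean (?t a) (restrict (random_tuple {1..p} X \<omega>) u))\<^sup>2 \<partial>M)"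
      unfolding output_integral(1)[OF T_section[OF a]]
    proof (rule integral_cong_AE)
      have "cond_exp_given M (PiM u E) (random_tuple u X) (\<lambda>v. T a (model_output p f X v)) \<in> borel_measurable M"
        unfolding cond_exp_given_def by (rule borel_measurable_cond_exp2)
      thus "(\<lambda>\<omega>. ((\<integral>y. T a y \<partial>P) - cond_exp_given M (PiM u E) (random_tuple u X)
          (\<lambda>v. T a (model_output p f X v)) \<omega>)\<^sup>2) \<in> borel_measurable M" by measurable
      show "AE \<omega> in M. ((\<integral>y. T a y \<partial>P) - cond_exp_given M (PiM u E) (random_tuple u X)
          (\<lambda>v. T a (model_output p f X v)) \<omega>)\<^sup>2
        = ((\<integral>y. T a y \<partial>P) - R.frozen_mean (?t a) (restrict (random_tuple {1..p} X \<omega>) u))\<^sup>2"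
        using ae by eventually_elim simp
    qed measurable
    also have "\<dots> = (\<integral>x. ((\<integral>y. T a y \<partial>P) - R.frozen_mean (?t a) (restrict x u))\<^sup>2 \<partial>distr M \<mu> (random_tuple {1..p} X))"
      by (rule integral_distr[symmetric]) measurable
    finally show "(\<integral>\<omega>. ((\<integral>v. T a (model_output p f X v) \<partial>M)
         - cond_exp_given M (PiM u E) (random_tuple u X) (\<lambda>v. T a (model_output p f X v)) \<omega>)\<^sup>2 \<partial>M)
       = (\<integral>x. ((\<integral>y. T a y \<partial>P) - R.frozen_mean (?t a) (restrict x u))\<^sup>2 \<partial>\<mu>)"
      unfolding X_law .
  qed
  also have "\<dots> = (\<integral>a. (\<integral>q. T a (fst q) * T a (snd q) \<partial>Q) - (\<integral>x. T a x \<partial>P)\<^sup>2 \<partial>A)"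
  proof (rule integral_cong_AE)
    show "(\<lambda>a. \<integral>x. ((\<integral>y. T a y \<partial>P) - R.frozen_mean (?t a) (restrict x u))\<^sup>2 \<partial>\<mu>) \<in> borel_measurable A"
      unfolding R.frozen_mean_def R.frozen_nn_def by measurable
    show "AE a in A. (\<integral>x. ((\<integral>y. T a y \<partial>P) - R.frozen_mean (?t a) (restrict x u))\<^sup>2 \<partial>\<mu>)
        = (\<integral>q. T a (fst q) * T a (snd q) \<partial>Q) - (\<integral>x. T a x \<partial>P)\<^sup>2"
      using T_section_sq AE_space
    proof eventually_elim
      case (elim a)
      note Ta[measurable] = T_section[OF elim(2)]
      have ta: "?t a \<in> borel_measurable \<mu>" by measurable
      have sq: "integrable \<mu> (\<lambda>x. (?t a x)\<^sup>2)"
        using output_integral(3)[of "\<lambda>x. (T a x)\<^sup>2"] elim by simp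
      have "(\<integral>q. T a (fst q) * T a (snd q) \<partial>Q) = (\<integral>z. ?t a (fst z) * ?t a (R.mix (fst z) (snd z)) \<partial>(\<mu> \<Otimes>\<^sub>M \<mu>))"
        unfolding Q_eq by (subst integral_distr[OF pair_m]) (auto simp: case_prod_unfold)
      also have "\<dots> = (\<integral>x. (\<integral>y. ?t a x * ?t a (R.mix x y) \<partial>\<mu>) \<partial>\<mu>)"
        using R.pair.integral_fst'[OF R.frozen_mean_square_integral(2)[OF ta sq]] by (simp add: case_prod_unfold)
      finally show ?case
        using R.frozen_mean_square_integral(1)[OF ta sq] by (simp add: output_integral(2)[OF Ta])
    qed
  qed measurable
  also have "\<dots> = kernel_means m T Q $ 1 - kernel_means m T Q $ 2"
  proof -
    interpret AQ: pair_prob_space A Q ..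
    have "integrable A (\<lambda>a. \<integral>q. T a (fst q) * T a (snd q) \<partial>Q)"
      using AQ.integrable_fst'[OF Q.F_integrable(1)] by (simp add: Q.F1_def)
    thus ?thesis using mean_sq_integrable by (simp add: Q.kernel_means_eq)
  qed
  finally show ?thesis .
qed

lemma index_eq_Psi: "gms_index M E p f u X m T = Psi (kernel_means m T Q)"
  by (simp add: gms_index_def Psi_def numerator_eq denominator_eq)

end

theorem theorem2p4:
  fixes M :: "'w measure" and E :: "nat \<Rightarrow> 'e measure" and p m :: nat and u :: "nat set"
    and f :: "(nat \<Rightarrow> 'e) \<Rightarrow> 'x::{metric_space, second_countable_topology}"
    and X X' :: "nat \<Rightarrow> 'w \<Rightarrow> 'e"
    and T :: "(nat \<Rightarrow> 'x) \<Rightarrow> 'x \<Rightarrow> real"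
    and S :: "'s measure" and ZZ :: "nat \<Rightarrow> 's \<Rightarrow> 'x \<times> 'x"
    and g :: "real ^ 4" and \<Gamma> :: "real ^ 4 ^ 4" and \<sigma>2 :: real
  assumes "prob_space M"
    and "u \<subseteq> {1..p}"
    and "f \<in> PiM {1..p} E \<rightarrow>\<^sub>M borel"
    and "prob_space.indep_vars M E X {1..p}"
    and "prob_space.indep_var M (PiM {1..p} E) (random_tuple {1..p} X)
           (PiM {1..p} E) (random_tuple {1..p} X')"
    and "distr M (PiM {1..p} E) (random_tuple {1..p} X') =
         distr M (PiM {1..p} E) (random_tuple {1..p} X)"
    and "(\<lambda>(a, x). T a x) \<in> borel_measurable (PiM {1..m} (\<lambda>_. borel) \<Otimes>\<^sub>M borel)"
    and "integrable (PiM {1..m} (\<lambda>_. output_law M p f X) \<Otimes>\<^sub>M output_law M p f X)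
           (\<lambda>(a, x). (T a x)\<^sup>2)"
    and "gms_denominator M p f X m T \<noteq> 0"
    and "prob_space S"
    and "prob_space.indep_vars S (\<lambda>_. borel \<Otimes>\<^sub>M borel) ZZ {1..}"
    and "\<And>i. i \<ge> 1 \<Longrightarrow> distr S (borel \<Otimes>\<^sub>M borel) (ZZ i) = pair_law M p f u X X'"
    and "\<And>j. integrable S (\<lambda>\<omega>. (sample_kernel m T ZZ j \<omega>)\<^sup>2)"
    and "\<Gamma> = Gamma_matrix S m T ZZ"
    and "g = grad_Psi (kernel_means m T (pair_law M p f u X X'))"
    and "\<sigma>2 = g \<bullet> (\<Gamma> *v g)"
  shows "weak_conv_m
           (\<lambda>N. distr S borel
             (\<lambda>\<omega>. sqrt (real N) * (estimator m T N (\<lambda>i. ZZ i \<omega>) - gms_index M E p f u X m T)))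
           (centered_gaussian \<sigma>2)"
proof -
  interpret M: pick_freeze_model M E p m u f X X' T
    using assms(1-8) by (intro pick_freeze_model.intro pick_freeze_model_axioms.intro)
  interpret S: prob_space S by fact
  have sets_Q: "sets M.Q = sets (borel \<Otimes>\<^sub>M borel)" by (rule M.Q.sets_Q)
  have iid: "iid_sample M.Q S ZZ"
  proof (intro iid_sample.intro iid_sample_axioms.intro M.Q.Q.prob_space_axioms S.prob_space_axioms)
    show "S.indep_vars (\<lambda>_. M.Q) ZZ {1..}"
      using assms(11) sets_Q by (simp add: S.indep_vars_def2 cong: measurable_cong_sets)
    show "distr S M.Q (ZZ i) = M.Q" if "i \<ge> 1" for i
      using assms(12)[OF that] distr_cong[OF refl sets_Q, of S "ZZ i" "ZZ i"] by simp
  qed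
  have "pick_freeze_sample M.Q M.P m T S ZZ"
  proof (intro pick_freeze_sample.intro pick_freeze_sample_axioms.intro iid M.test_function_pairs)
    fix j
    have "sym_kernel m T j \<in> borel_measurable (PiM {1..arity m j} (\<lambda>_. M.Q))"
      unfolding sym_kernel_def
      by (rule symmetrize_measurable[OF M.Q.Q.prob_space_axioms M.Q.kernel_measurable])
    hence "(\<lambda>z. (sym_kernel m T j z)\<^sup>2) \<in> borel_measurable (PiM {1..arity m j} (\<lambda>_. M.Q))" by measurable
    moreover have "id ` {1..arity m j} \<subseteq> {1..}" by auto
    ultimately show "integrable (PiM {1..arity m j} (\<lambda>_. M.Q)) (\<lambda>z. (sym_kernel m T j z)\<^sup>2)"
      using iid_sample.sample_integral(2)[OF iid inj_on_id, of "{1..arity m j}" "\<lambda>z. (sym_kernel m T j z)\<^sup>2"]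
        assms(13)[of j]
      by (simp add: sample_kernel_def)
  next
    show "0 < kernel_means m T M.Q $ 3 - kernel_means m T M.Q $ 4"
      using assms(9) M.denominator_nonneg M.denominator_eq by linarith
  qed
  from pick_freeze_sample.estimator_clt[OF this]
  show ?thesis unfolding assms(14-16) M.index_eq_Psi .
qed

end
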